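(* Let $\widehat u\in V$ and $0\le s\le m$ be such that $DG_{\mathrm{pw}}(\widehat u)\in L(V_{\mathrm{pw}};H^{-s}(\Omega))$, and let $C_{\beta,1},C_{\beta,2},C_{\beta,3}>0$ satisfy $$\|DG_{\mathrm{pw}}(\widehat u;v_{\mathrm{nc}})\|_{s,*}\le C_{\beta,1}|||v_{\mathrm{nc}}|||_{\mathrm{pw}},$$ $$\|DG_{\mathrm{pw}}(\widehat u;(1-I)v)\|_{s,*}\le C_{\beta,2}|||(1-I)v|||_{\mathrm{pw}},$$ $$|||DG_{\mathrm{pw}}(\widehat u;(1-I)v)|||_*\le C_{\beta,3}|||(1-I)v|||_{\mathrm{pw}}$$ for all $v\in V$ and $v_{\mathrm{nc}}\in V_{\mathrm{nc}}$. Let $$\widehat\beta_h\coloneqq\inf_{0\ne w_{\mathrm{nc}}\in V_{\mathrm{nc}}}\sup_{0\ne\varphi_{\mathrm{nc}}\in V_{\mathrm{nc}}}\frac{DN_h(\widehat u;w_{\mathrm{nc}},\varphi_{\mathrm{nc}})}{|||w_{\mathrm{nc}}|||_{\mathrm{pw}}|||\varphi_{\mathrm{nc}}|||_{\mathrm{pw}}},$$ $C_{\beta,\mathcal T}\coloneqq\kappa(\mathcal T,s)C_{\beta,2}+C_{\beta,3}\|J\|$, and define $M,N_2\in\mathbb R^{2\times2}$ by $$N_2\coloneqq\begin{pmatrix}1&C_{\beta,\mathcal T}\\0&\widehat\beta_h\end{pmatrix},\qquad M\coloneqq\begin{pmatrix}(1+C_{\beta,\mathcal T})C_{\beta,1}&C_{\beta,\mathcal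 T}C_{\beta,2}\\ \widehat\beta_hC_{\beta,1}&\widehat\beta_hC_{\beta,2}\end{pmatrix}.$$ (a) Suppose $\kappa(\mathcal T,s)\|M\|_2<\widehat\beta_h$. Then $DN(\widehat u)$ satisfies the inf--sup condition $$\widehat\beta_0\coloneqq\frac{\widehat\beta_h-\kappa(\mathcal T,s)\|M\|_2}{\|N_2\|_2}\le\inf_{0\ne v\in V}\sup_{0\ne\varphi\in V}\frac{DN(\widehat u;v,\varphi)}{|||v|||\,|||\varphi|||}.$$ (b) If additionally $0\le s<m$, then $DN(\widehat u)\in L(V;V^* )$ is bijective (so $DN(\widehat u)$ is invertible and fulfils the inf--sup condition with the constant $\widehat\beta_0$ from (a)).
   Context: $\Omega\subset\mathbb R^n$, $n\ge2$, is a bounded Lipschitz domain, $m\in\mathbb N$, $V=H^m_0(\Omega)$ with scalar product $a(v,w)=(D^mv,D^mw)_{L^2(\Omega)}$, norm $|||\cdot|||$, and dual $V^*$ with operator norm $|||\cdot|||_*$; $(-\Delta)^m:V\to V^*$ is the isometry $v\mapsto a(v,\cdot)$. For $0\le s\le m$, $H^s_0(\Omega)$ carries a Hilbert norm $\|\cdot\|_s$ equivalent to $\|\cdot\|_{H^s(\Omega)}$, and $H^{-s}(\Omega)\subset V^*$ is its dual with operator norm $\|\cdot\|_{s,*}$. $G\in C^1(V;V^* )$ is a compact nonlinear operator, $F\in V^*$, and $N(v)\coloneqq a(v,\cdot)+G(v)-F\in V^*$, so $DN(u;v,\varphi)=a(v,\varphi)+DG(u;v,\varphi)$ for $u,v,\varphi\in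 V$. Discretisation: $V_{\mathrm{nc}}\ne\{0\}$ is a finite-dimensional space (in general $\not\subset V$) associated with a triangulation $\mathcal T$ of $\Omega$; $V_{\mathrm{pw}}=V+V_{\mathrm{nc}}$; $a_{\mathrm{pw}}$ is a semi-scalar product on $V_{\mathrm{pw}}$ extending $a$, with seminorm $|||\cdot|||_{\mathrm{pw}}$, and a scalar product on $V_{\mathrm{nc}}$. The interpolation $I\in L(V;V_{\mathrm{nc}})$ satisfies $a_{\mathrm{pw}}(v-Iv,v_{\mathrm{nc}})=0$ for all $v\in V,v_{\mathrm{nc}}\in V_{\mathrm{nc}}$. The smoother $J:V_{\mathrm{nc}}\to V$ is linear with $IJ=\mathrm{id}$ on $V_{\mathrm{nc}}$ and $|||v_{\mathrm{nc}}-Jv_{\mathrm{nc}}|||_{\mathrm{pw}}\le\Lambda_J\min_{v\in V}|||v-v_{\mathrm{nc}}|||_{\mathrm{pw}}$ for all $v_{\mathrm{nc}}\in V_{\mathrm{nc}}$ and some $\Lambda_J>0$; $\|J\|$ is the operator norm of $J:(V_{\mathrm{nc}},|||\cdot|||_{\mathrm{pw}})\to(V,|||\cdot|||)$. $G_{\mathrm{pw}}\in C^1(V_{\mathrm{pw}};V^* )$ extends $G=G_{\mathrm{pw}}|_V$, and $N_h:V_{\mathrm{pw}}\to V_{\mathrm{nc}}^*$ is $N_h(v_{\mathrm{pw}};\varphi_{\mathrm{nc}})\coloneqq a_{\mathrm{pw}}(v_{\mathrm{pw}},\varphi_{\mathrm{nc}})+G_{\mathrm{pw}}(v_{\mathrm{pw}};J\varphi_{\mathrm{nc}})-F(J\varphi_{\mathrm{nc}})$,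 so that $DN_h(\widehat u;w_{\mathrm{nc}},\varphi_{\mathrm{nc}})=a_{\mathrm{pw}}(w_{\mathrm{nc}},\varphi_{\mathrm{nc}})+DG_{\mathrm{pw}}(\widehat u;w_{\mathrm{nc}},J\varphi_{\mathrm{nc}})$. Here $DG_{\mathrm{pw}}(\widehat u;w)\in V^*$ denotes the derivative at $\widehat u$ in direction $w\in V_{\mathrm{pw}}$ and $DG_{\mathrm{pw}}(\widehat u;w,\varphi)$ its value at $\varphi$. $\kappa(\mathcal T,s)>0$ denotes a constant such that $|||z-z_{\mathrm{nc}}|||_{\mathrm{pw}}\le\kappa(\mathcal T,s)\|\Phi\|_{s,*}$ for all $\Phi\in H^{-s}(\Omega)$, where $z\in V$ solves $(-\Delta)^mz=\Phi$ and $z_{\mathrm{nc}}\in V_{\mathrm{nc}}$ solves $a_{\mathrm{pw}}(z_{\mathrm{nc}},v_{\mathrm{nc}})=\Phi(Jv_{\mathrm{nc}})$ for all $v_{\mathrm{nc}}\in V_{\mathrm{nc}}$. $\|\cdot\|_2$ is the spectral norm on $\mathbb R^{2\times2}$. *)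

theory Defs
  imports "HOL-Analysis.Analysis"
begin

section \<open>Measurable functions modulo almost everywhere equality\<close>

text \<open>
  All function spaces below live in the vector space of measurable real functions on the whole
  space modulo equality almost everywhere.  A function on an open set \<open>\<Omega>\<close> is represented by its
  extension by zero.  Borel representatives lose nothing, because every Lebesgue measurable
  function agrees almost everywhere with a Borel measurable one.
\<close>

quotient_type (overloaded) 'n lfun = "(real^('n::finite)) \<Rightarrow> real" / partial:
  "\<lambda>f g. f \<in> borel_measurable borel \<and> g \<in> borel_measurable borel \<and> (AE x in lborel. f x = g x)"
proof (rule part_equivpI)
  show "\<exists>f::(real^'n) \<Rightarrow> real. f \<in> borel_measurable borel \<and> f \<in> borel_measurable borel
          \<and> (AE x in lborel. f x = f x)"
    by (rule exI[of _ "\<lambda>_. 0"]) auto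
next
  show "symp (\<lambda>f g :: (real^'n) \<Rightarrow> real. f \<in> borel_measurable borel \<and> g \<in> borel_measurable borel
          \<and> (AE x in lborel. f x = g x))"
    by (rule sympI) (auto simp: eq_commute)
next
  show "transp (\<lambda>f g :: (real^'n) \<Rightarrow> real. f \<in> borel_measurable borel \<and> g \<in> borel_measurable borel
          \<and> (AE x in lborel. f x = g x))"
    by (rule transpI) (auto elim: AE_mp)
qed

instantiation lfun :: (finite) real_vector
begin

lift_definition zero_lfun :: "'a lfun" is "\<lambda>_. 0" by simp

lift_definition plus_lfun :: "'a lfun \<Rightarrow> 'a lfun \<Rightarrow> 'a lfun" is "\<lambda>f g x. f x + g x"
  by (auto elim!: AE_mp)

lift_definition minus_lfun :: "'a lfun \<Rightarrow> 'a lfun \<Rightarrow> 'a lfun" is "\<lambda>f g x. f x - g x"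
  by (auto elim!: AE_mp)

lift_definition uminus_lfun :: "'a lfun \<Rightarrow> 'a lfun" is "\<lambda>f x. - f x"
  by auto

lift_definition scaleR_lfun :: "real \<Rightarrow> 'a lfun \<Rightarrow> 'a lfun" is "\<lambda>c f x. c * f x"
  by (auto elim!: AE_mp)

instance
  by standard (transfer; auto simp: algebra_simps intro!: borel_measurable_add
    borel_measurable_diff borel_measurable_times)+

end

definition L0 :: "(real^'n) set \<Rightarrow> 'n lfun set" where
  "L0 \<Omega> = {u. AE x in lborel. x \<notin> \<Omega> \<longrightarrow> rep_lfun u x = 0}"

definition L2 :: "(real^'n) set \<Rightarrow> 'n lfun set" where
  "L2 \<Omega> = {u \<in> L0 \<Omega>. set_integrable lborel \<Omega> (\<lambda>x. (rep_lfun u x)\<^sup>2)}"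

definition ip_L2 :: "(real^'n) set \<Rightarrow> 'n lfun \<Rightarrow> 'n lfun \<Rightarrow> real" where
  "ip_L2 \<Omega> u v = set_lebesgue_integral lborel \<Omega> (\<lambda>x. rep_lfun u x * rep_lfun v x)"

section \<open>Domains and triangulations\<close>

text \<open>
  Near each boundary point, \<open>\<Omega>\<close> lies on one side of the graph of a Lipschitz function \<open>\<gamma>\<close> over
  the hyperplane orthogonal to a unit vector \<open>\<nu>\<close>; \<open>\<gamma>\<close> is only evaluated at the orthogonal
  projection \<open>y - (y \<bullet> \<nu>) \<nu>\<close>.
\<close>

definition bounded_lipschitz_domain :: "(real^'n) set \<Rightarrow> bool" where
  "bounded_lipschitz_domain \<Omega> \<longleftrightarrow>
     open \<Omega> \<and> connected \<Omega> \<and> \<Omega> \<noteq> {} \<and> bounded \<Omega> \<and>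
     (\<forall>x \<in> frontier \<Omega>. \<exists>r>0. \<exists>\<nu>. \<exists>L. \<exists>\<gamma> :: real^'n \<Rightarrow> real.
        norm \<nu> = 1 \<and> L-lipschitz_on {y. y \<bullet> \<nu> = 0} \<gamma> \<and>
        \<Omega> \<inter> ball x r = {y \<in> ball x r. \<gamma> (y - (y \<bullet> \<nu>) *\<^sub>R \<nu>) < y \<bullet> \<nu>})"

text \<open>
  Triangulations in the general sense of Ciarlet: the cells are not required to be simplices, so
  that domains with a curved boundary are not excluded.
\<close>

definition triangulation_of :: "(real^'n) set set \<Rightarrow> (real^'n) set \<Rightarrow> bool" where
  "triangulation_of \<T> \<Omega> \<longleftrightarrow>
     finite \<T> \<and> \<Union>\<T> = closure \<Omega> \<and> (\<forall>K\<in>\<T>. closed K \<and> interior K \<noteq> {}) \<and>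
     (\<forall>K\<in>\<T>. \<forall>K'\<in>\<T>. K \<noteq> K' \<longrightarrow> interior K \<inter> interior K' = {})"

section \<open>Sobolev spaces\<close>

text \<open>
  Derivatives of order \<open>k\<close> are indexed by the lists of coordinate directions of length \<open>k\<close> rather
  than by multi-indices.  They are the entries of the derivative tensor \<open>D\<^sup>k v\<close>, so that
  summing the products of all of them yields the Frobenius product of these tensors.
\<close>

fun iter_pd :: "'n list \<Rightarrow> (real^('n::finite) \<Rightarrow> real) \<Rightarrow> real^'n \<Rightarrow> real" where
  "iter_pd [] f = f"
| "iter_pd (i # is) f = (\<lambda>x. frechet_derivative (iter_pd is f) (at x) (axis i 1))"

definition smooth :: "(real^('n::finite) \<Rightarrow> real) \<Rightarrow> bool" where
  "smooth f \<longleftrightarrow> (\<forall>is x. iter_pd is f differentiable (at x))"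

definition test_functions :: "(real^('n::finite)) set \<Rightarrow> (real^'n \<Rightarrow> real) set" where
  "test_functions \<Omega> =
     {f. smooth f \<and> compact (closure {x. f x \<noteq> 0}) \<and> closure {x. f x \<noteq> 0} \<subseteq> \<Omega>}"

definition is_weak_deriv :: "(real^('n::finite)) set \<Rightarrow> 'n list \<Rightarrow> 'n lfun \<Rightarrow> 'n lfun \<Rightarrow> bool" where
  "is_weak_deriv \<Omega> is u g \<longleftrightarrow>
     (\<forall>f \<in> test_functions \<Omega>.
        set_lebesgue_integral lborel \<Omega> (\<lambda>x. rep_lfun u x * iter_pd is f x)
        = (-1) ^ length is * set_lebesgue_integral lborel \<Omega> (\<lambda>x. rep_lfun g x * f x))"

definition weak_deriv :: "(real^('n::finite)) set \<Rightarrow> 'n list \<Rightarrow> 'n lfun \<Rightarrow> 'n lfun" where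
  "weak_deriv \<Omega> is u = (THE g. g \<in> L2 \<Omega> \<and> is_weak_deriv \<Omega> is u g)"

definition gagliardo :: "(real^('n::finite)) set \<Rightarrow> real \<Rightarrow> 'n lfun \<Rightarrow> ennreal" where
  "gagliardo \<Omega> \<sigma> g =
     (\<integral>\<^sup>+ x \<in> \<Omega>. (\<integral>\<^sup>+ y \<in> \<Omega>.
        ennreal ((rep_lfun g x - rep_lfun g y)\<^sup>2 / norm (x - y) powr (real CARD('n) + 2 * \<sigma>))
        \<partial>lborel) \<partial>lborel)"

text \<open>
  The Sobolev--Slobodeckij space \<open>H\<^sup>s(\<Omega>)\<close> for \<open>s \<ge> 0\<close>.  The Gagliardo seminorm of the
  derivatives of order \<open>\<lfloor>s\<rfloor>\<close> is present only if \<open>s\<close> is not an integer.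
\<close>

definition Sobolev :: "(real^('n::finite)) set \<Rightarrow> real \<Rightarrow> 'n lfun set" where
  "Sobolev \<Omega> s =
     {u \<in> L2 \<Omega>.
        (\<forall>is. length is \<le> nat \<lfloor>s\<rfloor> \<longrightarrow> (\<exists>g \<in> L2 \<Omega>. is_weak_deriv \<Omega> is u g)) \<and>
        (frac s \<noteq> 0 \<longrightarrow>
          (\<forall>is. length is = nat \<lfloor>s\<rfloor> \<longrightarrow> gagliardo \<Omega> (frac s) (weak_deriv \<Omega> is u) < \<infinity>))}"

definition sobolev_norm :: "(real^('n::finite)) set \<Rightarrow> real \<Rightarrow> 'n lfun \<Rightarrow> real" where
  "sobolev_norm \<Omega> s u =
     sqrt ((\<Sum>is | length is \<le> nat \<lfloor>s\<rfloor>. ip_L2 \<Omega> (weak_deriv \<Omega> is u) (weak_deriv \<Omega> is u)) +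
       (if frac s = 0 then 0
        else (\<Sum>is | length is = nat \<lfloor>s\<rfloor>. enn2real (gagliardo \<Omega> (frac s) (weak_deriv \<Omega> is u)))))"

text \<open>\<open>H\<^sup>s\<^sub>0(\<Omega>)\<close> is the closure of the test functions in \<open>H\<^sup>s(\<Omega>)\<close>.\<close>

definition Sobolev0 :: "(real^('n::finite)) set \<Rightarrow> real \<Rightarrow> 'n lfun set" where
  "Sobolev0 \<Omega> s =
     {u \<in> Sobolev \<Omega> s. \<forall>\<epsilon>>0. \<exists>f \<in> test_functions \<Omega>. sobolev_norm \<Omega> s (u - abs_lfun f) < \<epsilon>}"

text \<open>The scalar product \<open>(D\<^sup>m v, D\<^sup>m w)\<close> in \<open>L\<^sup>2(\<Omega>)\<close>.\<close>

definition energy_ip :: "(real^('n::finite)) set \<Rightarrow> nat \<Rightarrow> 'n lfun \<Rightarrow> 'n lfun \<Rightarrow> real" where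
  "energy_ip \<Omega> m v w = (\<Sum>is | length is = m. ip_L2 \<Omega> (weak_deriv \<Omega> is v) (weak_deriv \<Omega> is w))"

section \<open>Linear functional analysis on subspaces\<close>

text \<open>
  A (semi-)normed space is given by a subspace \<open>X\<close> of a real vector space together with a
  (semi-)norm \<open>p\<close>, whose values outside \<open>X\<close> are irrelevant.  Functionals and operators on \<open>X\<close> are
  total functions.  Those in \<open>dual\<close> and \<open>bounded_ops\<close> vanish outside \<open>X\<close>, so that equality of
  functions is equality on \<open>X\<close>.
\<close>

definition lin_on :: "'e::real_vector set \<Rightarrow> ('e \<Rightarrow> 'f::real_vector) \<Rightarrow> bool" where
  "lin_on X f \<longleftrightarrow>
     (\<forall>x\<in>X. \<forall>y\<in>X. f (x + y) = f x + f y) \<and> (\<forall>c. \<forall>x\<in>X. f (c *\<^sub>R x) = c *\<^sub>R f x)"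

definition semi_ip_on :: "'e::real_vector set \<Rightarrow> ('e \<Rightarrow> 'e \<Rightarrow> real) \<Rightarrow> bool" where
  "semi_ip_on X b \<longleftrightarrow>
     (\<forall>y\<in>X. lin_on X (\<lambda>x. b x y)) \<and> (\<forall>x\<in>X. \<forall>y\<in>X. b x y = b y x) \<and> (\<forall>x\<in>X. 0 \<le> b x x)"

definition ip_on :: "'e::real_vector set \<Rightarrow> ('e \<Rightarrow> 'e \<Rightarrow> real) \<Rightarrow> bool" where
  "ip_on X b \<longleftrightarrow> semi_ip_on X b \<and> (\<forall>x\<in>X. b x x = 0 \<longrightarrow> x = 0)"

definition ip_norm :: "('e \<Rightarrow> 'e \<Rightarrow> real) \<Rightarrow> 'e \<Rightarrow> real" where
  "ip_norm b x = sqrt (b x x)"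

definition complete_on :: "'e::real_vector set \<Rightarrow> ('e \<Rightarrow> real) \<Rightarrow> bool" where
  "complete_on X p \<longleftrightarrow>
     (\<forall>u :: nat \<Rightarrow> 'e. (\<forall>k. u k \<in> X) \<and> (\<forall>\<epsilon>>0. \<exists>K. \<forall>j\<ge>K. \<forall>k\<ge>K. p (u j - u k) < \<epsilon>) \<longrightarrow>
        (\<exists>x\<in>X. (\<lambda>k. p (u k - x)) \<longlonglongrightarrow> 0))"

definition hilbert_norm_on :: "'e::real_vector set \<Rightarrow> ('e \<Rightarrow> real) \<Rightarrow> bool" where
  "hilbert_norm_on X p \<longleftrightarrow> (\<exists>b. ip_on X b \<and> (\<forall>x\<in>X. p x = ip_norm b x)) \<and> complete_on X p"

definition equivalent_norms_on :: "'e set \<Rightarrow> ('e \<Rightarrow> real) \<Rightarrow> ('e \<Rightarrow> real) \<Rightarrow> bool" where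
  "equivalent_norms_on X p q \<longleftrightarrow> (\<exists>c>0. \<exists>C>0. \<forall>x\<in>X. c * q x \<le> p x \<and> p x \<le> C * q x)"

definition dual :: "'e::real_vector set \<Rightarrow> ('e \<Rightarrow> real) \<Rightarrow> ('e \<Rightarrow> real) set" where
  "dual X p =
     {\<Phi>. lin_on X \<Phi> \<and> (\<exists>C. \<forall>x\<in>X. \<bar>\<Phi> x\<bar> \<le> C * p x) \<and> (\<forall>x. x \<notin> X \<longrightarrow> \<Phi> x = 0)}"

definition dual_norm :: "'e set \<Rightarrow> ('e \<Rightarrow> real) \<Rightarrow> ('e \<Rightarrow> real) \<Rightarrow> real" where
  "dual_norm X p \<Phi> = (SUP x\<in>{x \<in> X. p x \<le> 1}. \<bar>\<Phi> x\<bar>)"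

definition op_norm :: "'e set \<Rightarrow> ('e \<Rightarrow> real) \<Rightarrow> ('f \<Rightarrow> real) \<Rightarrow> ('e \<Rightarrow> 'f) \<Rightarrow> real" where
  "op_norm X p q A = (SUP x\<in>{x \<in> X. p x \<le> 1}. q (A x))"

text \<open>Bounded linear operators from \<open>X\<close> to the dual of \<open>Y\<close>.\<close>

definition bounded_ops ::
  "'e::real_vector set \<Rightarrow> ('e \<Rightarrow> real) \<Rightarrow> 'f::real_vector set \<Rightarrow> ('f \<Rightarrow> real) \<Rightarrow> ('e \<Rightarrow> 'f \<Rightarrow> real) set"
where
  "bounded_ops X p Y q =
     {A. (\<forall>x\<in>X. A x \<in> dual Y q) \<and> (\<forall>\<phi>\<in>Y. lin_on X (\<lambda>x. A x \<phi>)) \<and>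
         (\<exists>C. \<forall>x\<in>X. dual_norm Y q (A x) \<le> C * p x) \<and> (\<forall>x. x \<notin> X \<longrightarrow> A x = (\<lambda>_. 0))}"

text \<open>
  For \<open>V\<close> dense in \<open>H\<close>, a functional \<open>\<Phi>\<close> in the dual of \<open>V\<close> belongs to the dual of \<open>H\<close> iff it
  has an extension in the dual of \<open>H\<close>, which is then unique; its norm as an element of the dual
  of \<open>H\<close> is the operator norm of this extension.
\<close>

definition sub_dual ::
  "'e::real_vector set \<Rightarrow> ('e \<Rightarrow> real) \<Rightarrow> 'e set \<Rightarrow> ('e \<Rightarrow> real) \<Rightarrow> ('e \<Rightarrow> real) set" where
  "sub_dual V p H q = {\<Phi> \<in> dual V p. \<exists>\<Psi> \<in> dual H q. \<forall>v\<in>V. \<Psi> v = \<Phi> v}"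

definition sub_dual_norm ::
  "'e::real_vector set \<Rightarrow> 'e set \<Rightarrow> ('e \<Rightarrow> real) \<Rightarrow> ('e \<Rightarrow> real) \<Rightarrow> real" where
  "sub_dual_norm V H q \<Phi> = dual_norm H q (THE \<Psi>. \<Psi> \<in> dual H q \<and> (\<forall>v\<in>V. \<Psi> v = \<Phi> v))"

section \<open>Nonlinear maps into dual spaces\<close>

definition has_fderiv ::
  "'e::real_vector set \<Rightarrow> ('e \<Rightarrow> real) \<Rightarrow> 'f::real_vector set \<Rightarrow> ('f \<Rightarrow> real) \<Rightarrow>
   ('e \<Rightarrow> 'f \<Rightarrow> real) \<Rightarrow> 'e \<Rightarrow> ('e \<Rightarrow> 'f \<Rightarrow> real) \<Rightarrow> bool" where
  "has_fderiv X p Y q T u A \<longleftrightarrow>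
     A \<in> bounded_ops X p Y q \<and>
     (\<forall>\<epsilon>>0. \<exists>\<delta>>0. \<forall>h\<in>X. p h < \<delta> \<longrightarrow>
        dual_norm Y q (\<lambda>\<phi>. T (u + h) \<phi> - T u \<phi> - A h \<phi>) \<le> \<epsilon> * p h)"

definition fderiv ::
  "'e::real_vector set \<Rightarrow> ('e \<Rightarrow> real) \<Rightarrow> 'f::real_vector set \<Rightarrow> ('f \<Rightarrow> real) \<Rightarrow>
   ('e \<Rightarrow> 'f \<Rightarrow> real) \<Rightarrow> 'e \<Rightarrow> 'e \<Rightarrow> 'f \<Rightarrow> real" where
  "fderiv X p Y q T u = (THE A. has_fderiv X p Y q T u A)"

definition C1_map ::
  "'e::real_vector set \<Rightarrow> ('e \<Rightarrow> real) \<Rightarrow> 'f::real_vector set \<Rightarrow> ('f \<Rightarrow> real) \<Rightarrow>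
   ('e \<Rightarrow> 'f \<Rightarrow> real) \<Rightarrow> bool" where
  "C1_map X p Y q T \<longleftrightarrow>
     (\<forall>u\<in>X. T u \<in> dual Y q) \<and> (\<forall>u\<in>X. \<exists>A. has_fderiv X p Y q T u A) \<and>
     (\<forall>u\<in>X. \<forall>\<epsilon>>0. \<exists>\<delta>>0. \<forall>v\<in>X. p (v - u) < \<delta> \<longrightarrow>
        (\<forall>h\<in>X. dual_norm Y q (\<lambda>\<phi>. fderiv X p Y q T v h \<phi> - fderiv X p Y q T u h \<phi>) \<le> \<epsilon> * p h))"

text \<open>Bounded sets are mapped to relatively compact sets; continuity comes from \<open>C1_map\<close>.\<close>

definition maps_bounded_to_relcompact ::
  "'e::real_vector set \<Rightarrow> ('e \<Rightarrow> real) \<Rightarrow> 'f::real_vector set \<Rightarrow> ('f \<Rightarrow> real) \<Rightarrow>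
   ('e \<Rightarrow> 'f \<Rightarrow> real) \<Rightarrow> bool" where
  "maps_bounded_to_relcompact X p Y q T \<longleftrightarrow>
     (\<forall>v :: nat \<Rightarrow> 'e. (\<forall>k. v k \<in> X) \<and> (\<exists>C. \<forall>k. p (v k) \<le> C) \<longrightarrow>
        (\<exists>r \<Phi>. strict_mono r \<and> \<Phi> \<in> dual Y q \<and>
           (\<lambda>k. dual_norm Y q (\<lambda>\<phi>. T (v (r k)) \<phi> - \<Phi> \<phi>)) \<longlonglongrightarrow> 0))"

text \<open>
  The operators \<open>N\<close> and \<open>N\<^sub>h\<close>.  The case distinctions only make the values elements of \<open>dual\<close>.
\<close>

definition N_op ::
  "'e set \<Rightarrow> ('e \<Rightarrow> 'e \<Rightarrow> real) \<Rightarrow> ('e \<Rightarrow> 'e \<Rightarrow> real) \<Rightarrow> ('e \<Rightarrow> real) \<Rightarrow> 'e \<Rightarrow> 'e \<Rightarrow> real" where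
  "N_op V a G F v = (\<lambda>\<phi>. if \<phi> \<in> V then a v \<phi> + G v \<phi> - F \<phi> else 0)"

definition Nh_op ::
  "'e set \<Rightarrow> ('e \<Rightarrow> 'e \<Rightarrow> real) \<Rightarrow> ('e \<Rightarrow> 'e \<Rightarrow> real) \<Rightarrow> ('e \<Rightarrow> real) \<Rightarrow> ('e \<Rightarrow> 'e) \<Rightarrow>
   'e \<Rightarrow> 'e \<Rightarrow> real" where
  "Nh_op V\<^sub>n\<^sub>c a\<^sub>p\<^sub>w G\<^sub>p\<^sub>w F J v =
     (\<lambda>\<phi>. if \<phi> \<in> V\<^sub>n\<^sub>c then a\<^sub>p\<^sub>w v \<phi> + G\<^sub>p\<^sub>w v (J \<phi>) - F (J \<phi>) else 0)"

definition inf_sup :: "'e::zero set \<Rightarrow> ('e \<Rightarrow> real) \<Rightarrow> ('e \<Rightarrow> 'e \<Rightarrow> real) \<Rightarrow> real" where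
  "inf_sup X p B = (INF w\<in>X - {0}. SUP \<phi>\<in>X - {0}. B w \<phi> / (p w * p \<phi>))"

definition spectral_norm :: "real^2^2 \<Rightarrow> real" where
  "spectral_norm A = onorm (\<lambda>x. A *v x)"

end

theory Submission
  imports Defs
begin

text \<open>
  Let \<open>z1\<close>, \<open>z2\<close> represent \<open>DG (I v)\<close> and \<open>DG (v - I v)\<close> in \<open>V\<close>, so that \<open>t = v + z1 + z2\<close> represents
  \<open>DN v\<close>.  Since \<open>I\<close> is the orthogonal projection onto the discrete space, \<open>\<kappa>\<close> bounds both
  \<open>z - I z\<close> and the distance of \<open>I z\<close> from the discrete solution.  The discrete inf-sup condition at
  \<open>I v\<close> and the triangle inequality then bound \<open>\<beta>\<^sub>h (|I v|, |v - I v|)\<close> componentwise by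
  \<open>N2 (|I t|, |t - I t|) + \<kappa> M (|I v|, |v - I v|)\<close>, and Pythagoras turns this into a lower bound for
  \<open>|t| / |v|\<close>.  So \<open>v \<mapsto> t\<close> is bounded below, and it is a compact perturbation of the identity because the
  derivative of the compact map \<open>G\<close> is compact; hence it is onto.

  Riesz representation needs \<open>V\<close> to be a Hilbert space for the energy product.  This follows from the
  completeness of \<open>L2\<close>, the uniqueness of weak derivatives (tested with smooth bumps on boxes), and
  the Friedrichs inequality.
\<close>

section \<open>Riesz representation and compact perturbations of the identity\<close>

text \<open>The obstacle is that the discrete inf-sup condition sees only \<open>I v\<close>, and
  only through \<open>J\<close>: the discrete representer \<open>n1\<close> of
  \<open>DG (I v)\<close> composed with \<open>J\<close> is not \<open>I z1\<close>. The constant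
  \<kappa> closes this gap. About \<open>v - I v\<close> there is no discrete information, but it
  equals \<open>(t - I t) - (z1 - I z1) - (z2 - I z2)\<close>, where both terms with
  \<open>z\<close> carry a factor \<kappa> and are perturbations. The term
  \<open>I z2 = (I z2 - n2) + n2\<close> carries no such factor as a whole: \<open>n2\<close> is
  controlled only by \<open>C3\<close> and the norm of \<open>J\<close>. This is the origin of
  \<open>C\<^sub>T\<close>, a constant that multiplies |v - I v| and need not be small. Hence the
  estimate of |v - I v| is substituted into that of |I v|. The substitution creates the off-diagonal
  entry of \<open>N2\<close> and the \<open>C\<^sub>T\<close> terms of \<open>M\<close>, and leaves
  \<kappa> in front of all of \<open>M\<close>. Multiplying the estimate of |v - I v| by the
  discrete constant gives the second rows. A lower bound alone yields injectivity and closed range,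
  not surjectivity; a separate compactness argument is needed for that.\<close>

lemma quadratic_nonneg_discrim:
  fixes p q r :: real
  assumes nonneg: "\<And>t. 0 \<le> p + 2 * t * q + t\<^sup>2 * r" and r: "0 \<le> r"
  shows "q\<^sup>2 \<le> p * r"
proof (cases "r = 0")
  case True
  have "q = 0"
  proof (rule ccontr)
    assume "q \<noteq> 0"
    \<comment> \<open>With \<open>r = 0\<close> the expression is affine in \<open>t\<close>; at
      this \<open>t\<close> its value is -1.\<close>
    then show False using nonneg[of "- (p + 1) / (2 * q)"] True by (simp add: field_simps)
  qed
  then show ?thesis using True by simp
next
  case False
  then have "0 < r" using r by simp
  then have "p + 2 * (- q / r) * q + (- q / r)\<^sup>2 * r = (p * r - q\<^sup>2) / r"
    by (simp add: field_simps power2_eq_square)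
  then have "0 \<le> (p * r - q\<^sup>2) / r" using nonneg[of "- q / r"] by simp
  then show ?thesis using \<open>0 < r\<close> by (simp add: zero_le_divide_iff)
qed

lemma lin_on_add: "lin_on X f \<Longrightarrow> x \<in> X \<Longrightarrow> y \<in> X \<Longrightarrow> f (x + y) = f x + f y"
  and lin_on_scale: "lin_on X f \<Longrightarrow> x \<in> X \<Longrightarrow> f (c *\<^sub>R x) = c *\<^sub>R f x"
  by (auto simp: lin_on_def)

lemma lin_on_diff:
  assumes "subspace X" "lin_on X f" "x \<in> X" "y \<in> X"
  shows "f (x - y) = f x - f y"
proof -
  have "f (x + (-1) *\<^sub>R y) = f x + (-1) *\<^sub>R f y"
    using assms by (simp only: lin_on_add lin_on_scale subspace_scale)
  then show ?thesis by simp
qed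

lemma lin_on_0: "subspace X \<Longrightarrow> lin_on X f \<Longrightarrow> f 0 = 0"
  using lin_on_diff[of X f 0 0] by (simp add: subspace_0)

lemma lin_on_subset: "lin_on X f \<Longrightarrow> Y \<subseteq> X \<Longrightarrow> lin_on Y f"
  unfolding lin_on_def by blast

lemma semi_ip_on_subset: "semi_ip_on X b \<Longrightarrow> Y \<subseteq> X \<Longrightarrow> semi_ip_on Y b"
  unfolding semi_ip_on_def using lin_on_subset by blast

text \<open>Definiteness is postponed to \<open>ip_space\<close>, because
  \<open>a\<^sub>p\<^sub>w\<close> may vanish on nonzero elements of
  \<open>V\<^sub>p\<^sub>w\<close>, and the energy product does so on polynomials of low degree in
  the full Sobolev space.\<close>

locale semi_ip_space =
  fixes X :: "'e::real_vector set" and b :: "'e \<Rightarrow> 'e \<Rightarrow> real"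
  assumes sub: "subspace X" and semi: "semi_ip_on X b"
begin

abbreviation nm :: "'e \<Rightarrow> real" where "nm \<equiv> ip_norm b"

lemma zero_mem [simp]: "0 \<in> X"
  and add_mem [simp]: "x \<in> X \<Longrightarrow> y \<in> X \<Longrightarrow> x + y \<in> X"
  and diff_mem [simp]: "x \<in> X \<Longrightarrow> y \<in> X \<Longrightarrow> x - y \<in> X"
  and scale_mem [simp]: "x \<in> X \<Longrightarrow> c *\<^sub>R x \<in> X"
  and neg_mem [simp]: "x \<in> X \<Longrightarrow> - x \<in> X"
  using sub by (auto intro: subspace_0 subspace_add subspace_diff subspace_scale subspace_neg)

lemma lin_left: "y \<in> X \<Longrightarrow> lin_on X (\<lambda>x. b x y)"
  and sym: "x \<in> X \<Longrightarrow> y \<in> X \<Longrightarrow> b x y = b y x"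
  and nonneg: "x \<in> X \<Longrightarrow> 0 \<le> b x x"
  using semi by (auto simp: semi_ip_on_def)

lemma add_left: "x \<in> X \<Longrightarrow> y \<in> X \<Longrightarrow> z \<in> X \<Longrightarrow> b (x + y) z = b x z + b y z"
  and scale_left: "x \<in> X \<Longrightarrow> z \<in> X \<Longrightarrow> b (c *\<^sub>R x) z = c * b x z"
  and diff_left: "x \<in> X \<Longrightarrow> y \<in> X \<Longrightarrow> z \<in> X \<Longrightarrow> b (x - y) z = b x z - b y z"
  using lin_on_add[OF lin_left] lin_on_scale[OF lin_left] lin_on_diff[OF sub lin_left]
  by auto

lemma add_right: "x \<in> X \<Longrightarrow> y \<in> X \<Longrightarrow> z \<in> X \<Longrightarrow> b z (x + y) = b z x + b z y"
  and scale_right: "x \<in> X \<Longrightarrow> z \<in> X \<Longrightarrow> b z (c *\<^sub>R x) = c * b z x"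
  and diff_right: "x \<in> X \<Longrightarrow> y \<in> X \<Longrightarrow> z \<in> X \<Longrightarrow> b z (x - y) = b z x - b z y"
  using add_left scale_left diff_left by (simp_all add: sym[of z])

lemma lin_right: "x \<in> X \<Longrightarrow> lin_on X (\<lambda>y. b x y)"
  by (simp add: lin_on_def add_right scale_right)

lemmas bilinear = add_left diff_left scale_left add_right diff_right scale_right

lemma nm_nonneg [simp]: "x \<in> X \<Longrightarrow> 0 \<le> nm x"
  by (simp add: ip_norm_def nonneg)

lemma nm_sq: "x \<in> X \<Longrightarrow> (nm x)\<^sup>2 = b x x"
  by (simp add: ip_norm_def nonneg)

lemma b_square: "x \<in> X \<Longrightarrow> y \<in> X \<Longrightarrow> b (x + y) (x + y) = b x x + 2 * b x y + b y y"
  by (simp add: bilinear sym[of y x])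

lemma b_square_diff: "x \<in> X \<Longrightarrow> y \<in> X \<Longrightarrow> b (x - y) (x - y) = b x x - 2 * b x y + b y y"
  by (simp add: bilinear sym[of y x])

lemma Cauchy_Schwarz_sq:
  assumes "x \<in> X" "y \<in> X"
  shows "(b x y)\<^sup>2 \<le> b x x * b y y"
proof (rule quadratic_nonneg_discrim)
  fix t :: real
  have "b (x + t *\<^sub>R y) (x + t *\<^sub>R y) = b x x + 2 * t * b x y + t\<^sup>2 * b y y"
    using assms by (simp add: bilinear sym[of y x] power2_eq_square algebra_simps)
  then show "0 \<le> b x x + 2 * t * b x y + t\<^sup>2 * b y y"
    using nonneg[of "x + t *\<^sub>R y"] assms by simp
qed (use assms nonneg in simp)

lemma Cauchy_Schwarz: "x \<in> X \<Longrightarrow> y \<in> X \<Longrightarrow> \<bar>b x y\<bar> \<le> nm x * nm y"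
  using real_sqrt_le_mono[OF Cauchy_Schwarz_sq] by (simp add: ip_norm_def real_sqrt_mult)

lemma nm_0 [simp]: "nm 0 = 0"
  using scale_left[of 0 0 0] by (simp add: ip_norm_def)

lemma nm_scale: "x \<in> X \<Longrightarrow> nm (c *\<^sub>R x) = \<bar>c\<bar> * nm x"
  by (simp add: ip_norm_def bilinear real_sqrt_mult flip: mult.assoc power2_eq_square)

lemma nm_minus: "x \<in> X \<Longrightarrow> nm (- x) = nm x"
  using nm_scale[of x "-1"] by simp

lemma nm_triangle:
  assumes "x \<in> X" "y \<in> X"
  shows "nm (x + y) \<le> nm x + nm y"
proof (rule power2_le_imp_le)
  have "(nm (x + y))\<^sup>2 \<le> (nm x)\<^sup>2 + 2 * (nm x * nm y) + (nm y)\<^sup>2"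
    using assms Cauchy_Schwarz[of x y] by (simp add: nm_sq b_square)
  then show "(nm (x + y))\<^sup>2 \<le> (nm x + nm y)\<^sup>2" by (simp add: power2_sum)
qed (use assms in simp)

lemma nm_triangle_diff: "x \<in> X \<Longrightarrow> y \<in> X \<Longrightarrow> nm (x - y) \<le> nm x + nm y"
  using nm_triangle[of x "- y"] by (simp add: nm_minus)

lemma nm_diff_commute: "x \<in> X \<Longrightarrow> y \<in> X \<Longrightarrow> nm (x - y) = nm (y - x)"
  using nm_minus[of "x - y"] by simp

text \<open>\<open>dual_norm\<close> is a supremum of reals, so it says something only once the set
  is known to be bounded; membership in \<open>dual\<close> provides this. A vector of seminorm zero
  cannot be normalised, but there the bound in \<open>dual\<close> forces the functional to
  vanish.\<close>

lemma dual_bound: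
  assumes "\<Phi> \<in> dual X nm" "x \<in> X"
  shows "\<bar>\<Phi> x\<bar> \<le> dual_norm X nm \<Phi> * nm x"
proof -
  from assms(1) obtain C where lin: "lin_on X \<Phi>" and C: "\<And>x. x \<in> X \<Longrightarrow> \<bar>\<Phi> x\<bar> \<le> C * nm x"
    unfolding dual_def by blast
  have bdd: "bdd_above ((\<lambda>x. \<bar>\<Phi> x\<bar>) ` {x \<in> X. nm x \<le> 1})"
  proof (intro bdd_aboveI2)
    fix x assume x: "x \<in> {x \<in> X. nm x \<le> 1}"
    have "\<bar>\<Phi> x\<bar> \<le> \<bar>C\<bar> * nm x" using C[of x] x mult_right_mono[OF abs_ge_self[of C], of "nm x"] by simp
    also have "\<dots> \<le> \<bar>C\<bar>" using x by (simp add: mult_left_le)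
    finally show "\<bar>\<Phi> x\<bar> \<le> \<bar>C\<bar>" .
  qed
  show ?thesis
  proof (cases "nm x = 0")
    case True
    then show ?thesis using C[OF assms(2)] by simp
  next
    case False
    then have pos: "0 < nm x" using nm_nonneg[OF assms(2)] by simp
    have "\<bar>\<Phi> ((1 / nm x) *\<^sub>R x)\<bar> \<le> dual_norm X nm \<Phi>"
      unfolding dual_norm_def
      by (rule cSUP_upper[OF _ bdd]) (use assms(2) pos in \<open>simp add: nm_scale\<close>)
    then show ?thesis using pos assms(2) by (simp add: lin_on_scale[OF lin] field_simps abs_mult)
  qed
qed

lemma dual_norm_le:
  assumes "0 \<le> C" "\<And>x. x \<in> X \<Longrightarrow> \<bar>\<Phi> x\<bar> \<le> C * nm x"
  shows "dual_norm X nm \<Phi> \<le> C"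
  unfolding dual_norm_def
proof (rule cSUP_least)
  show "{x \<in> X. nm x \<le> 1} \<noteq> {}" by (auto intro!: exI[of _ 0])
  fix x assume x: "x \<in> {x \<in> X. nm x \<le> 1}"
  then have "C * nm x \<le> C" using assms(1) by (simp add: mult_left_le)
  then show "\<bar>\<Phi> x\<bar> \<le> C" using assms(2)[of x] x by simp
qed

lemma dual_diff:
  assumes "\<Phi> \<in> dual X nm" "\<Psi> \<in> dual X nm"
  shows "(\<lambda>x. \<Phi> x - \<Psi> x) \<in> dual X nm"
proof -
  have "\<bar>\<Phi> x - \<Psi> x\<bar> \<le> (dual_norm X nm \<Phi> + dual_norm X nm \<Psi>) * nm x" if "x \<in> X" for x
    using dual_bound[OF assms(1) that] dual_bound[OF assms(2) that] by (simp add: distrib_right)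
  then have "\<exists>C. \<forall>x\<in>X. \<bar>\<Phi> x - \<Psi> x\<bar> \<le> C * nm x" by blast
  then show ?thesis using assms unfolding dual_def lin_on_def by (simp add: algebra_simps)
qed

text \<open>The representer minimises the functional \<open>x \<mapsto> b x x - 2 * \<Phi> x\<close>, and the parallelogram
  identity makes every minimising sequence a Cauchy sequence.\<close>

theorem Riesz:
  assumes compl: "complete_on X nm" and lin: "lin_on X \<Phi>"
    and bd: "\<And>x. x \<in> X \<Longrightarrow> \<bar>\<Phi> x\<bar> \<le> C * nm x"
  shows "\<exists>z\<in>X. \<forall>x\<in>X. b z x = \<Phi> x"
proof -
  define E where "E x = b x x - 2 * \<Phi> x" for x
  \<comment> \<open>Completing the square: \<open>E x\<close> is at least
    \<open>(nm x)\<^sup>2 - 2 * C * nm x\<close>.\<close>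
  have E_lower: "- C\<^sup>2 \<le> E x" if "x \<in> X" for x
    using bd[OF that] nm_sq[OF that] zero_le_power2[of "nm x - C"]
    by (simp add: E_def power2_diff algebra_simps)
  define d where "d = Inf (E ` X)"
  have bdd: "bdd_below (E ` X)" using E_lower by (auto intro!: bdd_belowI2)
  have d_le: "d \<le> E x" if "x \<in> X" for x
    unfolding d_def by (rule cINF_lower[OF bdd that])
  have "\<exists>x\<in>X. E x < d + 1 / real (Suc k)" for k
  proof -
    have "Inf (E ` X) < d + 1 / real (Suc k)" by (simp add: d_def)
    then show ?thesis using cInf_lessD[of "E ` X"] zero_mem by blast
  qed
  then obtain x where xX: "\<And>k. x k \<in> X" and xE: "\<And>k. E (x k) < d + 1 / real (Suc k)" by metis
  have par: "(nm (y - z))\<^sup>2 \<le> 2 * (E y + E z - 2 * d)" if "y \<in> X" "z \<in> X" for y z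
  proof -
    have "E y + E z = 2 * E ((1/2) *\<^sub>R (y + z)) + (1/2) * (nm (y - z))\<^sup>2"
      using that by (simp add: E_def nm_sq bilinear lin_on_add[OF lin] lin_on_scale[OF lin]
          sym[of z y] algebra_simps)
    moreover have "d \<le> E ((1/2) *\<^sub>R (y + z))" using that by (intro d_le) simp
    ultimately show ?thesis by simp
  qed
  have "\<exists>K. \<forall>j\<ge>K. \<forall>k\<ge>K. nm (x j - x k) < \<epsilon>" if eps: "\<epsilon> > 0" for \<epsilon>
  proof -
    \<comment> \<open>By \<open>par\<close>, the squared distance is below twice the sum of the two
      excesses over \<open>d\<close>; an excess below \<epsilon>-squared over 4 for each is what is
      required.\<close>
    obtain K :: nat where K: "4 / \<epsilon>\<^sup>2 < real K" using reals_Archimedean2 by blast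
    have "nm (x j - x k) < \<epsilon>" if "j \<ge> K" "k \<ge> K" for j k
    proof (rule power_less_imp_less_base)
      have small: "1 / real (Suc i) < \<epsilon>\<^sup>2 / 4" if "i \<ge> K" for i
      proof -
        have "4 / \<epsilon>\<^sup>2 < real (Suc i)" using K that by simp
        then show ?thesis using eps by (simp add: field_simps)
      qed
      show "(nm (x j - x k))\<^sup>2 < \<epsilon>\<^sup>2"
        using par[OF xX[of j] xX[of k]] xE[of j] xE[of k] small[OF that(1)] small[OF that(2)] by simp
    qed (use eps in simp)
    then show ?thesis by blast
  qed
  then obtain z where z: "z \<in> X" and lim: "(\<lambda>k. nm (x k - z)) \<longlonglongrightarrow> 0"
    using compl xX unfolding complete_on_def by blast
  have "b z w = \<Phi> w" if w: "w \<in> X" for w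
  proof -
    have "(\<lambda>k. b (x k) w - b z w) \<longlonglongrightarrow> 0"
    proof (rule tendsto_rabs_zero_cancel, rule Lim_null_comparison)
      show "\<forall>\<^sub>F k in sequentially. norm \<bar>b (x k) w - b z w\<bar> \<le> nm (x k - z) * nm w"
        using Cauchy_Schwarz[of "x _ - z" w] xX z w by (simp add: diff_left)
      show "(\<lambda>k. nm (x k - z) * nm w) \<longlonglongrightarrow> 0" using tendsto_mult_right[OF lim, of "nm w"] by simp
    qed
    then have limw: "(\<lambda>k. b (x k) w) \<longlonglongrightarrow> b z w" by (simp add: LIM_zero_iff)
    \<comment> \<open>The first variation at the minimiser. Minimality is used at the approximants
      \<open>x k\<close>, with excess \<open>1 / Suc k\<close>, and passed to the limit;
      \<open>E z\<close> itself is never computed. The limiting quadratic in \<open>t\<close> has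
      constant term 0, so its discriminant bound kills the linear coefficient.\<close>
    have "(b z w - \<Phi> w)\<^sup>2 \<le> 0 * b w w"
    proof (rule quadratic_nonneg_discrim)
      fix t :: real
      have ge: "0 \<le> 1 / real (Suc k) + 2 * t * (b (x k) w - \<Phi> w) + t\<^sup>2 * b w w" for k
      proof -
        have "E (x k + t *\<^sub>R w) = E (x k) + 2 * t * (b (x k) w - \<Phi> w) + t\<^sup>2 * b w w"
          using xX[of k] w by (simp add: E_def bilinear sym[of w "x k"] lin_on_add[OF lin]
              lin_on_scale[OF lin] power2_eq_square algebra_simps)
        then show ?thesis using d_le[of "x k + t *\<^sub>R w"] xE[of k] xX[of k] w by simp
      qed
      have "(\<lambda>k. 1 / real (Suc k)) \<longlonglongrightarrow> 0" using LIMSEQ_inverse_real_of_nat by (simp add: inverse_eq_divide)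
      then have "(\<lambda>k. 1 / real (Suc k) + 2 * t * (b (x k) w - \<Phi> w) + t\<^sup>2 * b w w)
              \<longlonglongrightarrow> 0 + 2 * t * (b z w - \<Phi> w) + t\<^sup>2 * b w w"
        by (intro tendsto_intros limw)
      then show "0 \<le> 0 + 2 * t * (b z w - \<Phi> w) + t\<^sup>2 * b w w"
        using ge by (intro LIMSEQ_le_const[of _ "0 + 2 * t * (b z w - \<Phi> w) + t\<^sup>2 * b w w" 0]) auto
    qed (use nonneg[OF w] in simp)
    then show ?thesis by simp
  qed
  then show ?thesis using z by blast
qed

lemma Riesz_dual: "complete_on X nm \<Longrightarrow> \<Phi> \<in> dual X nm \<Longrightarrow> \<exists>z\<in>X. \<forall>x\<in>X. b z x = \<Phi> x"
  unfolding dual_def using Riesz by blast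

lemma subspace_space: "subspace Y \<Longrightarrow> Y \<subseteq> X \<Longrightarrow> semi_ip_space Y b"
  using semi semi_ip_on_subset by (simp add: semi_ip_space_def)

text \<open>The projection is the Riesz representer, taken inside \<open>Y\<close>, of the
  functional \<open>b x\<close>.\<close>

lemma orthogonal_projection:
  assumes "subspace Y" "Y \<subseteq> X" "complete_on Y nm" "x \<in> X"
  shows "\<exists>y\<in>Y. \<forall>w\<in>Y. b (x - y) w = 0"
proof -
  interpret Y: semi_ip_space Y b using assms by (intro subspace_space)
  have "\<exists>y\<in>Y. \<forall>w\<in>Y. b y w = b x w"
  proof (rule Y.Riesz[where C = "nm x"])
    show "lin_on Y (\<lambda>w. b x w)" using lin_on_subset[OF lin_right] assms by blast
    show "\<bar>b x w\<bar> \<le> nm x * nm w" if "w \<in> Y" for w using Cauchy_Schwarz assms that by blast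
  qed (rule assms)
  then obtain y where y: "y \<in> Y" "\<And>w. w \<in> Y \<Longrightarrow> b y w = b x w" by blast
  have "b (x - y) w = 0" if "w \<in> Y" for w
  proof -
    have "y \<in> X" "w \<in> X" using y that assms by auto
    then show ?thesis using y(2)[OF that] assms by (simp add: diff_left)
  qed
  then show ?thesis using y by blast
qed

end

text \<open>The discrete space is given as the span of a finite set, and Gram-Schmidt by induction
  over this set avoids completeness arguments: the representer of \<open>b v\<close> in the smaller
  span is the projection of the new vector, and the remainder \<open>e\<close> is orthogonal to that
  span.\<close>

lemma Riesz_finite_dim:
  assumes "finite B" "semi_ip_on (span B) b" "\<And>x. x \<in> span B \<Longrightarrow> b x x = 0 \<Longrightarrow> x = 0"
    and "lin_on (span B) \<Phi>"
  shows "\<exists>z\<in>span B. \<forall>x\<in>span B. b z x = \<Phi> x"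
  using assms
proof (induction B arbitrary: \<Phi> rule: finite_induct)
  case empty
  then have "\<Phi> 0 = 0" "b 0 0 = 0" using lin_on_0[OF subspace_single_0, of \<Phi>]
      lin_on_0[OF subspace_single_0, of "\<lambda>x. b x 0"] by (auto simp: semi_ip_on_def)
  then show ?case by simp
next
  case (insert v B)
  let ?X = "span (insert v B)"
  interpret semi_ip_space ?X b using insert.prems by (simp add: semi_ip_space_def)
  have sub: "span B \<subseteq> ?X" by (intro span_mono) auto
  have v: "v \<in> ?X" by (simp add: span_base)
  have rep: "\<exists>z\<in>span B. \<forall>x\<in>span B. b z x = \<Psi> x" if "lin_on ?X \<Psi>" for \<Psi>
  proof (rule insert.IH)
    show "semi_ip_on (span B) b" using semi_ip_on_subset[OF insert.prems(1) sub] .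
    show "lin_on (span B) \<Psi>" using lin_on_subset[OF that sub] .
    show "x = 0" if "x \<in> span B" "b x x = 0" for x using insert.prems(2)[of x] that sub by auto
  qed
  obtain y where y: "y \<in> span B" "\<And>x. x \<in> span B \<Longrightarrow> b y x = b v x" using rep[OF lin_right[OF v]] by blast
  obtain z where z: "z \<in> span B" "\<And>x. x \<in> span B \<Longrightarrow> b z x = \<Phi> x"
    using rep[OF insert.prems(3)] by blast
  define e where "e = v - y"
  have e: "e \<in> ?X" unfolding e_def using v y sub by (intro diff_mem) auto
  have eB: "b e x = 0" if "x \<in> span B" for x unfolding e_def using that y sub v
    by (subst diff_left) auto
  define r where "r = z + (\<Phi> e / b e e) *\<^sub>R e"
  have zX: "z \<in> ?X" using z sub by auto
  have rX: "r \<in> ?X" unfolding r_def using zX e by simp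
  have "b r x = \<Phi> x" if x: "x \<in> ?X" for x
  proof -
    obtain k where k: "x - k *\<^sub>R v \<in> span B" using x unfolding span_insert by blast
    define w where "w = x - k *\<^sub>R e"
    have "w = (x - k *\<^sub>R v) + k *\<^sub>R y" by (simp add: w_def e_def algebra_simps)
    then have w: "w \<in> span B" using k y by (simp add: span_add span_scale)
    then have wX: "w \<in> ?X" using sub by auto
    have xe: "x = w + k *\<^sub>R e" by (simp add: w_def)
    have ze: "b z e = 0" using eB[OF z(1)] sym[OF e zX] by simp
    \<comment> \<open>If \<open>v\<close> already lies in the span of \<open>B\<close>, then
      \<open>e = 0\<close>, and the identity survives because division by zero gives 0 and \<Phi>
      vanishes at 0.\<close>
    have e0: "\<Phi> e / b e e * b e e = \<Phi> e"
      using insert.prems(2)[OF e] lin_on_0[OF subspace_span insert.prems(3)] by auto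
    have "b r x = b z w + k * (\<Phi> e / b e e * b e e)"
      using zX e wX eB[OF w] ze by (simp add: r_def xe bilinear algebra_simps)
    also have "\<dots> = \<Phi> x" unfolding e0 xe
      using z(2)[OF w] wX e by (simp add: lin_on_add[OF insert.prems(3)] lin_on_scale[OF insert.prems(3)])
    finally show ?thesis .
  qed
  then show ?case using rX by blast
qed

locale ip_space = semi_ip_space +
  assumes definite: "x \<in> X \<Longrightarrow> b x x = 0 \<Longrightarrow> x = 0"
begin

lemma nm_eq_0: "x \<in> X \<Longrightarrow> nm x = 0 \<Longrightarrow> x = 0"
  using definite nonneg by (simp add: ip_norm_def)

lemma nm_pos: "x \<in> X \<Longrightarrow> x \<noteq> 0 \<Longrightarrow> 0 < nm x"
  using nm_eq_0[of x] nm_nonneg[of x] by linarith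

lemma ip_eqI:
  assumes "x \<in> X" "y \<in> X" "\<And>z. z \<in> X \<Longrightarrow> b x z = b y z"
  shows "x = y"
  using definite[of "x - y"] assms by (simp add: diff_left)

text \<open>The unit vector is exhibited as a multiple of \<open>x - y\<close> with \<open>y\<close>
  in \<open>Y\<close>, so that it lies in every subspace that contains \<open>x\<close> and
  \<open>Y\<close>.\<close>

lemma exists_unit_orthogonal:
  assumes "subspace Y" "Y \<subseteq> X" "complete_on Y nm" "x \<in> X" "x \<notin> Y"
  shows "\<exists>y\<in>Y. \<exists>c. nm (c *\<^sub>R (x - y)) = 1 \<and> (\<forall>w\<in>Y. b (c *\<^sub>R (x - y)) w = 0)"
proof -
  obtain y where y: "y \<in> Y" "\<And>w. w \<in> Y \<Longrightarrow> b (x - y) w = 0"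
    using orthogonal_projection[OF assms(1-4)] by blast
  have xy: "x - y \<in> X" using y assms by auto
  have "0 < nm (x - y)" using y assms by (intro nm_pos xy) auto
  then have "nm ((1 / nm (x - y)) *\<^sub>R (x - y)) = 1" using xy by (simp add: nm_scale)
  moreover have "b ((1 / nm (x - y)) *\<^sub>R (x - y)) w = 0" if "w \<in> Y" for w
    using y(2)[OF that] xy that assms(2) by (subst scale_left) auto
  ultimately show ?thesis using y(1) by blast
qed

text \<open>Riesz-Schauder: otherwise the iterated ranges of \<open>T\<close> would decrease strictly, and unit vectors
  in one range orthogonal to the next would have \<open>1\<close>-separated images under \<open>T - id\<close>.\<close>

theorem surj_of_bounded_below:
  assumes compl: "complete_on X nm" and lin: "lin_on X T" and TX: "T ` X \<subseteq> X"
    and upper: "\<And>x. x \<in> X \<Longrightarrow> nm (T x) \<le> C * nm x"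
    and lower: "\<And>x. x \<in> X \<Longrightarrow> c * nm x \<le> nm (T x)" and c: "0 < c"
    and compact: "\<And>e :: nat \<Rightarrow> 'a. (\<And>k. e k \<in> X) \<Longrightarrow> (\<And>k. nm (e k) = 1) \<Longrightarrow>
      (\<And>j k. j < k \<Longrightarrow> 1 \<le> nm ((T (e j) - e j) - (T (e k) - e k))) \<Longrightarrow> False"
  shows "T ` X = X"
proof (rule ccontr)
  assume "T ` X \<noteq> X"
  then obtain x0 where x0: "x0 \<in> X" "x0 \<notin> T ` X" using TX by blast
  have Tmem: "T x \<in> X" if "x \<in> X" for x using TX that by blast
  have pow_mem: "(T ^^ k) x \<in> X" if "x \<in> X" for k x
    using that Tmem by (induction k) auto
  have pow_diff: "(T ^^ k) (x - y) = (T ^^ k) x - (T ^^ k) y" if "x \<in> X" "y \<in> X" for k x y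
    using that pow_mem by (induction k) (auto simp: lin_on_diff[OF sub lin])
  have pow_lin: "lin_on X (T ^^ k)" for k
  proof (induction k)
    case (Suc k)
    then show ?case using pow_mem lin unfolding lin_on_def by simp
  qed (simp add: lin_on_def)
  have pow_lower: "c ^ k * nm x \<le> nm ((T ^^ k) x)" if "x \<in> X" for k x
  proof (induction k)
    case (Suc k)
    have "c ^ Suc k * nm x \<le> c * nm ((T ^^ k) x)" using Suc c by simp
    also have "\<dots> \<le> nm ((T ^^ Suc k) x)" using lower[OF pow_mem[OF that]] by simp
    finally show ?case .
  qed simp
  have pow_upper: "nm ((T ^^ k) x) \<le> \<bar>C\<bar> ^ k * nm x" if "x \<in> X" for k x
  proof (induction k)
    case (Suc k)
    have "nm ((T ^^ Suc k) x) \<le> \<bar>C\<bar> * nm ((T ^^ k) x)"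
      using upper[OF pow_mem[OF that, of k]]
        mult_right_mono[OF abs_ge_self[of C] nm_nonneg[OF pow_mem[OF that, of k]]] by simp
    also have "\<dots> \<le> \<bar>C\<bar> * (\<bar>C\<bar> ^ k * nm x)" using Suc by (intro mult_left_mono) auto
    finally show ?case by simp
  qed simp
  define R where "R k = (T ^^ k) ` X" for k
  have RX: "R k \<subseteq> X" for k using pow_mem by (auto simp: R_def)
  have TR: "T x \<in> R (Suc k)" if "x \<in> R k" for x k using that by (auto simp: R_def)
  have R_Suc: "R (Suc k) \<subseteq> R k" for k
    using Tmem by (auto simp: R_def funpow_swap1)
  have R_mono: "R k \<subseteq> R j" if "j \<le> k" for j k
    using lift_Suc_antimono_le[of R, OF R_Suc that] .
  have Rsub: "subspace (R k)" for k
    unfolding subspace_def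
  proof (intro conjI ballI allI)
    show "0 \<in> R k" unfolding R_def using lin_on_0[OF sub pow_lin] by (intro image_eqI[of _ _ 0]) simp_all
  next
    fix x y assume "x \<in> R k" "y \<in> R k"
    then obtain v w where "v \<in> X" "w \<in> X" "x = (T ^^ k) v" "y = (T ^^ k) w" unfolding R_def by blast
    then show "x + y \<in> R k" unfolding R_def
      by (intro image_eqI[of _ _ "v + w"]) (simp_all add: lin_on_add[OF pow_lin])
  next
    fix r x assume "x \<in> R k"
    then obtain v where "v \<in> X" "x = (T ^^ k) v" unfolding R_def by blast
    then show "r *\<^sub>R x \<in> R k" unfolding R_def
      by (intro image_eqI[of _ _ "r *\<^sub>R v"]) (simp_all add: lin_on_scale[OF pow_lin])
  qed
  \<comment> \<open>The lower bound for the powers of \<open>T\<close> pulls a Cauchy sequence of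
    images back to a Cauchy sequence in \<open>X\<close>. Complete ranges are what the orthogonal
    projection requires.\<close>
  have Rcompl: "complete_on (R k) nm" for k
    unfolding complete_on_def
  proof (intro allI impI, elim conjE)
    fix u :: "nat \<Rightarrow> 'a"
    assume "\<forall>j. u j \<in> R k" and cau: "\<forall>\<epsilon>>0. \<exists>K. \<forall>i\<ge>K. \<forall>j\<ge>K. nm (u i - u j) < \<epsilon>"
    then have "\<forall>j. \<exists>y. y \<in> X \<and> u j = (T ^^ k) y" unfolding R_def by blast
    from choice[OF this] obtain x where x: "\<And>j. x j \<in> X" "\<And>j. u j = (T ^^ k) (x j)" by blast
    have "\<exists>K. \<forall>i\<ge>K. \<forall>j\<ge>K. nm (x i - x j) < \<epsilon>" if eps: "\<epsilon> > 0" for \<epsilon>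
    proof -
      have ck: "0 < c ^ k" using c by simp
      obtain K where K: "\<And>i j. i \<ge> K \<Longrightarrow> j \<ge> K \<Longrightarrow> nm (u i - u j) < c ^ k * \<epsilon>"
        using cau mult_pos_pos[OF ck eps] by blast
      have "nm (x i - x j) < \<epsilon>" if "i \<ge> K" "j \<ge> K" for i j
      proof -
        have "c ^ k * nm (x i - x j) < c ^ k * \<epsilon>"
          using pow_lower[of "x i - x j" k] K[OF that] x by (simp add: pow_diff)
        then show ?thesis using ck by simp
      qed
      then show ?thesis by blast
    qed
    then obtain y where y: "y \<in> X" "(\<lambda>j. nm (x j - y)) \<longlonglongrightarrow> 0"
      using compl x(1) unfolding complete_on_def by blast
    have "(\<lambda>j. nm (u j - (T ^^ k) y)) \<longlonglongrightarrow> 0"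
    proof (rule Lim_null_comparison)
      show "\<forall>\<^sub>F j in sequentially. norm (nm (u j - (T ^^ k) y)) \<le> \<bar>C\<bar> ^ k * nm (x j - y)"
        using pow_upper[of "x _ - y" k] x y pow_mem by (simp add: pow_diff)
      show "(\<lambda>j. \<bar>C\<bar> ^ k * nm (x j - y)) \<longlonglongrightarrow> 0" using tendsto_mult_left[OF y(2)] by simp
    qed
    then show "\<exists>z\<in>R k. (\<lambda>j. nm (u j - z)) \<longlonglongrightarrow> 0" using y(1) unfolding R_def by blast
  qed
  \<comment> \<open>The powers of \<open>T\<close> are injective by the lower bound, so a preimage
    would put \<open>x0\<close> itself into the range of \<open>T\<close>. This makes the chain of
    ranges strictly decreasing.\<close>
  have not_mem: "(T ^^ k) x0 \<notin> R (Suc k)" for k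
  proof
    assume "(T ^^ k) x0 \<in> R (Suc k)"
    then obtain y where y: "y \<in> X" "(T ^^ k) x0 = (T ^^ k) (T y)" unfolding R_def
      by (auto simp: funpow_swap1)
    have "c ^ k * nm (x0 - T y) \<le> nm ((T ^^ k) (x0 - T y))" using pow_lower x0 y Tmem by simp
    also have "\<dots> = 0" using y x0 Tmem by (simp add: pow_diff)
    finally have "nm (x0 - T y) = 0"
      using zero_less_power[OF c, of k] nm_nonneg[of "x0 - T y"] x0 Tmem[OF y(1)]
      by (auto simp: mult_le_0_iff intro: order.antisym)
    then have "x0 = T y" using nm_eq_0[of "x0 - T y"] x0 Tmem[OF y(1)] by simp
    then show False using x0 y by blast
  qed
  have "\<exists>e\<in>R k. nm e = 1 \<and> (\<forall>w\<in>R (Suc k). b e w = 0)" for k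
  proof -
    have mem: "(T ^^ k) x0 \<in> R k" using x0 by (auto simp: R_def)
    obtain y r where "y \<in> R (Suc k)" "nm (r *\<^sub>R ((T ^^ k) x0 - y)) = 1"
        "\<forall>w\<in>R (Suc k). b (r *\<^sub>R ((T ^^ k) x0 - y)) w = 0"
      using exists_unit_orthogonal[OF Rsub RX Rcompl _ not_mem[of k]] pow_mem x0 by blast
    moreover from this have "r *\<^sub>R ((T ^^ k) x0 - y) \<in> R k"
      using mem R_Suc by (intro subspace_scale subspace_diff Rsub) auto
    ultimately show ?thesis by blast
  qed
  then obtain e where e: "\<And>k. e k \<in> R k" "\<And>k. nm (e k) = 1" "\<And>k w. w \<in> R (Suc k) \<Longrightarrow> b (e k) w = 0"
    by metis
  have eX: "e k \<in> X" for k using e(1) RX by auto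
  show False
  proof (rule compact[of e])
    fix j k :: nat assume jk: "j < k"
    \<comment> \<open>All terms of the difference of \<open>(T - id) (e j)\<close> and
      \<open>(T - id) (e k)\<close> except \<open>- e j\<close> lie in \<open>R (Suc j)\<close>,
      because \<open>k\<close> is at least \<open>Suc j\<close>. The vector \<open>e j\<close> is a
      unit vector orthogonal to that range, so subtracting it leaves norm at least 1.\<close>
    define w where "w = T (e j) - T (e k) + e k"
    have w: "w \<in> R (Suc j)"
      unfolding w_def using TR[OF e(1)[of j]] TR[OF e(1)[of k]] e(1)[of k] R_mono[of "Suc j" "Suc k"]
        R_mono[of "Suc j" k] jk
      by (intro subspace_add subspace_diff Rsub) auto
    then have wX: "w \<in> X" using RX by auto
    have "1 \<le> 1 - 2 * b (e j) w + b w w" using e(3)[OF w] nonneg[OF wX] by simp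
    also have "\<dots> = (nm (e j - w))\<^sup>2"
      using e(2)[of j] nm_sq[OF eX[of j]] nm_sq[OF diff_mem[OF eX[of j] wX]]
        b_square_diff[OF eX[of j] wX] by simp
    finally have "1 \<le> nm (e j - w)"
      using power2_le_imp_le[of 1 "nm (e j - w)"] nm_nonneg[OF diff_mem[OF eX[of j] wX]] by simp
    moreover have "nm (e j - w) = nm (w - e j)" using eX[of j] wX by (rule nm_diff_commute)
    moreover have "w - e j = (T (e j) - e j) - (T (e k) - e k)" by (simp add: w_def)
    ultimately show "1 \<le> nm ((T (e j) - e j) - (T (e k) - e k))" by simp
  qed (use eX e in auto)
qed

end

section \<open>Frechet derivatives between seminormed spaces and duals\<close>

lemma bounded_ops_bound:
  assumes "A \<in> bounded_ops X p Y (ip_norm b)" "semi_ip_space Y b"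
  shows "\<exists>C. \<forall>x\<in>X. \<forall>\<phi>\<in>Y. \<bar>A x \<phi>\<bar> \<le> C * p x * ip_norm b \<phi>"
proof -
  interpret semi_ip_space Y b by fact
  obtain C where C: "\<And>x. x \<in> X \<Longrightarrow> dual_norm Y nm (A x) \<le> C * p x"
    and A: "\<And>x. x \<in> X \<Longrightarrow> A x \<in> dual Y nm"
    using assms(1) unfolding bounded_ops_def by blast
  have "\<bar>A x \<phi>\<bar> \<le> C * p x * nm \<phi>" if "x \<in> X" "\<phi> \<in> Y" for x \<phi>
  proof -
    have "\<bar>A x \<phi>\<bar> \<le> dual_norm Y nm (A x) * nm \<phi>" using dual_bound A that by blast
    also have "\<dots> \<le> C * p x * nm \<phi>" using C that by (intro mult_right_mono) auto
    finally show ?thesis .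
  qed
  then show ?thesis by blast
qed

lemma bounded_opsI:
  assumes "semi_ip_space X a" "semi_ip_space Y b"
    and "\<And>x \<phi>. x \<in> X \<Longrightarrow> \<phi> \<in> Y \<Longrightarrow> \<bar>A x \<phi>\<bar> \<le> C * ip_norm a x * ip_norm b \<phi>"
    and "\<And>x. x \<in> X \<Longrightarrow> lin_on Y (A x)" "\<And>\<phi>. \<phi> \<in> Y \<Longrightarrow> lin_on X (\<lambda>x. A x \<phi>)"
    and "\<And>x \<phi>. x \<notin> X \<or> \<phi> \<notin> Y \<Longrightarrow> A x \<phi> = 0"
  shows "A \<in> bounded_ops X (ip_norm a) Y (ip_norm b)"
proof -
  interpret X: semi_ip_space X a by fact
  interpret Y: semi_ip_space Y b by fact
  have "dual_norm Y Y.nm (A x) \<le> \<bar>C\<bar> * X.nm x" if "x \<in> X" for x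
  proof (rule Y.dual_norm_le)
    fix \<phi> assume "\<phi> \<in> Y"
    then have "C * X.nm x * Y.nm \<phi> \<le> \<bar>C\<bar> * X.nm x * Y.nm \<phi>"
      using that by (intro mult_right_mono) auto
    then show "\<bar>A x \<phi>\<bar> \<le> \<bar>C\<bar> * X.nm x * Y.nm \<phi>" using assms(3)[OF that \<open>\<phi> \<in> Y\<close>] by simp
  qed (use that in simp)
  then show ?thesis unfolding bounded_ops_def dual_def using assms(3-6) by blast
qed

text \<open>The definition bounds a \<open>dual_norm\<close>, a real supremum that controls values
  only for members of \<open>dual\<close>. The remainder is such a member, so the bound can be read
  pointwise.\<close>

lemma has_fderiv_remainder:
  assumes "has_fderiv X (ip_norm a) Y (ip_norm b) T u A" "semi_ip_space Y b"
    and "u \<in> X" "subspace X" "\<And>x. x \<in> X \<Longrightarrow> T x \<in> dual Y (ip_norm b)" "0 < \<epsilon>"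
  shows "\<exists>\<delta>>0. \<forall>h\<in>X. ip_norm a h < \<delta> \<longrightarrow>
    (\<forall>\<phi>\<in>Y. \<bar>T (u + h) \<phi> - T u \<phi> - A h \<phi>\<bar> \<le> \<epsilon> * ip_norm a h * ip_norm b \<phi>)"
proof -
  interpret semi_ip_space Y b by fact
  have A: "A h \<in> dual Y nm" if "h \<in> X" for h
    using assms(1) that unfolding has_fderiv_def bounded_ops_def by blast
  obtain \<delta> where \<delta>: "\<delta> > 0" "\<And>h. h \<in> X \<Longrightarrow> ip_norm a h < \<delta> \<Longrightarrow>
      dual_norm Y nm (\<lambda>\<phi>. T (u + h) \<phi> - T u \<phi> - A h \<phi>) \<le> \<epsilon> * ip_norm a h"
    using assms(1,6) unfolding has_fderiv_def by blast
  have "\<bar>T (u + h) \<phi> - T u \<phi> - A h \<phi>\<bar> \<le> \<epsilon> * ip_norm a h * nm \<phi>"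
    if h: "h \<in> X" "ip_norm a h < \<delta>" and \<phi>: "\<phi> \<in> Y" for h \<phi>
  proof -
    have "(\<lambda>\<phi>. T (u + h) \<phi> - T u \<phi> - A h \<phi>) \<in> dual Y nm"
      using assms(3-5) h A by (intro dual_diff) (auto intro: subspace_add)
    from dual_bound[OF this \<phi>] mult_right_mono[OF \<delta>(2)[OF h] nm_nonneg[OF \<phi>]] show ?thesis
      by linarith
  qed
  then show ?thesis using \<delta>(1) by blast
qed

text \<open>A seminorm on the domain suffices: at fixed \<open>h\<close> and test vector, the
  difference of two derivatives is linear along \<open>t *\<^sub>R h\<close> and bounded by any
  positive multiple of the product of the seminorms. Outside the spaces, members of
  \<open>bounded_ops\<close> are zero by convention.\<close>

lemma has_fderiv_unique:
  assumes X: "semi_ip_space X a" and Y: "semi_ip_space Y b"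
    and A: "has_fderiv X (ip_norm a) Y (ip_norm b) T u A"
    and B: "has_fderiv X (ip_norm a) Y (ip_norm b) T u B"
    and u: "u \<in> X" and T: "\<And>x. x \<in> X \<Longrightarrow> T x \<in> dual Y (ip_norm b)"
  shows "A = B"
proof (intro ext)
  fix h \<phi>
  interpret X: semi_ip_space X a by fact
  interpret Y: semi_ip_space Y b by fact
  have Aops: "A \<in> bounded_ops X X.nm Y Y.nm" and Bops: "B \<in> bounded_ops X X.nm Y Y.nm"
    using A B by (auto simp: has_fderiv_def)
  show "A h \<phi> = B h \<phi>"
  proof (cases "h \<in> X \<and> \<phi> \<in> Y")
    case False
    then show ?thesis using Aops Bops unfolding bounded_ops_def dual_def
      by (cases "h \<in> X") auto
  next
    case True
    then have h: "h \<in> X" and \<phi>: "\<phi> \<in> Y" by auto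
    define r where "r = X.nm h * Y.nm \<phi>"
    have r: "0 \<le> r" using h \<phi> by (simp add: r_def)
    have lin: "lin_on X (\<lambda>x. A x \<phi>)" "lin_on X (\<lambda>x. B x \<phi>)"
      using Aops Bops \<phi> unfolding bounded_ops_def by auto
    have le: "\<bar>A h \<phi> - B h \<phi>\<bar> \<le> 2 * \<epsilon> * r" if eps: "\<epsilon> > 0" for \<epsilon>
    proof -
      obtain \<delta>1 where d1: "\<delta>1 > 0" "\<And>k. k \<in> X \<Longrightarrow> X.nm k < \<delta>1 \<Longrightarrow>
          \<bar>T (u + k) \<phi> - T u \<phi> - A k \<phi>\<bar> \<le> \<epsilon> * X.nm k * Y.nm \<phi>"
        using has_fderiv_remainder[OF A Y u X.sub T eps] \<phi> by metis
      obtain \<delta>2 where d2: "\<delta>2 > 0" "\<And>k. k \<in> X \<Longrightarrow> X.nm k < \<delta>2 \<Longrightarrow>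
          \<bar>T (u + k) \<phi> - T u \<phi> - B k \<phi>\<bar> \<le> \<epsilon> * X.nm k * Y.nm \<phi>"
        using has_fderiv_remainder[OF B Y u X.sub T eps] \<phi> by metis
      \<comment> \<open>Shrinks \<open>h\<close> into both neighbourhoods; the summand 1 covers
        \<open>h\<close> of seminorm zero.\<close>
      define t where "t = min \<delta>1 \<delta>2 / (X.nm h + 1)"
      have pos: "0 < X.nm h + 1" using X.nm_nonneg[OF h] by linarith
      have t: "0 < t" using d1 d2 pos by (simp add: t_def)
      have "t * X.nm h < t * (X.nm h + 1)" using t by simp
      also have "\<dots> = min \<delta>1 \<delta>2" using pos by (simp add: t_def)
      finally have small: "X.nm (t *\<^sub>R h) < min \<delta>1 \<delta>2" using t h by (simp add: X.nm_scale)
      have "\<bar>A (t *\<^sub>R h) \<phi> - B (t *\<^sub>R h) \<phi>\<bar> \<le> 2 * (\<epsilon> * X.nm (t *\<^sub>R h) * Y.nm \<phi>)"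
        using d1(2)[of "t *\<^sub>R h"] d2(2)[of "t *\<^sub>R h"] small h by auto
      moreover have "A (t *\<^sub>R h) \<phi> - B (t *\<^sub>R h) \<phi> = t * (A h \<phi> - B h \<phi>)"
        using h by (simp add: lin_on_scale[OF lin(1)] lin_on_scale[OF lin(2)] right_diff_distrib)
      ultimately have "t * \<bar>A h \<phi> - B h \<phi>\<bar> \<le> t * (2 * \<epsilon> * r)"
        using t h by (simp add: X.nm_scale r_def abs_mult mult_ac)
      then show ?thesis using t by simp
    qed
    have "\<bar>A h \<phi> - B h \<phi>\<bar> \<le> 0"
    proof (rule field_le_epsilon)
      fix e :: real assume e: "0 < e"
      have "2 * (e / (2 * (r + 1))) * r \<le> e" using e r by (simp add: field_simps)
      then show "\<bar>A h \<phi> - B h \<phi>\<bar> \<le> 0 + e" using le[of "e / (2 * (r + 1))"] e r by simp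
    qed
    then show ?thesis by simp
  qed
qed

lemma fderiv_eqI:
  assumes "semi_ip_space X a" "semi_ip_space Y b" "u \<in> X"
    and "\<And>x. x \<in> X \<Longrightarrow> T x \<in> dual Y (ip_norm b)"
    and "has_fderiv X (ip_norm a) Y (ip_norm b) T u A"
  shows "fderiv X (ip_norm a) Y (ip_norm b) T u = A"
  unfolding fderiv_def using has_fderiv_unique[OF assms(1,2)] assms(3-5) by blast

lemma C1_map_has_fderiv:
  assumes "semi_ip_space X a" "semi_ip_space Y b" "u \<in> X" "C1_map X (ip_norm a) Y (ip_norm b) T"
  shows "has_fderiv X (ip_norm a) Y (ip_norm b) T u (fderiv X (ip_norm a) Y (ip_norm b) T u)"
  using assms fderiv_eqI[OF assms(1-3)] unfolding C1_map_def by metis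

section \<open>Stability of the linearised problem\<close>

lemma spectral_norm_bound: "norm (A *v x) \<le> spectral_norm A * norm x"
  unfolding spectral_norm_def by (rule onorm[OF matrix_vector_mul_bounded_linear])

lemma norm_mono_componentwise:
  fixes x y :: "real^2"
  assumes "\<And>i. \<bar>x $ i\<bar> \<le> \<bar>y $ i\<bar>" shows "norm x \<le> norm y"
  using assms by (intro norm_le_componentwise_cart) simp

lemma spectral_norm_pos: "A \<noteq> 0 \<Longrightarrow> 0 < spectral_norm A"
proof -
  assume "A \<noteq> 0"
  then have "\<exists>x. A *v x \<noteq> 0" by (metis matrix_eq matrix_vector_mult_0)
  then show ?thesis
    unfolding spectral_norm_def using onorm_pos_lt[OF matrix_vector_mul_bounded_linear] by blast
qed

text \<open>Estimate 2 inserted into \<open>C * y\<close> of estimate 1 gives the first rows of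
  \<open>N2\<close> and \<open>M\<close>, and estimate 2 multiplied by \<beta> gives the second
  rows. The resulting componentwise inequality has a nonnegative left side, so it passes to
  Euclidean norms, and the spectral norms appear.\<close>

lemma two_by_two_estimate:
  fixes \<beta> \<kappa> x y d1 d2 C C1 C2 :: real and N2 M :: "real^2^2"
  defines "N2 \<equiv> vector [vector [1, C], vector [0, \<beta>]]"
    and "M \<equiv> vector [vector [(1 + C) * C1, C * C2], vector [\<beta> * C1, \<beta> * C2]]"
  assumes "0 \<le> \<beta>" "0 \<le> \<kappa>" "0 \<le> x" "0 \<le> y"
    and 1: "\<beta> * x \<le> d1 + C * y + \<kappa> * C1 * x"
    and 2: "y \<le> d2 + \<kappa> * (C1 * x + C2 * y)"
    and "0 \<le> C"
  shows "\<beta> * sqrt (x\<^sup>2 + y\<^sup>2) \<le> spectral_norm N2 * sqrt (d1\<^sup>2 + d2\<^sup>2)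
    + \<kappa> * spectral_norm M * sqrt (x\<^sup>2 + y\<^sup>2)"
proof -
  have norm2: "norm (vector [s, t] :: real^2) = sqrt (s\<^sup>2 + t\<^sup>2)" for s t :: real
    by (simp add: norm_vec_def L2_set_def UNIV_2)
  define p q where "p = (vector [x, y] :: real^2)" and "q = (vector [d1, d2] :: real^2)"
  have "\<beta> * norm p = norm (\<beta> *\<^sub>R p)" using assms by simp
  also have "\<dots> \<le> norm (N2 *v q + \<kappa> *\<^sub>R (M *v p))"
  proof (rule norm_mono_componentwise)
    fix i :: 2
    have "\<beta> * x \<le> d1 + C * (d2 + \<kappa> * (C1 * x + C2 * y)) + \<kappa> * C1 * x"
      using 1 mult_left_mono[OF 2 \<open>0 \<le> C\<close>] by linarith
    then have c1: "(\<beta> *\<^sub>R p) $ 1 \<le> (N2 *v q + \<kappa> *\<^sub>R (M *v p)) $ 1"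
      by (simp add: p_def q_def N2_def M_def matrix_vector_mult_def UNIV_2 algebra_simps)
    have c2: "(\<beta> *\<^sub>R p) $ 2 \<le> (N2 *v q + \<kappa> *\<^sub>R (M *v p)) $ 2"
      using mult_left_mono[OF 2 \<open>0 \<le> \<beta>\<close>]
      by (simp add: p_def q_def N2_def M_def matrix_vector_mult_def UNIV_2 algebra_simps)
    have "0 \<le> (\<beta> *\<^sub>R p) $ 1" "0 \<le> (\<beta> *\<^sub>R p) $ 2" using assms by (simp_all add: p_def)
    then have "\<bar>(\<beta> *\<^sub>R p) $ 1\<bar> \<le> \<bar>(N2 *v q + \<kappa> *\<^sub>R (M *v p)) $ 1\<bar>"
        "\<bar>(\<beta> *\<^sub>R p) $ 2\<bar> \<le> \<bar>(N2 *v q + \<kappa> *\<^sub>R (M *v p)) $ 2\<bar>"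
      using c1 c2 by linarith+
    then show "\<bar>(\<beta> *\<^sub>R p) $ i\<bar> \<le> \<bar>(N2 *v q + \<kappa> *\<^sub>R (M *v p)) $ i\<bar>"
      using exhaust_2[of i] by metis
  qed
  also have "\<dots> \<le> norm (N2 *v q) + \<kappa> * norm (M *v p)"
    using norm_triangle_ineq[of "N2 *v q" "\<kappa> *\<^sub>R (M *v p)"] \<open>0 \<le> \<kappa>\<close> by simp
  also have "\<dots> \<le> spectral_norm N2 * norm q + \<kappa> * (spectral_norm M * norm p)"
    using \<open>0 \<le> \<kappa>\<close> by (intro add_mono mult_left_mono spectral_norm_bound)
  finally show ?thesis by (simp add: p_def q_def norm2 mult.assoc)
qed

text \<open>The numerical analysis is carried out for an abstract complete inner product space; that
  the concrete Sobolev space is one is proved separately.\<close>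

locale nonconforming = V: ip_space V a
  for V :: "'e::real_vector set" and a :: "'e \<Rightarrow> 'e \<Rightarrow> real" +
  fixes Vnc Vpw :: "'e set" and apw :: "'e \<Rightarrow> 'e \<Rightarrow> real" and I J :: "'e \<Rightarrow> 'e" and \<Lambda> :: real
  assumes complete: "complete_on V (ip_norm a)"
    and Vpw: "Vpw = {v + w | v w. v \<in> V \<and> w \<in> Vnc}"
    and sub_nc: "subspace Vnc" and finite_dim: "\<exists>B. finite B \<and> Vnc = span B"
    and nontrivial: "Vnc \<noteq> {0}"
    and semi_pw: "semi_ip_on Vpw apw"
    and apw_V: "\<forall>v\<in>V. \<forall>w\<in>V. apw v w = a v w"
    and ip_nc: "ip_on Vnc apw"
    and I_range: "I ` V \<subseteq> Vnc" and I_lin: "lin_on V I"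
    and I_orth: "\<forall>v\<in>V. \<forall>w\<in>Vnc. apw (v - I v) w = 0"
    and J_range: "J ` Vnc \<subseteq> V" and J_lin: "lin_on Vnc J" and IJ: "\<forall>w\<in>Vnc. I (J w) = w"
    and \<Lambda>_pos: "\<Lambda> > 0"
    and J_approx: "\<forall>w\<in>Vnc. ip_norm apw (w - J w) \<le> \<Lambda> * (INF v\<in>V. ip_norm apw (v - w))"
begin

lemma V_pw: "v \<in> V \<Longrightarrow> v \<in> Vpw"
  unfolding Vpw using subspace_0[OF sub_nc] by force

lemma nc_pw: "w \<in> Vnc \<Longrightarrow> w \<in> Vpw"
  unfolding Vpw using V.zero_mem by force

lemma diff_pw: "v \<in> V \<Longrightarrow> w \<in> Vnc \<Longrightarrow> v - w \<in> Vpw"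
  unfolding Vpw using subspace_neg[OF sub_nc] by force

lemma sub_pw: "subspace Vpw"
  unfolding Vpw by (rule subspace_sums[OF V.sub sub_nc])

sublocale PW: semi_ip_space Vpw apw
  by (rule semi_ip_space.intro[OF sub_pw semi_pw])

sublocale NC: ip_space Vnc apw
  using sub_nc ip_nc by unfold_locales (auto simp: ip_on_def)

abbreviation "nrm \<equiv> ip_norm a"
abbreviation "pw \<equiv> ip_norm apw"

lemma pw_V: "v \<in> V \<Longrightarrow> pw v = nrm v"
  using apw_V by (simp add: ip_norm_def)

lemma I_mem [simp]: "v \<in> V \<Longrightarrow> I v \<in> Vnc" and J_mem [simp]: "w \<in> Vnc \<Longrightarrow> J w \<in> V"
  using I_range J_range by auto

text \<open>\<open>J\<close> is injective, as \<open>I\<close> undoes it. The infimum over nonzero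
  elements of \<open>V\<close> must not range over the empty set.\<close>

lemma V_nontrivial: "V - {0} \<noteq> {}"
proof -
  obtain w where w: "w \<in> Vnc" "w \<noteq> 0" using nontrivial sub_nc subspace_0 by blast
  have "J w \<noteq> 0" using IJ w lin_on_0[OF V.sub I_lin] by auto
  then show ?thesis using J_mem[OF w(1)] by blast
qed

text \<open>\<open>v - I v\<close> is orthogonal to the discrete space, which contains
  \<open>I v - w\<close>. With \<open>w = 0\<close> this splits the norm of \<open>v\<close>; with a
  discrete solution for \<open>w\<close> it lets one error bound serve two quantities.\<close>

lemma pw_Pythagoras:
  assumes "v \<in> V" "w \<in> Vnc"
  shows "(pw (v - w))\<^sup>2 = (pw (I v - w))\<^sup>2 + (pw (v - I v))\<^sup>2"
proof -
  have mem: "v - I v \<in> Vpw" "I v - w \<in> Vpw" "v - w \<in> Vpw"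
    using assms diff_pw[OF assms(1) I_mem[OF assms(1)]] diff_pw[OF assms]
      nc_pw[OF NC.diff_mem[OF I_mem[OF assms(1)] assms(2)]] by blast+
  have "apw (v - I v) (I v - w) = 0" using I_orth assms by simp
  then have "apw ((v - I v) + (I v - w)) ((v - I v) + (I v - w))
      = apw (v - I v) (v - I v) + apw (I v - w) (I v - w)"
    using PW.b_square[OF mem(1,2)] by simp
  then show ?thesis using mem by (simp add: PW.nm_sq)
qed

lemma pw_split: "v \<in> V \<Longrightarrow> (nrm v)\<^sup>2 = (pw (I v))\<^sup>2 + (pw (v - I v))\<^sup>2"
  using pw_Pythagoras[of v 0] by (simp add: pw_V)

lemma pw_interpolation_le:
  assumes "v \<in> V" "w \<in> Vnc"
  shows "pw (I v - w) \<le> pw (v - w)" "pw (v - I v) \<le> pw (v - w)"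
proof -
  have "0 \<le> pw (v - w)" using assms by (intro PW.nm_nonneg PW.diff_mem V_pw nc_pw)
  then show "pw (I v - w) \<le> pw (v - w)" "pw (v - I v) \<le> pw (v - w)"
    using pw_Pythagoras[OF assms] power2_le_imp_le[of "pw (I v - w)" "pw (v - w)"]
      power2_le_imp_le[of "pw (v - I v)" "pw (v - w)"] by simp_all
qed

text \<open>The operator norm is a real supremum and has to be shown finite first. Comparing with
  \<open>v = 0\<close> in the quasi-optimality of \<open>J\<close> gives the crude bound 1 +
  \<Lambda>.\<close>

lemma J_bound: "w \<in> Vnc \<Longrightarrow> nrm (J w) \<le> op_norm Vnc pw nrm J * pw w"
proof -
  have crude: "nrm (J w) \<le> (1 + \<Lambda>) * pw w" if w: "w \<in> Vnc" for w
  proof -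
    have Jw: "J w \<in> V" using w by simp
    have "(INF v\<in>V. pw (v - w)) \<le> pw (0 - w)"
      using w by (intro cINF_lower bdd_belowI2[of _ 0] PW.nm_nonneg PW.diff_mem V_pw nc_pw) auto
    then have "(INF v\<in>V. pw (v - w)) \<le> pw w" using w by (simp add: NC.nm_minus)
    then have "\<Lambda> * (INF v\<in>V. pw (v - w)) \<le> \<Lambda> * pw w" using \<Lambda>_pos by simp
    then have "pw (w - J w) \<le> \<Lambda> * pw w" using J_approx w by force
    moreover have "pw (w - (w - J w)) \<le> pw w + pw (w - J w)"
      using w Jw by (intro PW.nm_triangle_diff PW.diff_mem V_pw nc_pw)
    ultimately show ?thesis using Jw by (simp add: pw_V algebra_simps)
  qed
  have bdd: "bdd_above ((\<lambda>w. nrm (J w)) ` {w \<in> Vnc. pw w \<le> 1})"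
  proof (intro bdd_aboveI2)
    fix w assume w: "w \<in> {w \<in> Vnc. pw w \<le> 1}"
    then have "(1 + \<Lambda>) * pw w \<le> 1 + \<Lambda>" using \<Lambda>_pos by (intro mult_left_le) auto
    then show "nrm (J w) \<le> 1 + \<Lambda>" using crude[of w] w by simp
  qed
  assume w: "w \<in> Vnc"
  show ?thesis
  proof (cases "pw w = 0")
    case True
    then show ?thesis using crude[OF w] by simp
  next
    case False
    then have pos: "0 < pw w" using NC.nm_nonneg[OF w] by simp
    have "nrm (J ((1 / pw w) *\<^sub>R w)) \<le> op_norm Vnc pw nrm J"
      unfolding op_norm_def
      by (rule cSUP_upper[OF _ bdd]) (use w pos in \<open>simp add: NC.nm_scale\<close>)
    then show ?thesis using pos w by (simp add: lin_on_scale[OF J_lin] V.nm_scale field_simps)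
  qed
qed

lemma op_norm_J_nonneg: "0 \<le> op_norm Vnc pw nrm J"
proof -
  obtain w where w: "w \<in> Vnc" "w \<noteq> 0" using nontrivial sub_nc subspace_0 by blast
  have "0 \<le> nrm (J w)" using w by simp
  then have "0 \<le> op_norm Vnc pw nrm J * pw w" using J_bound[OF w(1)] by linarith
  then show ?thesis using NC.nm_pos[OF w] by (simp add: zero_le_mult_iff)
qed

lemma discrete_Riesz:
  assumes "lin_on V \<Phi>"
  shows "\<exists>z\<in>Vnc. \<forall>w\<in>Vnc. apw z w = \<Phi> (J w)"
proof -
  obtain B where B: "finite B" "Vnc = span B" using finite_dim by blast
  have "lin_on Vnc (\<lambda>w. \<Phi> (J w))"
    using assms J_lin unfolding lin_on_def by simp
  then show ?thesis
    using Riesz_finite_dim[OF B(1), of apw "\<lambda>w. \<Phi> (J w)"] NC.semi NC.definite B(2) by blast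
qed

text \<open>Testing the discrete equation with its own solution leaves one factor
  \<open>pw z\<close> to cancel.\<close>

lemma discrete_Riesz_bound:
  assumes z: "z \<in> Vnc" "\<And>w. w \<in> Vnc \<Longrightarrow> apw z w = \<Phi> (J w)"
    and \<Phi>: "\<And>v. v \<in> V \<Longrightarrow> \<bar>\<Phi> v\<bar> \<le> D * nrm v" and "0 \<le> D"
  shows "pw z \<le> op_norm Vnc pw nrm J * D"
proof (cases "z = 0")
  case False
  have "pw z * pw z = \<Phi> (J z)" using z NC.nm_sq[OF z(1)] by (simp add: power2_eq_square)
  also have "\<dots> \<le> D * nrm (J z)" using \<Phi>[of "J z"] z by simp
  also have "\<dots> \<le> D * (op_norm Vnc pw nrm J * pw z)"
    using J_bound[OF z(1)] \<open>0 \<le> D\<close> by (rule mult_left_mono)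
  also have "\<dots> = (op_norm Vnc pw nrm J * D) * pw z" by simp
  finally show ?thesis using NC.nm_pos[OF z(1) False] by simp
qed (use op_norm_J_nonneg \<open>0 \<le> D\<close> in simp)

end

text \<open>\<open>nd\<close> stands for the norm of the dual of the intermediate Sobolev space. The
  abstract argument only compares its values at \<open>DG w\<close>, so no structure of that space
  enters here.\<close>

locale linearised = nonconforming +
  fixes DG :: "'a \<Rightarrow> 'a \<Rightarrow> real" and nd :: "('a \<Rightarrow> real) \<Rightarrow> real"
    and \<kappa> C1 C2 C3 :: real
  assumes DG: "DG \<in> bounded_ops Vpw pw V nrm"
    and \<kappa>_pos: "0 < \<kappa>" and C_pos: "0 < C1" "0 < C2" "0 < C3"
    and \<kappa>: "\<forall>w\<in>Vpw. \<forall>z\<in>V. \<forall>znc\<in>Vnc. (\<forall>v\<in>V. a z v = DG w v) \<and> (\<forall>\<phi>\<in>Vnc. apw znc \<phi> = DG w (J \<phi>)) \<longrightarrow>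
      pw (z - znc) \<le> \<kappa> * nd (DG w)"
    and C1: "\<forall>w\<in>Vnc. nd (DG w) \<le> C1 * pw w"
    and C2: "\<forall>v\<in>V. nd (DG (v - I v)) \<le> C2 * pw (v - I v)"
    and C3: "\<forall>v\<in>V. dual_norm V nrm (DG (v - I v)) \<le> C3 * pw (v - I v)"
begin

abbreviation "C\<^sub>T \<equiv> \<kappa> * C2 + C3 * op_norm Vnc pw nrm J"

lemma DG_dual: "w \<in> Vpw \<Longrightarrow> DG w \<in> dual V nrm"
  and DG_lin: "\<phi> \<in> V \<Longrightarrow> lin_on Vpw (\<lambda>w. DG w \<phi>)"
  using DG by (auto simp: bounded_ops_def)

lemma DG_lin_right: "w \<in> Vpw \<Longrightarrow> lin_on V (DG w)"
  using DG_dual by (auto simp: dual_def)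

lemma DG_bound: "\<exists>C. \<forall>w\<in>Vpw. \<forall>\<phi>\<in>V. \<bar>DG w \<phi>\<bar> \<le> C * pw w * nrm \<phi>"
  by (rule bounded_ops_bound[OF DG V.semi_ip_space_axioms])

text \<open>\<kappa> controls \<open>z - znc\<close>, and \<open>z - I z\<close> and
  \<open>I z - znc\<close> are its two orthogonal components, so each inherits the bound.\<close>

lemma solution_pair:
  assumes w: "w \<in> Vpw"
  shows "\<exists>z\<in>V. \<exists>znc\<in>Vnc. (\<forall>\<phi>\<in>V. a z \<phi> = DG w \<phi>) \<and> (\<forall>\<phi>\<in>Vnc. apw znc \<phi> = DG w (J \<phi>)) \<and>
    pw (I z - znc) \<le> \<kappa> * nd (DG w) \<and> pw (z - I z) \<le> \<kappa> * nd (DG w)"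
proof -
  obtain z where z: "z \<in> V" "\<forall>\<phi>\<in>V. a z \<phi> = DG w \<phi>"
    using V.Riesz_dual[OF complete DG_dual[OF w]] by blast
  obtain znc where znc: "znc \<in> Vnc" "\<forall>\<phi>\<in>Vnc. apw znc \<phi> = DG w (J \<phi>)"
    using discrete_Riesz[OF DG_lin_right[OF w]] by blast
  have "pw (z - znc) \<le> \<kappa> * nd (DG w)" using \<kappa> w z znc by blast
  then show ?thesis using z znc pw_interpolation_le[OF z(1) znc(1)] by force
qed

text \<open>The discrete inf-sup condition enters as \<open>discrete\<close>: a bound
  \<open>r\<close> on the residual functional of \<open>w\<close> bounds \<beta> times the norm of
  \<open>w\<close>. This form is free of suprema and fits residuals that are represented by a
  discrete vector.\<close>

theorem stability:
  assumes \<beta>: "0 \<le> \<beta>"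
    and discrete: "\<And>w r. w \<in> Vnc \<Longrightarrow> 0 \<le> r \<Longrightarrow>
      (\<And>\<phi>. \<phi> \<in> Vnc \<Longrightarrow> apw w \<phi> + DG w (J \<phi>) \<le> r * pw \<phi>) \<Longrightarrow> \<beta> * pw w \<le> r"
    and v: "v \<in> V" and t: "t \<in> V" "\<And>\<phi>. \<phi> \<in> V \<Longrightarrow> a t \<phi> = a v \<phi> + DG v \<phi>"
  shows "(\<beta> - \<kappa> * spectral_norm (vector [vector [(1 + C\<^sub>T) * C1, C\<^sub>T * C2], vector [\<beta> * C1, \<beta> * C2]]))
    * nrm v \<le> spectral_norm (vector [vector [1, C\<^sub>T], vector [0, \<beta>]]) * nrm t"
proof -
  have Iv: "I v \<in> Vnc" and Ivpw: "I v \<in> Vpw" and vpw: "v \<in> Vpw" and vI: "v - I v \<in> Vpw"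
    using v V_pw[OF v] nc_pw[OF I_mem[OF v]] diff_pw[OF v I_mem[OF v]] by simp_all
  define x y where "x = pw (I v)" and "y = pw (v - I v)"
  have nonneg: "0 \<le> x" "0 \<le> y" using Iv vI by (simp_all add: x_def y_def)
  obtain z1 n1 where z1: "z1 \<in> V" "n1 \<in> Vnc" "\<And>\<phi>. \<phi> \<in> V \<Longrightarrow> a z1 \<phi> = DG (I v) \<phi>"
      "\<And>\<phi>. \<phi> \<in> Vnc \<Longrightarrow> apw n1 \<phi> = DG (I v) (J \<phi>)"
    and b1: "pw (I z1 - n1) \<le> \<kappa> * nd (DG (I v))" "pw (z1 - I z1) \<le> \<kappa> * nd (DG (I v))"
    using solution_pair[OF Ivpw] by blast
  obtain z2 n2 where z2: "z2 \<in> V" "n2 \<in> Vnc" "\<And>\<phi>. \<phi> \<in> V \<Longrightarrow> a z2 \<phi> = DG (v - I v) \<phi>"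
      "\<And>\<phi>. \<phi> \<in> Vnc \<Longrightarrow> apw n2 \<phi> = DG (v - I v) (J \<phi>)"
    and b2: "pw (I z2 - n2) \<le> \<kappa> * nd (DG (v - I v))" "pw (z2 - I z2) \<le> \<kappa> * nd (DG (v - I v))"
    using solution_pair[OF vI] by blast
  have "\<kappa> * nd (DG (I v)) \<le> \<kappa> * (C1 * x)" using C1 Iv \<kappa>_pos by (simp add: x_def)
  note b1' = order_trans[OF b1(1) this] order_trans[OF b1(2) this]
  have "\<kappa> * nd (DG (v - I v)) \<le> \<kappa> * (C2 * y)" using C2 v \<kappa>_pos by (simp add: y_def)
  note b2' = order_trans[OF b2(1) this] order_trans[OF b2(2) this]
  \<comment> \<open>The part of \<open>C\<^sub>T\<close> without \<kappa>: \<open>n2\<close> is not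
    compared with anything but estimated through the norm of \<open>J\<close>.\<close>
  have n2: "pw n2 \<le> op_norm Vnc pw nrm J * (C3 * y)"
  proof (rule discrete_Riesz_bound[OF z2(2,4)])
    fix \<phi> assume \<phi>: "\<phi> \<in> V"
    have "\<bar>DG (v - I v) \<phi>\<bar> \<le> dual_norm V nrm (DG (v - I v)) * nrm \<phi>"
      by (rule V.dual_bound[OF DG_dual[OF vI] \<phi>])
    also have "\<dots> \<le> (C3 * y) * nrm \<phi>" using C3 v \<phi> by (intro mult_right_mono) (auto simp: y_def)
    finally show "\<bar>DG (v - I v) \<phi>\<bar> \<le> (C3 * y) * nrm \<phi>" .
  qed (use mult_nonneg_nonneg[OF less_imp_le[OF C_pos(3)] nonneg(2)] in auto)
  have t_eq: "t = v + z1 + z2"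
  proof (rule V.ip_eqI)
    fix \<phi> assume \<phi>: "\<phi> \<in> V"
    have "DG (I v + (v - I v)) \<phi> = DG (I v) \<phi> + DG (v - I v) \<phi>"
      using lin_on_add[OF DG_lin[OF \<phi>] Ivpw vI] .
    then show "a t \<phi> = a (v + z1 + z2) \<phi>" using t(2)[OF \<phi>] v z1 z2 \<phi> by (simp add: V.add_left)
  qed (use t v z1 z2 in auto)
  have It: "I t = I v + I z1 + I z2"
    unfolding t_eq using v z1 z2 by (simp add: lin_on_add[OF I_lin])
  have Imem: "I t \<in> Vnc" "I z1 \<in> Vnc" "I z2 \<in> Vnc" using t z1 z2 by auto
  define d1 d2 where "d1 = pw (I t)" and "d2 = pw (t - I t)"
  have CT: "0 \<le> C\<^sub>T" using \<kappa>_pos C_pos op_norm_J_nonneg by simp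
  \<comment> \<open>The residual of \<open>I v\<close> is represented by \<open>I v + n1\<close>.
    Replacing \<open>n1\<close> by \<open>I z1\<close> costs a \<kappa> term, and what separates
    \<open>I v + I z1\<close> from \<open>I t\<close> is \<open>I z2\<close>, split at
    \<open>n2\<close>.\<close>
  have 1: "\<beta> * x \<le> d1 + C\<^sub>T * y + \<kappa> * C1 * x"
  proof -
    have "\<beta> * pw (I v) \<le> pw (I v + n1)"
    proof (rule discrete[OF Iv])
      fix \<phi> assume \<phi>: "\<phi> \<in> Vnc"
      have "apw (I v) \<phi> + DG (I v) (J \<phi>) = apw (I v + n1) \<phi>"
        using z1 Iv \<phi> by (simp add: NC.add_left)
      also have "\<dots> \<le> pw (I v + n1) * pw \<phi>"
        using NC.Cauchy_Schwarz[of "I v + n1" \<phi>] Iv z1 \<phi> by simp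
      finally show "apw (I v) \<phi> + DG (I v) (J \<phi>) \<le> pw (I v + n1) * pw \<phi>" .
    qed (use Iv z1 in simp)
    also have "I v + n1 = I t - (I z1 - n1) - ((I z2 - n2) + n2)" by (simp add: It)
    also have "pw \<dots> \<le> pw (I t) + pw (I z1 - n1) + (pw (I z2 - n2) + pw n2)"
      using Imem z1(2) z2(2) NC.nm_triangle_diff[of "I t - (I z1 - n1)" "(I z2 - n2) + n2"]
        NC.nm_triangle_diff[of "I t" "I z1 - n1"] NC.nm_triangle[of "I z2 - n2" n2] by simp
    also have "\<dots> \<le> d1 + \<kappa> * (C1 * x) + (\<kappa> * (C2 * y) + op_norm Vnc pw nrm J * (C3 * y))"
      unfolding d1_def using b1' b2' n2 by linarith
    finally show ?thesis by (simp add: x_def algebra_simps)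
  qed
  \<comment> \<open>The complementary parts of \<open>t = v + z1 + z2\<close>; both representers
    contribute only interpolation errors, hence the factor \<kappa>.\<close>
  have 2: "y \<le> d2 + \<kappa> * (C1 * x + C2 * y)"
  proof -
    have mem: "t - I t \<in> Vpw" "z1 - I z1 \<in> Vpw" "z2 - I z2 \<in> Vpw"
      using t(1) z1(1) z2(1) by (simp_all add: diff_pw)
    have "v - I v = (t - I t) - (z1 - I z1) - (z2 - I z2)" unfolding It by (simp add: t_eq)
    then have "y \<le> pw (t - I t) + pw (z1 - I z1) + pw (z2 - I z2)"
      using PW.nm_triangle_diff[of "(t - I t) - (z1 - I z1)" "z2 - I z2"]
        PW.nm_triangle_diff[of "t - I t" "z1 - I z1"] mem by (simp add: y_def)
    then show ?thesis unfolding d2_def using b1'(2) b2'(2) by (simp add: algebra_simps)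
  qed
  have "sqrt (x\<^sup>2 + y\<^sup>2) = nrm v" "sqrt (d1\<^sup>2 + d2\<^sup>2) = nrm t"
    using pw_split[OF v] pw_split[OF t(1)] v t by (simp_all add: x_def y_def d1_def d2_def real_sqrt_unique)
  then show ?thesis
    using two_by_two_estimate[OF \<beta> less_imp_le[OF \<kappa>_pos] nonneg 1 2 CT] by (simp add: algebra_simps)
qed

end

section \<open>The derivatives of the continuous and the discrete operator\<close>

lemma has_fderiv_bounded_op: "has_fderiv X p Y q T u A \<Longrightarrow> A \<in> bounded_ops X p Y q"
  by (simp add: has_fderiv_def)

lemma has_fderivI:
  assumes "semi_ip_space X a" "semi_ip_space Y b" and A: "A \<in> bounded_ops X (ip_norm a) Y (ip_norm b)"
    and rem: "\<And>\<epsilon>. \<epsilon> > 0 \<Longrightarrow> \<exists>\<delta>>0. \<forall>h\<in>X. ip_norm a h < \<delta> \<longrightarrow>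
      (\<forall>\<phi>\<in>Y. \<bar>T (u + h) \<phi> - T u \<phi> - A h \<phi>\<bar> \<le> \<epsilon> * ip_norm a h * ip_norm b \<phi>)"
  shows "has_fderiv X (ip_norm a) Y (ip_norm b) T u A"
  unfolding has_fderiv_def
proof (intro conjI A allI impI)
  interpret X: semi_ip_space X a by fact
  interpret Y: semi_ip_space Y b by fact
  fix \<epsilon> :: real assume eps: "\<epsilon> > 0"
  obtain \<delta> where \<delta>: "\<delta> > 0" "\<And>h \<phi>. h \<in> X \<Longrightarrow> X.nm h < \<delta> \<Longrightarrow> \<phi> \<in> Y \<Longrightarrow>
      \<bar>T (u + h) \<phi> - T u \<phi> - A h \<phi>\<bar> \<le> \<epsilon> * X.nm h * Y.nm \<phi>"
    using rem[OF eps] by metis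
  have "dual_norm Y Y.nm (\<lambda>\<phi>. T (u + h) \<phi> - T u \<phi> - A h \<phi>) \<le> \<epsilon> * X.nm h"
    if "h \<in> X" "X.nm h < \<delta>" for h
    using \<delta>(2)[OF that] eps that(1) by (intro Y.dual_norm_le) auto
  then show "\<exists>\<delta>>0. \<forall>h\<in>X. X.nm h < \<delta> \<longrightarrow>
      dual_norm Y Y.nm (\<lambda>\<phi>. T (u + h) \<phi> - T u \<phi> - A h \<phi>) \<le> \<epsilon> * X.nm h"
    using \<delta>(1) by blast
qed

context nonconforming
begin

text \<open>The remaining terms of \<open>N_op\<close> are affine and contribute nothing to the
  Taylor remainder, which is therefore that of \<open>Gpw\<close> restricted to directions in
  \<open>V\<close>, where the two norms agree.\<close>

lemma fderiv_N_op:
  assumes Gpw: "has_fderiv Vpw pw V nrm Gpw u DG" "\<And>v. v \<in> Vpw \<Longrightarrow> Gpw v \<in> dual V nrm"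
    and G: "\<And>v. v \<in> V \<Longrightarrow> G v = Gpw v" and F: "F \<in> dual V nrm" and u: "u \<in> V"
  shows "fderiv V nrm V nrm (N_op V a G F) u = (\<lambda>v \<phi>. if v \<in> V \<and> \<phi> \<in> V then a v \<phi> + DG v \<phi> else 0)"
    (is "_ = ?A")
    and "(\<lambda>v \<phi>. if v \<in> V \<and> \<phi> \<in> V then a v \<phi> + DG v \<phi> else 0) \<in> bounded_ops V nrm V nrm"
proof -
  have Vs: "semi_ip_space V a" by unfold_locales
  have ops: "DG \<in> bounded_ops Vpw pw V nrm" using Gpw(1) by (rule has_fderiv_bounded_op)
  obtain C where C: "\<And>w \<phi>. w \<in> Vpw \<Longrightarrow> \<phi> \<in> V \<Longrightarrow> \<bar>DG w \<phi>\<bar> \<le> C * pw w * nrm \<phi>"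
    using bounded_ops_bound[OF ops Vs] by blast
  have lin1: "lin_on V (DG v)" if "v \<in> Vpw" for v using ops that by (auto simp: bounded_ops_def dual_def)
  have lin2: "lin_on Vpw (\<lambda>v. DG v \<phi>)" if "\<phi> \<in> V" for \<phi> using ops that by (auto simp: bounded_ops_def)
  show A: "?A \<in> bounded_ops V nrm V nrm"
  proof (rule bounded_opsI[OF Vs Vs, where C = "1 + C"])
    fix v \<phi> assume mem: "v \<in> V" "\<phi> \<in> V"
    show "\<bar>?A v \<phi>\<bar> \<le> (1 + C) * nrm v * nrm \<phi>"
      using C[OF V_pw[OF mem(1)] mem(2)] V.Cauchy_Schwarz[OF mem] mem
      by (simp add: pw_V algebra_simps)
  next
    fix v assume "v \<in> V"
    then show "lin_on V (?A v)" using lin1[OF V_pw, of v]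
      by (simp add: lin_on_def V.add_right V.scale_right algebra_simps)
  next
    fix \<phi> assume "\<phi> \<in> V"
    then show "lin_on V (\<lambda>v. ?A v \<phi>)" using lin2[of \<phi>] V_pw
      by (simp add: lin_on_def V.add_left V.scale_left algebra_simps)
  qed auto
  show "fderiv V nrm V nrm (N_op V a G F) u = ?A"
  proof (rule fderiv_eqI[OF Vs Vs u])
    fix v assume v: "v \<in> V"
    have Gv: "G v \<in> dual V nrm" using Gpw(2) V_pw v G by simp
    obtain C1 C2 where "\<And>\<phi>. \<phi> \<in> V \<Longrightarrow> \<bar>G v \<phi>\<bar> \<le> C1 * nrm \<phi>" "\<And>\<phi>. \<phi> \<in> V \<Longrightarrow> \<bar>F \<phi>\<bar> \<le> C2 * nrm \<phi>"
      using Gv F unfolding dual_def by blast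
    then have "\<bar>N_op V a G F v \<phi>\<bar> \<le> (nrm v + C1 + C2) * nrm \<phi>" if "\<phi> \<in> V" for \<phi>
      using V.Cauchy_Schwarz[OF v that] that by (fastforce simp: N_op_def algebra_simps)
    then have "\<exists>C. \<forall>\<phi>\<in>V. \<bar>N_op V a G F v \<phi>\<bar> \<le> C * nrm \<phi>" by blast
    moreover have "lin_on V (N_op V a G F v)"
      using Gv F v by (simp add: N_op_def dual_def lin_on_def V.add_right V.scale_right algebra_simps)
    ultimately show "N_op V a G F v \<in> dual V nrm" by (simp add: dual_def N_op_def)
  next
    show "has_fderiv V nrm V nrm (N_op V a G F) u ?A"
    proof (rule has_fderivI[OF Vs Vs A])
      fix \<epsilon> :: real assume "\<epsilon> > 0"
      from has_fderiv_remainder[OF Gpw(1) Vs V_pw[OF u] sub_pw Gpw(2) this]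
      obtain \<delta> where \<delta>: "\<delta> > 0" "\<And>h \<phi>. h \<in> Vpw \<Longrightarrow> pw h < \<delta> \<Longrightarrow> \<phi> \<in> V \<Longrightarrow>
          \<bar>Gpw (u + h) \<phi> - Gpw u \<phi> - DG h \<phi>\<bar> \<le> \<epsilon> * pw h * nrm \<phi>" by blast
      have "\<bar>N_op V a G F (u + h) \<phi> - N_op V a G F u \<phi> - ?A h \<phi>\<bar> \<le> \<epsilon> * nrm h * nrm \<phi>"
        if "h \<in> V" "nrm h < \<delta>" "\<phi> \<in> V" for h \<phi>
      proof -
        have "N_op V a G F (u + h) \<phi> - N_op V a G F u \<phi> - ?A h \<phi> = Gpw (u + h) \<phi> - Gpw u \<phi> - DG h \<phi>"
          using that u G by (simp add: N_op_def V.add_left)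
        then show ?thesis using \<delta>(2)[of h \<phi>] that by (simp add: V_pw pw_V)
      qed
      then show "\<exists>\<delta>>0. \<forall>h\<in>V. nrm h < \<delta> \<longrightarrow>
          (\<forall>\<phi>\<in>V. \<bar>N_op V a G F (u + h) \<phi> - N_op V a G F u \<phi> - ?A h \<phi>\<bar> \<le> \<epsilon> * nrm h * nrm \<phi>)"
        using \<delta>(1) by blast
    qed
  qed
qed

text \<open>The Taylor remainder is that of \<open>Gpw\<close>, tested with values of
  \<open>J\<close>; the norm of \<open>J\<close> converts it into a bound by the discrete
  norm.\<close>

lemma fderiv_Nh_op:
  assumes Gpw: "has_fderiv Vpw pw V nrm Gpw u DG" "\<And>v. v \<in> Vpw \<Longrightarrow> Gpw v \<in> dual V nrm"
    and F: "F \<in> dual V nrm" and u: "u \<in> V"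
  shows "fderiv Vpw pw Vnc pw (Nh_op Vnc apw Gpw F J) u
    = (\<lambda>v \<phi>. if v \<in> Vpw \<and> \<phi> \<in> Vnc then apw v \<phi> + DG v (J \<phi>) else 0)" (is "_ = ?A")
proof -
  let ?N = "Nh_op Vnc apw Gpw F J" and ?j = "op_norm Vnc pw nrm J"
  have Vs: "semi_ip_space V a" and PWs: "semi_ip_space Vpw apw" and NCs: "semi_ip_space Vnc apw"
    by unfold_locales
  have ops: "DG \<in> bounded_ops Vpw pw V nrm" using Gpw(1) by (rule has_fderiv_bounded_op)
  obtain C where C: "\<And>w \<phi>. w \<in> Vpw \<Longrightarrow> \<phi> \<in> V \<Longrightarrow> \<bar>DG w \<phi>\<bar> \<le> C * pw w * nrm \<phi>"
    using bounded_ops_bound[OF ops Vs] by blast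
  have lin1: "lin_on V (DG v)" if "v \<in> Vpw" for v using ops that by (auto simp: bounded_ops_def dual_def)
  have lin2: "lin_on Vpw (\<lambda>v. DG v \<phi>)" if "\<phi> \<in> V" for \<phi> using ops that by (auto simp: bounded_ops_def)
  have CJ: "\<bar>\<Phi> (J \<phi>)\<bar> \<le> \<bar>D\<bar> * ?j * pw \<phi>"
    if "\<phi> \<in> Vnc" "\<bar>\<Phi> (J \<phi>)\<bar> \<le> D * nrm (J \<phi>)" for \<Phi> :: "'e \<Rightarrow> real" and D \<phi>
  proof -
    have "D * nrm (J \<phi>) \<le> \<bar>D\<bar> * nrm (J \<phi>)" using that by (intro mult_right_mono) auto
    also have "\<dots> \<le> \<bar>D\<bar> * (?j * pw \<phi>)" using J_bound[OF that(1)] by (intro mult_left_mono) auto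
    finally show ?thesis using that(2) by simp
  qed
  have A: "?A \<in> bounded_ops Vpw pw Vnc pw"
  proof (rule bounded_opsI[OF PWs NCs, where C = "1 + \<bar>C\<bar> * ?j"])
    fix v \<phi> assume mem: "v \<in> Vpw" "\<phi> \<in> Vnc"
    have "\<bar>DG v (J \<phi>)\<bar> \<le> \<bar>C * pw v\<bar> * ?j * pw \<phi>" using mem C by (intro CJ) auto
    also have "\<dots> = \<bar>C\<bar> * ?j * pw v * pw \<phi>" using PW.nm_nonneg[OF mem(1)] by (simp add: abs_mult)
    finally show "\<bar>?A v \<phi>\<bar> \<le> (1 + \<bar>C\<bar> * ?j) * pw v * pw \<phi>"
      using PW.Cauchy_Schwarz[OF mem(1) nc_pw[OF mem(2)]] mem by (simp add: algebra_simps)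
  next
    fix v assume "v \<in> Vpw"
    then show "lin_on Vnc (?A v)" using lin1[of v] J_lin
      by (simp add: lin_on_def PW.add_right PW.scale_right nc_pw algebra_simps)
  next
    fix \<phi> assume "\<phi> \<in> Vnc"
    then show "lin_on Vpw (\<lambda>v. ?A v \<phi>)" using lin2[of "J \<phi>"]
      by (simp add: lin_on_def PW.add_left PW.scale_left nc_pw algebra_simps)
  qed auto
  show ?thesis
  proof (rule fderiv_eqI[OF PWs NCs V_pw[OF u]])
    fix v assume v: "v \<in> Vpw"
    have Gv: "Gpw v \<in> dual V nrm" using Gpw(2) v by simp
    obtain C1 C2 where C12: "\<And>\<phi>. \<phi> \<in> V \<Longrightarrow> \<bar>Gpw v \<phi>\<bar> \<le> C1 * nrm \<phi>" "\<And>\<phi>. \<phi> \<in> V \<Longrightarrow> \<bar>F \<phi>\<bar> \<le> C2 * nrm \<phi>"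
      using Gv F unfolding dual_def by blast
    have "\<bar>?N v \<phi>\<bar> \<le> (pw v + \<bar>C1\<bar> * ?j + \<bar>C2\<bar> * ?j) * pw \<phi>" if \<phi>: "\<phi> \<in> Vnc" for \<phi>
    proof -
      have "\<bar>?N v \<phi>\<bar> \<le> \<bar>apw v \<phi>\<bar> + \<bar>Gpw v (J \<phi>)\<bar> + \<bar>F (J \<phi>)\<bar>" using \<phi> by (simp add: Nh_op_def)
      also have "\<dots> \<le> pw v * pw \<phi> + \<bar>C1\<bar> * ?j * pw \<phi> + \<bar>C2\<bar> * ?j * pw \<phi>"
        using PW.Cauchy_Schwarz[OF v nc_pw[OF \<phi>]] CJ[of \<phi> "Gpw v" C1, OF \<phi> C12(1)[OF J_mem[OF \<phi>]]]
          CJ[of \<phi> F C2, OF \<phi> C12(2)[OF J_mem[OF \<phi>]]] by linarith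
      finally show ?thesis by (simp add: distrib_right)
    qed
    then have "\<exists>C. \<forall>\<phi>\<in>Vnc. \<bar>?N v \<phi>\<bar> \<le> C * pw \<phi>" by blast
    moreover have "lin_on Vnc (?N v)"
      using Gv F v J_lin by (simp add: Nh_op_def dual_def lin_on_def PW.add_right PW.scale_right nc_pw algebra_simps)
    ultimately show "?N v \<in> dual Vnc pw" by (simp add: dual_def Nh_op_def)
  next
    show "has_fderiv Vpw pw Vnc pw ?N u ?A"
    proof (rule has_fderivI[OF PWs NCs A])
      fix \<epsilon> :: real assume eps: "\<epsilon> > 0"
      \<comment> \<open>The tolerance for \<open>Gpw\<close> is divided by the factor that testing
        through \<open>J\<close> costs; the summand 1 is there because the norm of \<open>J\<close>
        is only known to be nonnegative at this point.\<close>
      have j1: "0 < ?j + 1" using op_norm_J_nonneg by simp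
      have "0 < \<epsilon> / (?j + 1)" using eps j1 by simp
      from has_fderiv_remainder[OF Gpw(1) Vs V_pw[OF u] sub_pw Gpw(2) this]
      obtain \<delta> where \<delta>: "\<delta> > 0" "\<And>h \<phi>. h \<in> Vpw \<Longrightarrow> pw h < \<delta> \<Longrightarrow> \<phi> \<in> V \<Longrightarrow>
          \<bar>Gpw (u + h) \<phi> - Gpw u \<phi> - DG h \<phi>\<bar> \<le> \<epsilon> / (?j + 1) * pw h * nrm \<phi>" by blast
      have "\<bar>?N (u + h) \<phi> - ?N u \<phi> - ?A h \<phi>\<bar> \<le> \<epsilon> * pw h * pw \<phi>"
        if h: "h \<in> Vpw" "pw h < \<delta>" and \<phi>: "\<phi> \<in> Vnc" for h \<phi>
      proof -
        have "?N (u + h) \<phi> - ?N u \<phi> - ?A h \<phi> = Gpw (u + h) (J \<phi>) - Gpw u (J \<phi>) - DG h (J \<phi>)"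
          using h \<phi> u by (simp add: Nh_op_def PW.add_left V_pw nc_pw)
        also have "\<bar>\<dots>\<bar> \<le> \<epsilon> / (?j + 1) * pw h * nrm (J \<phi>)" using \<delta>(2)[OF h J_mem[OF \<phi>]] .
        also have "\<dots> \<le> \<epsilon> / (?j + 1) * pw h * ((?j + 1) * pw \<phi>)"
          using J_bound[OF \<phi>] NC.nm_nonneg[OF \<phi>] PW.nm_nonneg[OF h(1)] j1 eps
          by (intro mult_left_mono) (auto simp: algebra_simps)
        also have "\<dots> = \<epsilon> * pw h * pw \<phi>" using j1 by simp
        finally show ?thesis .
      qed
      then show "\<exists>\<delta>>0. \<forall>h\<in>Vpw. pw h < \<delta> \<longrightarrow>
          (\<forall>\<phi>\<in>Vnc. \<bar>?N (u + h) \<phi> - ?N u \<phi> - ?A h \<phi>\<bar> \<le> \<epsilon> * pw h * pw \<phi>)"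
        using \<delta>(1) by blast
    qed
  qed
qed

end

section \<open>Inf-sup constants and compactness of derivatives\<close>

lemma (in ip_space) inf_sup_ge:
  assumes "X - {0} \<noteq> {}"
    and upper: "\<And>w \<phi>. w \<in> X \<Longrightarrow> \<phi> \<in> X \<Longrightarrow> B w \<phi> \<le> C * nm w * nm \<phi>"
    and lower: "\<And>w. w \<in> X \<Longrightarrow> w \<noteq> 0 \<Longrightarrow> \<exists>\<phi>\<in>X - {0}. \<beta> * nm w * nm \<phi> \<le> B w \<phi>"
  shows "\<beta> \<le> inf_sup X nm B"
  unfolding inf_sup_def
proof (rule cINF_greatest[OF assms(1)])
  fix w assume w: "w \<in> X - {0}"
  then obtain \<phi> where \<phi>: "\<phi> \<in> X - {0}" "\<beta> * nm w * nm \<phi> \<le> B w \<phi>" using lower[of w] by blast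
  have pos: "0 < nm w * nm \<psi>" if "\<psi> \<in> X - {0}" for \<psi> using nm_pos[of w] nm_pos[of \<psi>] w that by simp
  show "\<beta> \<le> (SUP \<phi>\<in>X - {0}. B w \<phi> / (nm w * nm \<phi>))"
  proof (rule cSUP_upper2[OF _ \<phi>(1)])
    show "bdd_above ((\<lambda>\<phi>. B w \<phi> / (nm w * nm \<phi>)) ` (X - {0}))"
      using upper[of w] w pos by (intro bdd_aboveI2[of _ _ C]) (simp add: pos_divide_le_eq mult.assoc)
    show "\<beta> \<le> B w \<phi> / (nm w * nm \<phi>)" using \<phi> pos[OF \<phi>(1)] by (simp add: pos_le_divide_eq mult.assoc)
  qed
qed

text \<open>Turns the real-valued infimum of suprema into a usable estimate. Boundedness of
  \<open>B w\<close> makes each supremum finite, and its linearity makes the family of suprema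
  bounded below, so that the infimum lies below every member.\<close>

lemma (in ip_space) inf_sup_le:
  assumes upper: "\<And>w. w \<in> X \<Longrightarrow> \<exists>C. \<forall>\<phi>\<in>X. B w \<phi> \<le> C * nm \<phi>"
    and lin: "\<And>w. w \<in> X \<Longrightarrow> lin_on X (B w)"
    and w: "w \<in> X" and r: "0 \<le> r" "\<And>\<phi>. \<phi> \<in> X \<Longrightarrow> B w \<phi> \<le> r * nm \<phi>"
  shows "inf_sup X nm B * nm w \<le> r"
proof (cases "w = 0")
  case False
  have bdd: "bdd_above ((\<lambda>\<phi>. B v \<phi> / (nm v * nm \<phi>)) ` (X - {0}))" if v: "v \<in> X" "v \<noteq> 0" for v
  proof -
    obtain C where C: "\<And>\<phi>. \<phi> \<in> X \<Longrightarrow> B v \<phi> \<le> C * nm \<phi>" using upper[OF v(1)] by blast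
    have "B v \<phi> / (nm v * nm \<phi>) \<le> C / nm v" if "\<phi> \<in> X - {0}" for \<phi>
      using C[of \<phi>] nm_pos[of \<phi>] nm_pos[OF v] that by (simp add: field_simps)
    then show ?thesis by (intro bdd_aboveI2) auto
  qed
  have "bdd_below ((\<lambda>v. SUP \<phi>\<in>X - {0}. B v \<phi> / (nm v * nm \<phi>)) ` (X - {0}))"
  proof (intro bdd_belowI2)
    fix v assume v: "v \<in> X - {0}"
    \<comment> \<open>The sign is chosen so that the quotient is nonnegative; hence so is every
      supremum.\<close>
    define \<phi> where "\<phi> = (if 0 \<le> B v v then v else - v)"
    have "B v (- v) = - B v v" using lin_on_scale[OF lin[of v], of v "-1"] v by simp
    then have \<phi>: "\<phi> \<in> X - {0}" "0 \<le> B v \<phi>" using v by (auto simp: \<phi>_def)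
    show "0 \<le> (SUP \<phi>\<in>X - {0}. B v \<phi> / (nm v * nm \<phi>))"
      using v \<phi> by (intro cSUP_upper2[OF bdd \<phi>(1)]) auto
  qed
  then have "inf_sup X nm B \<le> (SUP \<phi>\<in>X - {0}. B w \<phi> / (nm w * nm \<phi>))"
    unfolding inf_sup_def using w False by (intro cINF_lower) auto
  also have "\<dots> \<le> r / nm w"
  proof (rule cSUP_least)
    show "X - {0} \<noteq> {}" using w False by blast
    fix \<phi> assume "\<phi> \<in> X - {0}"
    then show "B w \<phi> / (nm w * nm \<phi>) \<le> r / nm w"
      using r(2)[of \<phi>] nm_pos[of \<phi>] nm_pos[OF w False] by (simp add: field_simps)
  qed
  finally show ?thesis using nm_pos[OF w False] by (simp add: field_simps)
qed (use r in simp)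

text \<open>The derivative of a compact map is compact: the difference quotients \<open>(G (u + t *\<^sub>R e k) - G u) / t\<close>
  with a fixed small \<open>t\<close> have a convergent subsequence and are uniformly close to \<open>DG (e k)\<close>.\<close>

lemma fderiv_of_compact_map:
  assumes X: "semi_ip_space X a" and Y: "semi_ip_space Y b"
    and diff: "has_fderiv X (ip_norm a) Y (ip_norm b) G u A" and u: "u \<in> X"
    and dual: "\<And>x. x \<in> X \<Longrightarrow> G x \<in> dual Y (ip_norm b)"
    and comp: "maps_bounded_to_relcompact X (ip_norm a) Y (ip_norm b) G"
    and e: "\<And>k :: nat. e k \<in> X" "\<And>k. ip_norm a (e k) \<le> 1" and c: "0 < c"
  shows "\<exists>j k. j < k \<and> (\<forall>\<phi>\<in>Y. \<bar>A (e j) \<phi> - A (e k) \<phi>\<bar> \<le> c * ip_norm b \<phi>)"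
proof -
  interpret X: semi_ip_space X a by fact
  interpret Y: semi_ip_space Y b by fact
  \<comment> \<open>Four errors of size \<open>c / 4\<close> are added below: two for replacing a
    derivative by a quotient, two for the distance of a quotient to the limit.\<close>
  have c4: "0 < c / 4" using c by simp
  obtain \<delta> where \<delta>: "\<delta> > 0" "\<And>h \<phi>. h \<in> X \<Longrightarrow> X.nm h < \<delta> \<Longrightarrow> \<phi> \<in> Y \<Longrightarrow>
      \<bar>G (u + h) \<phi> - G u \<phi> - A h \<phi>\<bar> \<le> c / 4 * X.nm h * Y.nm \<phi>"
    using has_fderiv_remainder[OF diff Y u X.sub dual c4] by blast
  define t where "t = \<delta> / 2"
  have t: "0 < t" "t < \<delta>" using \<delta>(1) by (simp_all add: t_def)
  have te: "t *\<^sub>R e k \<in> X" "X.nm (t *\<^sub>R e k) \<le> t" for k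
    using e[of k] t mult_left_le[of "X.nm (e k)" t] by (simp_all add: X.nm_scale)
  have lin: "lin_on X (\<lambda>x. A x \<phi>)" if "\<phi> \<in> Y" for \<phi>
    using has_fderiv_bounded_op[OF diff] that by (simp add: bounded_ops_def)
  have quot: "\<bar>G (u + t *\<^sub>R e k) \<phi> - G u \<phi> - t * A (e k) \<phi>\<bar> \<le> c / 4 * t * Y.nm \<phi>" if \<phi>: "\<phi> \<in> Y" for k \<phi>
  proof -
    have "\<bar>G (u + t *\<^sub>R e k) \<phi> - G u \<phi> - A (t *\<^sub>R e k) \<phi>\<bar> \<le> c / 4 * X.nm (t *\<^sub>R e k) * Y.nm \<phi>"
      using te[of k] t \<phi> by (intro \<delta>(2)) auto
    also have "\<dots> \<le> c / 4 * t * Y.nm \<phi>"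
      using te[of k] c \<phi> by (intro mult_right_mono mult_left_mono) auto
    finally show ?thesis using lin_on_scale[OF lin[OF \<phi>] e(1)] by simp
  qed
  have "X.nm (u + t *\<^sub>R e k) \<le> X.nm u + t" for k
    using X.nm_triangle[OF u te(1)[of k]] te(2)[of k] by simp
  then have "(\<forall>k. u + t *\<^sub>R e k \<in> X) \<and> (\<exists>C. \<forall>k. X.nm (u + t *\<^sub>R e k) \<le> C)"
    using u te(1) by (intro conjI allI exI[of _ "X.nm u + t"]) auto
  then obtain r \<Phi> where r: "strict_mono r" "\<Phi> \<in> dual Y Y.nm"
      "(\<lambda>k. dual_norm Y Y.nm (\<lambda>\<phi>. G (u + t *\<^sub>R e (r k)) \<phi> - \<Phi> \<phi>)) \<longlonglongrightarrow> 0"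
    using comp[unfolded maps_bounded_to_relcompact_def, rule_format, of "\<lambda>k. u + t *\<^sub>R e k"] by blast
  have "0 < c * t / 4" using c t by simp
  then obtain K where K: "\<And>k. k \<ge> K \<Longrightarrow> dual_norm Y Y.nm (\<lambda>\<phi>. G (u + t *\<^sub>R e (r k)) \<phi> - \<Phi> \<phi>) < c * t / 4"
    using order_tendstoD(2)[OF r(3)] unfolding eventually_sequentially by blast
  have near: "\<bar>G (u + t *\<^sub>R e (r k)) \<phi> - \<Phi> \<phi>\<bar> \<le> c * t / 4 * Y.nm \<phi>" if "k \<ge> K" and \<phi>: "\<phi> \<in> Y" for k \<phi>
  proof -
    have "G (u + t *\<^sub>R e (r k)) \<in> dual Y Y.nm" using u te by (intro dual) simp
    from Y.dual_bound[OF Y.dual_diff[OF this r(2)] \<phi>]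
      mult_right_mono[OF less_imp_le[OF K[OF that(1)]] Y.nm_nonneg[OF \<phi>]]
    show ?thesis by linarith
  qed
  have "\<bar>A (e (r K)) \<phi> - A (e (r (Suc K))) \<phi>\<bar> \<le> c * Y.nm \<phi>" if \<phi>: "\<phi> \<in> Y" for \<phi>
  proof -
    have "t * \<bar>A (e (r K)) \<phi> - A (e (r (Suc K))) \<phi>\<bar> = \<bar>t * A (e (r K)) \<phi> - t * A (e (r (Suc K))) \<phi>\<bar>"
      using t by (simp add: abs_mult flip: right_diff_distrib)
    also have "\<dots> \<le> 2 * (c / 4 * t * Y.nm \<phi>) + 2 * (c * t / 4 * Y.nm \<phi>)"
      using quot[OF \<phi>, of "r K"] quot[OF \<phi>, of "r (Suc K)"] near[OF order.refl \<phi>] near[OF le_SucI[OF order.refl] \<phi>]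
      by linarith
    also have "\<dots> = t * (c * Y.nm \<phi>)" by simp
    finally show ?thesis using t by simp
  qed
  moreover have "r K < r (Suc K)" using r(1) by (simp add: strict_mono_def)
  ultimately show ?thesis by blast
qed

text \<open>Everything is read off the map \<open>T\<close> that sends \<open>v\<close> to the Riesz
  representer of \<open>DN v\<close>: \<open>stability\<close> bounds \<open>T\<close> below,
  \<open>T v\<close> is a good test function for \<open>DN v\<close>, and \<open>DN\<close> is
  bijective onto the dual when \<open>T\<close> is bijective on \<open>V\<close>.\<close>

theorem (in linearised) inf_sup_and_bijective:
  fixes uh :: 'a and DN and \<beta> :: real
  defines "DN \<equiv> (\<lambda>v \<phi>. if v \<in> V \<and> \<phi> \<in> V then a v \<phi> + DG v \<phi> else 0)"
    and "N2 \<equiv> vector [vector [1, C\<^sub>T], vector [0, \<beta>]] :: real^2^2"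
    and "M \<equiv> vector [vector [(1 + C\<^sub>T) * C1, C\<^sub>T * C2], vector [\<beta> * C1, \<beta> * C2]] :: real^2^2"
  assumes \<beta>: "\<beta> = inf_sup Vnc pw (\<lambda>v \<phi>. if v \<in> Vpw \<and> \<phi> \<in> Vnc then apw v \<phi> + DG v (J \<phi>) else 0)"
    and small: "\<kappa> * spectral_norm M < \<beta>"
    and DN_ops: "DN \<in> bounded_ops V nrm V nrm"
    and Gpw: "has_fderiv Vpw pw V nrm Gpw uh DG" "\<And>v. v \<in> Vpw \<Longrightarrow> Gpw v \<in> dual V nrm"
    and G: "\<And>v. v \<in> V \<Longrightarrow> G v = Gpw v" and uh: "uh \<in> V"
    and compact: "maps_bounded_to_relcompact V nrm V nrm G"
  shows "(\<beta> - \<kappa> * spectral_norm M) / spectral_norm N2 \<le> inf_sup V nrm DN"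
    and "bij_betw DN V (dual V nrm)"
proof -
  have Vs: "semi_ip_space V a" by unfold_locales
  define \<beta>0 where "\<beta>0 = (\<beta> - \<kappa> * spectral_norm M) / spectral_norm N2"
  have "0 \<le> spectral_norm M"
    unfolding spectral_norm_def by (rule onorm_pos_le[OF matrix_vector_mul_bounded_linear])
  then have \<beta>_nonneg: "0 \<le> \<beta>" using small mult_nonneg_nonneg[OF less_imp_le[OF \<kappa>_pos], of "spectral_norm M"]
    by linarith
  have "N2 $ 1 $ 1 \<noteq> 0" by (simp add: N2_def)
  then have "N2 \<noteq> 0" by auto
  then have N2: "0 < spectral_norm N2" by (rule spectral_norm_pos)
  then have \<beta>0: "0 < \<beta>0" using small by (simp add: \<beta>0_def)
  have DN_dual: "DN v \<in> dual V nrm" if "v \<in> V" for v using DN_ops that by (simp add: bounded_ops_def)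
  have DN_lin: "lin_on V (\<lambda>v. DN v \<phi>)" if "\<phi> \<in> V" for \<phi> using DN_ops that by (simp add: bounded_ops_def)
  obtain CN where CN: "\<And>v \<phi>. v \<in> V \<Longrightarrow> \<phi> \<in> V \<Longrightarrow> \<bar>DN v \<phi>\<bar> \<le> CN * nrm v * nrm \<phi>"
    using bounded_ops_bound[OF DN_ops Vs] by blast
  have "\<forall>v. \<exists>t. v \<in> V \<longrightarrow> t \<in> V \<and> (\<forall>\<phi>\<in>V. a t \<phi> = DN v \<phi>)"
    using V.Riesz_dual[OF complete DN_dual] by blast
  from choice[OF this] obtain T where T: "\<And>v. v \<in> V \<Longrightarrow> T v \<in> V" "\<And>v \<phi>. v \<in> V \<Longrightarrow> \<phi> \<in> V \<Longrightarrow> a (T v) \<phi> = DN v \<phi>"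
    by blast
  obtain CG where CG: "\<And>w \<phi>. w \<in> Vpw \<Longrightarrow> \<phi> \<in> V \<Longrightarrow> \<bar>DG w \<phi>\<bar> \<le> CG * pw w * nrm \<phi>"
    using DG_bound by blast
  \<comment> \<open>\<open>v + z\<close> represents the discrete form in its second argument;
    Cauchy-Schwarz then supplies the finiteness of the suprema that \<open>inf_sup_le\<close> asks
    for.\<close>
  have discrete: "\<beta> * pw w \<le> r" if w: "w \<in> Vnc" and "0 \<le> r"
    and le: "\<And>\<phi>. \<phi> \<in> Vnc \<Longrightarrow> apw w \<phi> + DG w (J \<phi>) \<le> r * pw \<phi>" for w r
    unfolding \<beta>
  proof (rule NC.inf_sup_le)
    fix v assume v: "v \<in> Vnc"
    obtain z where z: "z \<in> Vnc" "\<And>\<phi>. \<phi> \<in> Vnc \<Longrightarrow> apw z \<phi> = DG v (J \<phi>)"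
      using discrete_Riesz[OF DG_lin_right[OF nc_pw[OF v]]] by blast
    have eq: "(if v \<in> Vpw \<and> \<phi> \<in> Vnc then apw v \<phi> + DG v (J \<phi>) else 0) = apw (v + z) \<phi>"
      if "\<phi> \<in> Vnc" for \<phi>
      using that v z nc_pw[OF v] by (simp add: NC.add_left)
    then show "\<exists>C. \<forall>\<phi>\<in>Vnc. (if v \<in> Vpw \<and> \<phi> \<in> Vnc then apw v \<phi> + DG v (J \<phi>) else 0) \<le> C * pw \<phi>"
    proof (intro exI[of _ "pw (v + z)"] ballI)
      fix \<phi> assume \<phi>: "\<phi> \<in> Vnc"
      show "(if v \<in> Vpw \<and> \<phi> \<in> Vnc then apw v \<phi> + DG v (J \<phi>) else 0) \<le> pw (v + z) * pw \<phi>"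
        unfolding eq[OF \<phi>] using NC.Cauchy_Schwarz[OF NC.add_mem[OF v z(1)] \<phi>] by linarith
    qed
    show "lin_on Vnc (\<lambda>\<phi>. if v \<in> Vpw \<and> \<phi> \<in> Vnc then apw v \<phi> + DG v (J \<phi>) else 0)"
      using eq NC.lin_right[OF NC.add_mem[OF v z(1)]] by (simp add: lin_on_def)
  qed (use that nc_pw in auto)
  have lower: "\<beta>0 * nrm v \<le> nrm (T v)" if v: "v \<in> V" for v
  proof -
    have "(\<beta> - \<kappa> * spectral_norm M) * nrm v \<le> spectral_norm N2 * nrm (T v)"
      unfolding M_def N2_def
      by (rule stability[OF \<beta>_nonneg discrete v T(1)[OF v]]) (use v T in \<open>auto simp: DN_def\<close>)
    then show ?thesis using N2 by (simp add: \<beta>0_def field_simps)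
  qed
  show "(\<beta> - \<kappa> * spectral_norm M) / spectral_norm N2 \<le> inf_sup V nrm DN"
    unfolding \<beta>0_def[symmetric]
  proof (rule V.inf_sup_ge[OF V_nontrivial])
    fix v \<phi> assume "v \<in> V" "\<phi> \<in> V"
    then show "DN v \<phi> \<le> CN * nrm v * nrm \<phi>" using CN[of v \<phi>] by linarith
  next
    fix v assume v: "v \<in> V" "v \<noteq> 0"
    \<comment> \<open>The test function is \<open>T v\<close>, for which \<open>DN v\<close> takes
      the value |T v| squared; it must be nonzero to be admissible in the supremum.\<close>
    have "0 < \<beta>0 * nrm v" using \<beta>0 V.nm_pos[OF v] by simp
    then have "0 < nrm (T v)" using lower[OF v(1)] by linarith
    moreover have "\<beta>0 * nrm v * nrm (T v) \<le> nrm (T v) * nrm (T v)"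
      using lower[OF v(1)] T(1)[OF v(1)] by (intro mult_right_mono) auto
    moreover have "\<dots> = DN v (T v)"
      using T(2)[OF v(1) T(1)[OF v(1)]] V.nm_sq[OF T(1)[OF v(1)]] by (simp add: power2_eq_square)
    ultimately show "\<exists>\<phi>\<in>V - {0}. \<beta>0 * nrm v * nrm \<phi> \<le> DN v \<phi>"
      using T(1)[OF v(1)] by (intro bexI[of _ "T v"]) auto
  qed
  have T_lin: "lin_on V T"
    unfolding lin_on_def
  proof (intro conjI ballI allI)
    fix v w assume "v \<in> V" "w \<in> V"
    then show "T (v + w) = T v + T w"
      using T lin_on_add[OF DN_lin] by (intro V.ip_eqI) (simp_all add: V.add_left)
  next
    fix c v assume "v \<in> V"
    then show "T (c *\<^sub>R v) = c *\<^sub>R T v"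
      using T lin_on_scale[OF DN_lin] by (intro V.ip_eqI) (simp_all add: V.scale_left)
  qed
  have T_upper: "nrm (T v) \<le> \<bar>CN\<bar> * nrm v" if v: "v \<in> V" for v
  proof (cases "T v = 0")
    case False
    have "nrm (T v) * nrm (T v) = DN v (T v)"
      using T(2)[OF v T(1)[OF v]] V.nm_sq[OF T(1)[OF v]] by (simp add: power2_eq_square)
    also have "\<dots> \<le> CN * nrm v * nrm (T v)" using CN[OF v T(1)[OF v]] by linarith
    finally have "nrm (T v) \<le> CN * nrm v" using V.nm_pos[OF T(1)[OF v] False] by simp
    also have "\<dots> \<le> \<bar>CN\<bar> * nrm v" using v by (intro mult_right_mono) auto
    finally show ?thesis .
  qed (use v in simp)
  \<comment> \<open>Compactness is assumed for \<open>G\<close> on \<open>V\<close>, whereas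
    \<open>DG\<close> is a derivative on the larger space; restricting it gives the derivative of
    \<open>G\<close> there.\<close>
  have G_diff: "has_fderiv V nrm V nrm G uh (\<lambda>v. if v \<in> V then DG v else (\<lambda>_. 0))" (is "has_fderiv _ _ _ _ _ _ ?DG")
  proof (rule has_fderivI[OF Vs Vs])
    show "?DG \<in> bounded_ops V nrm V nrm"
    proof (rule bounded_opsI[OF Vs Vs, where C = CG])
      fix v \<phi> assume "v \<in> V" "\<phi> \<in> V"
      then show "\<bar>?DG v \<phi>\<bar> \<le> CG * nrm v * nrm \<phi>" using CG[of v \<phi>] by (simp add: V_pw pw_V)
    next
      fix \<phi> assume "\<phi> \<in> V"
      then show "lin_on V (\<lambda>v. ?DG v \<phi>)"
        using lin_on_subset[OF DG_lin, of \<phi> V] V_pw by (auto simp: lin_on_def)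
    next
      fix v \<phi> assume "v \<notin> V \<or> \<phi> \<notin> V"
      then show "?DG v \<phi> = 0" using DG_dual[OF V_pw, of v] by (auto simp: dual_def)
    qed (use DG_lin_right V_pw in auto)
    fix \<epsilon> :: real assume "\<epsilon> > 0"
    from has_fderiv_remainder[OF Gpw(1) Vs V_pw[OF uh] sub_pw Gpw(2) this]
    obtain \<delta> where "\<delta> > 0" "\<And>h \<phi>. h \<in> Vpw \<Longrightarrow> pw h < \<delta> \<Longrightarrow> \<phi> \<in> V \<Longrightarrow>
        \<bar>Gpw (uh + h) \<phi> - Gpw uh \<phi> - DG h \<phi>\<bar> \<le> \<epsilon> * pw h * nrm \<phi>" by blast
    then show "\<exists>\<delta>>0. \<forall>h\<in>V. nrm h < \<delta> \<longrightarrow>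
        (\<forall>\<phi>\<in>V. \<bar>G (uh + h) \<phi> - G uh \<phi> - ?DG h \<phi>\<bar> \<le> \<epsilon> * nrm h * nrm \<phi>)"
      using uh by (intro exI[of _ \<delta>]) (simp add: G V_pw flip: pw_V)
  qed
  have surj: "T ` V = V"
  proof (rule V.surj_of_bounded_below[OF complete T_lin _ T_upper lower \<beta>0])
    fix e :: "nat \<Rightarrow> 'a"
    assume e: "\<And>k. e k \<in> V" "\<And>k. nrm (e k) = 1"
      and sep: "\<And>j k. j < k \<Longrightarrow> 1 \<le> nrm ((T (e j) - e j) - (T (e k) - e k))"
    have Gdual: "G v \<in> dual V nrm" if "v \<in> V" for v using that G Gpw(2) V_pw by simp
    obtain j k where jk: "j < k" "\<And>\<phi>. \<phi> \<in> V \<Longrightarrow> \<bar>?DG (e j) \<phi> - ?DG (e k) \<phi>\<bar> \<le> 1 / 2 * nrm \<phi>"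
      using fderiv_of_compact_map[where e = e and c = "1/2",
          OF Vs Vs G_diff uh Gdual compact e(1) eq_refl[OF e(2)]]
      by auto
    \<comment> \<open>\<open>T - id\<close> represents \<open>DG\<close> on \<open>V\<close>.
      Testing the difference \<open>w\<close> with itself gives |w| squared at most |w| / 2, against
      |w| at least 1 from the separation.\<close>
    define w where "w = (T (e j) - e j) - (T (e k) - e k)"
    have w: "w \<in> V" using e T by (simp add: w_def)
    have "a (T (e i) - e i) w = DG (e i) w" for i
      using e(1) T w by (simp add: V.diff_left DN_def)
    then have "a w w = DG (e j) w - DG (e k) w"
      using e(1) T w V.diff_left[of "T (e j) - e j" "T (e k) - e k" w] by (simp add: w_def)
    then have "nrm w * nrm w = DG (e j) w - DG (e k) w"
      using V.nm_sq[OF w] by (simp add: power2_eq_square)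
    moreover have "\<bar>DG (e j) w - DG (e k) w\<bar> \<le> 1 / 2 * nrm w" using jk(2)[OF w] e(1) by simp
    ultimately have "nrm w * nrm w \<le> 1 / 2 * nrm w" by linarith
    moreover have "1 \<le> nrm w" using sep[OF jk(1)] by (simp add: w_def)
    moreover from this have "1 * nrm w \<le> nrm w * nrm w" by (intro mult_right_mono) auto
    ultimately show False by simp
  qed (use T in auto)
  show "bij_betw DN V (dual V nrm)"
    unfolding bij_betw_def
  proof (intro conjI equalityI subsetI)
    show "inj_on DN V"
    proof (rule inj_onI)
      fix v w assume vw: "v \<in> V" "w \<in> V" "DN v = DN w"
      have "T v = T w" using vw T by (intro V.ip_eqI) simp_all
      then have "T (v - w) = 0" using vw by (simp add: lin_on_diff[OF V.sub T_lin])
      then have "\<beta>0 * nrm (v - w) \<le> 0" using lower[of "v - w"] vw by simp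
      then have "nrm (v - w) \<le> 0" using \<beta>0 by (simp add: mult_le_0_iff)
      then have "v - w = 0" using vw V.nm_pos[of "v - w"] by fastforce
      then show "v = w" by simp
    qed
  next
    fix \<Phi> assume \<Phi>: "\<Phi> \<in> dual V nrm"
    obtain z where z: "z \<in> V" "\<And>\<phi>. \<phi> \<in> V \<Longrightarrow> a z \<phi> = \<Phi> \<phi>" using V.Riesz_dual[OF complete \<Phi>] by blast
    have "z \<in> T ` V" using surj z(1) by simp
    then obtain v where v: "v \<in> V" "T v = z" by (elim imageE) simp
    have "DN v \<phi> = \<Phi> \<phi>" for \<phi>
      using T(2)[OF v(1)] v z(2) \<Phi> by (cases "\<phi> \<in> V") (auto simp: DN_def dual_def)
    then show "\<Phi> \<in> DN ` V" using v(1) by (intro image_eqI[of _ _ v]) auto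
  qed (use DN_dual in auto)
qed

section \<open>Square integrable functions\<close>

lemma rep_lfun_measurable [measurable]: "rep_lfun u \<in> borel_measurable borel"
  using Quotient_rep_reflp[OF Quotient_lfun, of u] by simp

lemma abs_rep_lfun [simp]: "abs_lfun (rep_lfun u) = u"
  by (rule Quotient_abs_rep[OF Quotient_lfun])

lemma rep_abs_lfun: "f \<in> borel_measurable borel \<Longrightarrow> AE x in lborel. rep_lfun (abs_lfun f) x = f x"
  using Quotient_rep_abs[OF Quotient_lfun, of f] by simp

lemma abs_lfun_eqI:
  "f \<in> borel_measurable borel \<Longrightarrow> g \<in> borel_measurable borel \<Longrightarrow> AE x in lborel. f x = g x \<Longrightarrow>
    abs_lfun f = abs_lfun g"
  by (rule Quotient_rel_abs[OF Quotient_lfun]) simp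

lemma lfun_eqI: "AE x in lborel. rep_lfun u x = rep_lfun v x \<Longrightarrow> u = v"
  using abs_lfun_eqI[of "rep_lfun u" "rep_lfun v"] by simp

text \<open>The representatives that \<open>rep_lfun\<close> picks for a sum and its summands are
  unrelated on null sets, so identities between representatives hold only almost everywhere.\<close>

lemma rep_add: "AE x in lborel. rep_lfun (u + v) x = rep_lfun u x + rep_lfun v x"
proof -
  have "u + v = abs_lfun (\<lambda>x. rep_lfun u x + rep_lfun v x)"
    using plus_lfun.abs_eq[of "rep_lfun u" "rep_lfun v"] by simp
  then show ?thesis by (simp add: rep_abs_lfun)
qed

lemma rep_diff: "AE x in lborel. rep_lfun (u - v) x = rep_lfun u x - rep_lfun v x"
proof -
  have "u - v = abs_lfun (\<lambda>x. rep_lfun u x - rep_lfun v x)"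
    using minus_lfun.abs_eq[of "rep_lfun u" "rep_lfun v"] by simp
  then show ?thesis by (simp add: rep_abs_lfun)
qed

lemma rep_scale: "AE x in lborel. rep_lfun (c *\<^sub>R u) x = c * rep_lfun u x"
proof -
  have "c *\<^sub>R u = abs_lfun (\<lambda>x. c * rep_lfun u x)"
    using scaleR_lfun.abs_eq[of "rep_lfun u" c] by simp
  then show ?thesis by (simp add: rep_abs_lfun)
qed

lemma rep_zero: "AE x in lborel. rep_lfun 0 x = 0"
  unfolding zero_lfun_def by (rule rep_abs_lfun) simp

lemma abs_lfun_add:
  "f \<in> borel_measurable borel \<Longrightarrow> g \<in> borel_measurable borel \<Longrightarrow>
    abs_lfun (\<lambda>x. f x + g x) = abs_lfun f + abs_lfun g"
  using plus_lfun.abs_eq[of f g] by simp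

lemma abs_lfun_scale: "f \<in> borel_measurable borel \<Longrightarrow> abs_lfun (\<lambda>x. c * f x) = c *\<^sub>R abs_lfun f"
  using scaleR_lfun.abs_eq[of f c] by simp

locale bounded_open_set =
  fixes \<Omega> :: "(real^'n) set"
  assumes open_\<Omega>: "open \<Omega>" and bounded_\<Omega>: "bounded \<Omega>"
begin

lemma \<Omega>_measurable [measurable]: "\<Omega> \<in> sets borel"
  using open_\<Omega> by simp

lemma \<Omega>_finite: "emeasure lborel \<Omega> < \<infinity>"
  using bounded_\<Omega> by (rule emeasure_bounded_finite)

lemma L0_AE: "u \<in> L0 \<Omega> \<Longrightarrow> AE x in lborel. indicator \<Omega> x * rep_lfun u x = rep_lfun u x"
  unfolding L0_def by (auto elim!: AE_mp simp: indicator_def)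

lemma ip_L2_eq: "u \<in> L0 \<Omega> \<Longrightarrow> ip_L2 \<Omega> u v = (\<integral>x. rep_lfun u x * rep_lfun v x \<partial>lborel)"
  unfolding ip_L2_def set_lebesgue_integral_def
  by (rule integral_cong_AE) (use L0_AE[of u] in \<open>auto elim!: AE_mp simp: mult.assoc[symmetric]\<close>)

lemma L2_iff: "u \<in> L2 \<Omega> \<longleftrightarrow> u \<in> L0 \<Omega> \<and> integrable lborel (\<lambda>x. (rep_lfun u x)\<^sup>2)"
proof -
  have "set_integrable lborel \<Omega> (\<lambda>x. (rep_lfun u x)\<^sup>2) = integrable lborel (\<lambda>x. (rep_lfun u x)\<^sup>2)"
    if "u \<in> L0 \<Omega>"
    unfolding set_integrable_def
    by (rule integrable_cong_AE)
      (use L0_AE[OF that] in \<open>auto elim!: AE_mp simp: power2_eq_square mult.assoc[symmetric]\<close>)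
  then show ?thesis unfolding L2_def by blast
qed

lemma L2_L0: "u \<in> L2 \<Omega> \<Longrightarrow> u \<in> L0 \<Omega>"
  by (simp add: L2_iff)

lemma L2_mult_integrable:
  assumes "u \<in> L2 \<Omega>" "v \<in> L2 \<Omega>"
  shows "integrable lborel (\<lambda>x. rep_lfun u x * rep_lfun v x)"
proof (rule Bochner_Integration.integrable_bound)
  show "integrable lborel (\<lambda>x. (rep_lfun u x)\<^sup>2 + (rep_lfun v x)\<^sup>2)"
    using assms by (intro Bochner_Integration.integrable_add) (simp_all add: L2_iff)
  have "\<bar>a * b\<bar> \<le> a\<^sup>2 + b\<^sup>2" for a b :: real
    using sum_squares_bound[of "\<bar>a\<bar>" "\<bar>b\<bar>"] abs_ge_zero[of "a * b"]
    unfolding abs_mult power2_abs by linarith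
  then show "AE x in lborel. norm (rep_lfun u x * rep_lfun v x) \<le> norm ((rep_lfun u x)\<^sup>2 + (rep_lfun v x)\<^sup>2)"
    by simp
qed simp

lemma L0_subspace: "subspace (L0 \<Omega>)"
  unfolding subspace_def
proof (intro conjI ballI allI)
  show "0 \<in> L0 \<Omega>" using rep_zero unfolding L0_def by (auto elim: AE_mp)
  fix u v :: "'n lfun" and c :: real assume "u \<in> L0 \<Omega>" "v \<in> L0 \<Omega>"
  then show "u + v \<in> L0 \<Omega>" "c *\<^sub>R u \<in> L0 \<Omega>"
    using rep_add[of u v] rep_scale[of c u] unfolding L0_def by (auto elim!: AE_mp)
qed

lemma L2_subspace: "subspace (L2 \<Omega>)"
  unfolding subspace_def
proof (intro conjI ballI allI)
  have "integrable lborel (\<lambda>x. (rep_lfun (0 :: 'n lfun) x)\<^sup>2)"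
    by (subst integrable_cong_AE[where g = "\<lambda>_. 0"]) (use rep_zero in \<open>auto elim!: AE_mp\<close>)
  then show "0 \<in> L2 \<Omega>" using L0_subspace by (simp add: L2_iff subspace_0)
next
  fix u v assume uv: "u \<in> L2 \<Omega>" "v \<in> L2 \<Omega>"
  have "integrable lborel (\<lambda>x. (rep_lfun u x)\<^sup>2 + 2 * (rep_lfun u x * rep_lfun v x) + (rep_lfun v x)\<^sup>2)"
    using uv L2_mult_integrable[OF uv] by (intro Bochner_Integration.integrable_add) (simp_all add: L2_iff)
  then have "integrable lborel (\<lambda>x. (rep_lfun (u + v) x)\<^sup>2)"
    by (subst (asm) integrable_cong_AE[where g = "\<lambda>x. (rep_lfun (u + v) x)\<^sup>2"])
      (use rep_add[of u v] in \<open>auto elim!: AE_mp simp: power2_sum\<close>)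
  then show "u + v \<in> L2 \<Omega>" using uv L0_subspace by (simp add: L2_iff subspace_add)
next
  fix c u assume u: "u \<in> L2 \<Omega>"
  have "integrable lborel (\<lambda>x. c\<^sup>2 * (rep_lfun u x)\<^sup>2)" using u by (simp add: L2_iff)
  then have "integrable lborel (\<lambda>x. (rep_lfun (c *\<^sub>R u) x)\<^sup>2)"
    by (subst (asm) integrable_cong_AE[where g = "\<lambda>x. (rep_lfun (c *\<^sub>R u) x)\<^sup>2"])
      (use rep_scale[of c u] in \<open>auto elim!: AE_mp simp: power_mult_distrib\<close>)
  then show "c *\<^sub>R u \<in> L2 \<Omega>" using u L0_subspace by (simp add: L2_iff subspace_scale)
qed

lemma ip_L2_add: "u \<in> L2 \<Omega> \<Longrightarrow> v \<in> L2 \<Omega> \<Longrightarrow> w \<in> L2 \<Omega> \<Longrightarrow> ip_L2 \<Omega> (u + v) w = ip_L2 \<Omega> u w + ip_L2 \<Omega> v w"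
proof -
  assume *: "u \<in> L2 \<Omega>" "v \<in> L2 \<Omega>" "w \<in> L2 \<Omega>"
  have "(\<integral>x. rep_lfun (u + v) x * rep_lfun w x \<partial>lborel)
      = (\<integral>x. rep_lfun u x * rep_lfun w x + rep_lfun v x * rep_lfun w x \<partial>lborel)"
    by (rule integral_cong_AE) (use rep_add[of u v] in \<open>auto elim!: AE_mp simp: distrib_right\<close>)
  then show ?thesis
    using * L2_mult_integrable L2_subspace by (simp add: ip_L2_eq L2_L0 subspace_add)
qed

lemma ip_L2_scale: "u \<in> L2 \<Omega> \<Longrightarrow> w \<in> L2 \<Omega> \<Longrightarrow> ip_L2 \<Omega> (c *\<^sub>R u) w = c * ip_L2 \<Omega> u w"
proof -
  assume *: "u \<in> L2 \<Omega>" "w \<in> L2 \<Omega>"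
  have "(\<integral>x. rep_lfun (c *\<^sub>R u) x * rep_lfun w x \<partial>lborel) = (\<integral>x. c * (rep_lfun u x * rep_lfun w x) \<partial>lborel)"
    by (rule integral_cong_AE) (use rep_scale[of c u] in \<open>auto elim!: AE_mp\<close>)
  then show ?thesis using * L2_subspace by (simp add: ip_L2_eq L2_L0 subspace_scale)
qed

sublocale L2: ip_space "L2 \<Omega>" "ip_L2 \<Omega>"
proof
  show "subspace (L2 \<Omega>)" by (rule L2_subspace)
  show "semi_ip_on (L2 \<Omega>) (ip_L2 \<Omega>)"
    unfolding semi_ip_on_def lin_on_def
  proof (intro conjI ballI allI)
    fix u v assume "u \<in> L2 \<Omega>" "v \<in> L2 \<Omega>"
    then show "ip_L2 \<Omega> u v = ip_L2 \<Omega> v u"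
      using ip_L2_eq[OF L2_L0, of u v] ip_L2_eq[OF L2_L0, of v u] by (simp add: mult.commute)
  next
    fix u assume "u \<in> L2 \<Omega>"
    then show "0 \<le> ip_L2 \<Omega> u u" by (simp add: ip_L2_eq L2_L0)
  qed (simp_all add: ip_L2_add ip_L2_scale)
  fix u assume u: "u \<in> L2 \<Omega>" "ip_L2 \<Omega> u u = 0"
  have "AE x in lborel. (rep_lfun u x)\<^sup>2 = 0"
    using u by (subst integral_nonneg_eq_0_iff_AE[symmetric]) (auto simp: ip_L2_eq L2_iff power2_eq_square)
  then show "u = 0" using rep_zero by (intro lfun_eqI) (auto elim!: AE_mp)
qed

abbreviation "nrm2 \<equiv> ip_norm (ip_L2 \<Omega>)"

lemma nrm2_sq: "u \<in> L2 \<Omega> \<Longrightarrow> (nrm2 u)\<^sup>2 = (\<integral>x. (rep_lfun u x)\<^sup>2 \<partial>lborel)"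
  using L2.nm_sq[of u] ip_L2_eq[OF L2_L0, of u u] by (simp add: power2_eq_square)

lemma nn_integral_L2: "u \<in> L2 \<Omega> \<Longrightarrow> (\<integral>\<^sup>+x. ennreal ((rep_lfun u x)\<^sup>2) \<partial>lborel) = ennreal ((nrm2 u)\<^sup>2)"
  by (simp add: nn_integral_eq_integral nrm2_sq L2_iff)

lemma L2_integrable:
  assumes "u \<in> L2 \<Omega>" shows "integrable lborel (rep_lfun u)"
proof (rule Bochner_Integration.integrable_bound)
  show "integrable lborel (\<lambda>x. indicator \<Omega> x + (rep_lfun u x)\<^sup>2)"
    using assms \<Omega>_finite by (intro Bochner_Integration.integrable_add) (auto simp: L2_iff)
  have "\<bar>y\<bar> \<le> 1 + y\<^sup>2" for y :: real
    using sum_squares_bound[of 1 "\<bar>y\<bar>"] abs_ge_zero[of y] by simp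
  then show "AE x in lborel. norm (rep_lfun u x) \<le> norm (indicator \<Omega> x + (rep_lfun u x)\<^sup>2)"
    using assms by (auto simp: L2_iff L0_def indicator_def elim!: AE_mp)
qed simp

text \<open>On a set of finite measure the pointwise bound of |y| by
  \<open>e + (1 / e) * y\<^sup>2\<close> makes the integral of the modulus linear in the L2 bound
  \<open>e\<close>. Geometrically small L2 steps thus have summable L1 norms.\<close>

lemma L1_le_L2:
  assumes u: "u \<in> L2 \<Omega>" and "nrm2 u \<le> e" "0 < e"
  shows "(\<integral>x. \<bar>rep_lfun u x\<bar> \<partial>lborel) \<le> e * (measure lborel \<Omega> + 1)"
proof -
  have ind: "integrable lborel (\<lambda>x. indicator \<Omega> x :: real)" using \<Omega>_finite by simp
  have sq: "integrable lborel (\<lambda>x. (rep_lfun u x)\<^sup>2)" using u by (simp add: L2_iff)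
  have pt: "\<bar>y\<bar> \<le> e + (1 / e) * y\<^sup>2" for y :: real
  proof -
    have "0 \<le> e * \<bar>y\<bar>" using \<open>0 < e\<close> by simp
    moreover have "2 * (e * \<bar>y\<bar>) \<le> e * e + y\<^sup>2"
      using sum_squares_bound[of e "\<bar>y\<bar>"] by (simp add: power2_eq_square)
    ultimately have "e * \<bar>y\<bar> \<le> e * e + y\<^sup>2" by linarith
    then show ?thesis using \<open>0 < e\<close> by (simp add: field_simps)
  qed
  have "(\<integral>x. \<bar>rep_lfun u x\<bar> \<partial>lborel) \<le> (\<integral>x. e * indicator \<Omega> x + (1 / e) * (rep_lfun u x)\<^sup>2 \<partial>lborel)"
  proof (rule integral_mono_AE)
    show "integrable lborel (\<lambda>x. \<bar>rep_lfun u x\<bar>)" using L2_integrable[OF u] by simp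
    show "integrable lborel (\<lambda>x. e * indicator \<Omega> x + (1 / e) * (rep_lfun u x)\<^sup>2)"
      using ind sq by (intro Bochner_Integration.integrable_add integrable_mult_right)
    show "AE x in lborel. \<bar>rep_lfun u x\<bar> \<le> e * indicator \<Omega> x + (1 / e) * (rep_lfun u x)\<^sup>2"
      using u pt by (auto simp: L2_iff L0_def indicator_def elim!: AE_mp)
  qed
  also have "\<dots> = e * measure lborel \<Omega> + (1 / e) * (nrm2 u)\<^sup>2"
    using ind sq u by (subst Bochner_Integration.integral_add) (auto simp: nrm2_sq)
  also have "\<dots> \<le> e * measure lborel \<Omega> + (1 / e) * e\<^sup>2"
    using assms by (intro add_left_mono mult_left_mono power_mono) auto
  finally show ?thesis using \<open>0 < e\<close> by (simp add: power2_eq_square algebra_simps)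
qed

text \<open>Riesz-Fischer: a fast Cauchy subsequence converges almost everywhere, and by Fatou its limit
  is the limit in \<open>L2\<close>.\<close>

lemma L2_complete: "complete_on (L2 \<Omega>) nrm2"
  unfolding complete_on_def
proof (intro allI impI, elim conjE)
  fix u :: "nat \<Rightarrow> 'n lfun"
  assume uL2: "\<forall>k. u k \<in> L2 \<Omega>" and cau: "\<forall>\<epsilon>>0. \<exists>K. \<forall>j\<ge>K. \<forall>k\<ge>K. nrm2 (u j - u k) < \<epsilon>"
  have u: "u k \<in> L2 \<Omega>" for k using uL2 by blast
  have "\<exists>K. \<forall>j\<ge>K. \<forall>k\<ge>K. nrm2 (u j - u k) < (1/2) ^ n" for n
    by (rule cau[rule_format]) simp
  then have "\<forall>n. \<exists>K. \<forall>j\<ge>K. \<forall>k\<ge>K. nrm2 (u j - u k) < (1/2) ^ n" by (rule allI)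
  from choice[OF this] obtain K where K: "\<And>n j k. j \<ge> K n \<Longrightarrow> k \<ge> K n \<Longrightarrow> nrm2 (u j - u k) < (1/2) ^ n"
    by blast
  \<comment> \<open>Adding up the thresholds makes \<open>r j\<close> exceed \<open>K n\<close> for
    all \<open>n\<close> up to \<open>j\<close>; the summand \<open>n\<close> makes \<open>r\<close>
    tend to infinity.\<close>
  define r where "r n = n + (\<Sum>i\<le>n. K i)" for n
  have rK: "r j \<ge> K n" if "j \<ge> n" for j n
  proof -
    have "K n \<le> (\<Sum>i\<le>j. K i)" using that by (intro member_le_sum) auto
    then show ?thesis by (simp add: r_def)
  qed
  have r_ge: "n \<le> r n" for n by (simp add: r_def)
  define w where "w n = u (r (Suc n)) - u (r n)" for n
  have w: "w n \<in> L2 \<Omega>" for n using u by (simp add: w_def)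
  have wsmall: "(\<integral>x. \<bar>rep_lfun (w n) x\<bar> \<partial>lborel) \<le> (1/2) ^ n * (measure lborel \<Omega> + 1)" for n
  proof (rule L1_le_L2[OF w])
    show "nrm2 (w n) \<le> (1/2) ^ n"
      unfolding w_def using K[OF rK[of n "Suc n"] rK[of n n]] by simp
  qed simp
  have "summable (\<lambda>n. (1/2) ^ n * (measure lborel \<Omega> + 1) :: real)" by (intro summable_mult2) simp
  then have "summable (\<lambda>n. \<integral>x. \<bar>rep_lfun (w n) x\<bar> \<partial>lborel)"
    by (rule summable_comparison_test'[where N = 0]) (use wsmall in \<open>simp add: integral_nonneg_AE\<close>)
  then have fin: "(\<Sum>n. ennreal (\<integral>x. \<bar>rep_lfun (w n) x\<bar> \<partial>lborel)) \<noteq> \<infinity>"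
    by (simp add: suminf_ennreal2 integral_nonneg_AE)
  have "(\<integral>\<^sup>+x. (\<Sum>n. ennreal \<bar>rep_lfun (w n) x\<bar>) \<partial>lborel) = (\<Sum>n. ennreal (\<integral>x. \<bar>rep_lfun (w n) x\<bar> \<partial>lborel))"
    using L2_integrable[OF w] by (subst nn_integral_suminf) (auto simp: nn_integral_eq_integral)
  then have "AE x in lborel. (\<Sum>n. ennreal \<bar>rep_lfun (w n) x\<bar>) \<noteq> \<infinity>"
    using fin by (intro nn_integral_PInf_AE) auto
  moreover have "AE x in lborel. \<forall>n. rep_lfun (w n) x = rep_lfun (u (r (Suc n))) x - rep_lfun (u (r n)) x"
    unfolding w_def by (subst AE_all_countable) (auto intro: rep_diff)
  ultimately have conv: "AE x in lborel. convergent (\<lambda>n. rep_lfun (u (r n)) x)"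
  proof eventually_elim
    case (elim x)
    then have "summable (\<lambda>n. \<bar>rep_lfun (w n) x\<bar>)"
      by (intro summable_suminf_not_top) auto
    then have "summable (\<lambda>n. rep_lfun (w n) x)" by (rule summable_rabs_cancel)
    then have "convergent (\<lambda>n. \<Sum>i<n. rep_lfun (w i) x)" by (simp add: summable_iff_convergent)
    moreover have "(\<Sum>i<n. rep_lfun (w i) x) = rep_lfun (u (r n)) x - rep_lfun (u (r 0)) x" for n
      using elim(2) sum_lessThan_telescope[of "\<lambda>i. rep_lfun (u (r i)) x"] by simp
    ultimately have "convergent (\<lambda>n. rep_lfun (u (r n)) x - rep_lfun (u (r 0)) x)" by simp
    from convergent_add[OF this convergent_const[of "rep_lfun (u (r 0)) x"]]
    show ?case by simp
  qed
  \<comment> \<open>Where the sequence diverges, \<open>lim\<close> has one fixed unspecified value,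
    so \<open>g\<close> is Borel measurable on the whole space.\<close>
  define g where "g x = lim (\<lambda>n. rep_lfun (u (r n)) x)" for x
  have g_meas [measurable]: "g \<in> borel_measurable borel"
    unfolding g_def by measurable
  have lim: "AE x in lborel. (\<lambda>n. rep_lfun (u (r n)) x) \<longlonglongrightarrow> g x"
    using conv by eventually_elim (simp add: g_def convergent_LIMSEQ_iff)
  define v where "v = abs_lfun g"
  have v: "AE x in lborel. rep_lfun v x = g x" unfolding v_def by (rule rep_abs_lfun) simp
  have "AE x in lborel. \<forall>n. x \<notin> \<Omega> \<longrightarrow> rep_lfun (u (r n)) x = 0"
    using u by (subst AE_all_countable) (auto simp: L2_iff L0_def)
  then have vL0: "v \<in> L0 \<Omega>"
    unfolding L0_def mem_Collect_eq using lim v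
    by eventually_elim (auto intro: LIMSEQ_unique)
  have fatou: "(\<integral>\<^sup>+x. ennreal ((rep_lfun (u j - v) x)\<^sup>2) \<partial>lborel) \<le> ennreal (\<epsilon>\<^sup>2)"
    if N: "\<And>k. k \<ge> N \<Longrightarrow> nrm2 (u j - u k) \<le> \<epsilon>" for j N \<epsilon>
  proof -
    have "AE x in lborel. ennreal ((rep_lfun (u j - v) x)\<^sup>2)
        = liminf (\<lambda>n. ennreal ((rep_lfun (u j) x - rep_lfun (u (r n)) x)\<^sup>2))"
      using lim v rep_diff[of "u j" v]
    proof eventually_elim
      case (elim x)
      have "(\<lambda>n. ennreal ((rep_lfun (u j) x - rep_lfun (u (r n)) x)\<^sup>2)) \<longlonglongrightarrow> ennreal ((rep_lfun (u j) x - g x)\<^sup>2)"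
        by (intro tendsto_intros elim)
      from lim_imp_Liminf[OF _ this] elim show ?case by simp
    qed
    then have "(\<integral>\<^sup>+x. ennreal ((rep_lfun (u j - v) x)\<^sup>2) \<partial>lborel)
        = (\<integral>\<^sup>+x. liminf (\<lambda>n. ennreal ((rep_lfun (u j) x - rep_lfun (u (r n)) x)\<^sup>2)) \<partial>lborel)"
      by (rule nn_integral_cong_AE)
    also have "\<dots> \<le> liminf (\<lambda>n. \<integral>\<^sup>+x. ennreal ((rep_lfun (u j) x - rep_lfun (u (r n)) x)\<^sup>2) \<partial>lborel)"
      by (rule nn_integral_liminf) simp
    also have "\<dots> \<le> limsup (\<lambda>n. \<integral>\<^sup>+x. ennreal ((rep_lfun (u j) x - rep_lfun (u (r n)) x)\<^sup>2) \<partial>lborel)"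
      by (intro Liminf_le_Limsup) simp
    also have "\<dots> \<le> ennreal (\<epsilon>\<^sup>2)"
    proof (rule Limsup_bounded, rule eventually_sequentiallyI)
      fix n assume "n \<ge> N"
      then have rN: "r n \<ge> N" using r_ge order_trans by blast
      have "(\<integral>\<^sup>+x. ennreal ((rep_lfun (u j) x - rep_lfun (u (r n)) x)\<^sup>2) \<partial>lborel)
          = (\<integral>\<^sup>+x. ennreal ((rep_lfun (u j - u (r n)) x)\<^sup>2) \<partial>lborel)"
        by (rule nn_integral_cong_AE) (use rep_diff[of "u j" "u (r n)"] in \<open>auto elim!: AE_mp\<close>)
      also have "\<dots> = ennreal ((nrm2 (u j - u (r n)))\<^sup>2)" using u by (intro nn_integral_L2) simp
      also have "\<dots> \<le> ennreal (\<epsilon>\<^sup>2)" using N[OF rN] u by (intro ennreal_leI power_mono) auto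
      finally show "(\<integral>\<^sup>+x. ennreal ((rep_lfun (u j) x - rep_lfun (u (r n)) x)\<^sup>2) \<partial>lborel) \<le> ennreal (\<epsilon>\<^sup>2)" .
    qed
    finally show ?thesis .
  qed
  \<comment> \<open>The Fatou bound shows square integrability of a difference first; that of
    \<open>v\<close> follows by subtracting from a member of the sequence.\<close>
  have diff: "u j - v \<in> L2 \<Omega>" if N: "\<And>k. k \<ge> N \<Longrightarrow> nrm2 (u j - u k) \<le> \<epsilon>" for j N \<epsilon>
  proof -
    have "(\<integral>\<^sup>+x. ennreal ((rep_lfun (u j - v) x)\<^sup>2) \<partial>lborel) < \<infinity>"
      using fatou[OF N] ennreal_less_top le_less_trans by fastforce
    then have "integrable lborel (\<lambda>x. (rep_lfun (u j - v) x)\<^sup>2)" by (intro integrableI_nonneg) auto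
    then show ?thesis using u vL0 L0_subspace by (simp add: L2_iff subspace_diff)
  qed
  obtain N where N: "\<And>k. k \<ge> N \<Longrightarrow> nrm2 (u N - u k) \<le> 1"
    using cau[rule_format, of 1] by (meson less_imp_le order_refl zero_less_one)
  have "u N - v \<in> L2 \<Omega>" by (rule diff[OF N])
  from L2.diff_mem[OF u this] have "u N - (u N - v) \<in> L2 \<Omega>" .
  moreover have "u N - (u N - v) = v" by simp
  ultimately have vL2: "v \<in> L2 \<Omega>" by (simp only:)
  have "(\<lambda>k. nrm2 (u k - v)) \<longlonglongrightarrow> 0"
  proof (rule LIMSEQ_I)
    fix \<epsilon> :: real assume eps: "0 < \<epsilon>"
    then obtain M where M: "\<And>j k. j \<ge> M \<Longrightarrow> k \<ge> M \<Longrightarrow> nrm2 (u j - u k) < \<epsilon> / 2"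
      using cau[rule_format, of "\<epsilon> / 2"] by auto
    have "norm (nrm2 (u j - v) - 0) < \<epsilon>" if "j \<ge> M" for j
    proof -
      have "ennreal ((nrm2 (u j - v))\<^sup>2) \<le> ennreal ((\<epsilon> / 2)\<^sup>2)"
        using fatou[of M j "\<epsilon> / 2", OF less_imp_le[OF M[OF that]]]
        unfolding nn_integral_L2[OF L2.diff_mem[OF u vL2]] .
      then have "(nrm2 (u j - v))\<^sup>2 \<le> (\<epsilon> / 2)\<^sup>2" by (subst (asm) ennreal_le_iff) auto
      then have "nrm2 (u j - v) \<le> \<epsilon> / 2" by (rule power2_le_imp_le) (use eps in simp)
      then show ?thesis using eps L2.nm_nonneg[OF L2.diff_mem[OF u[of j] vL2]] by simp
    qed
    then show "\<exists>M. \<forall>j\<ge>M. norm (nrm2 (u j - v) - 0) < \<epsilon>" by blast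
  qed
  then show "\<exists>x\<in>L2 \<Omega>. (\<lambda>k. nrm2 (u k - x)) \<longlonglongrightarrow> 0" using vL2 by blast
qed

end

section \<open>Smooth functions\<close>

definition pd :: "'n \<Rightarrow> (real^('n::finite) \<Rightarrow> real) \<Rightarrow> real^'n \<Rightarrow> real" where
  "pd i f = (\<lambda>x. frechet_derivative f (at x) (axis i 1))"

lemma iter_pd_Cons: "iter_pd (i # is) f = pd i (iter_pd is f)"
  by (simp add: pd_def)

text \<open>The head of the list is differentiated last; this peels off the derivative taken first,
  as induction on the differentiated function requires.\<close>

lemma iter_pd_snoc: "iter_pd (is @ [i]) f = iter_pd is (pd i f)"
  by (induction "is") (simp_all add: pd_def)

lemma pd_eqI: "(f has_derivative f') (at x) \<Longrightarrow> pd i f x = f' (axis i 1)"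
  unfolding pd_def by (simp add: frechet_derivative_at[symmetric])

lemma
  assumes f: "f differentiable (at x)"
  shows pd_scale: "pd i (\<lambda>y. c * f y) x = c * pd i f x"
    and pd_add: "g differentiable (at x) \<Longrightarrow> pd i (\<lambda>y. f y + g y) x = pd i f x + pd i g x"
    and pd_mult: "g differentiable (at x) \<Longrightarrow> pd i (\<lambda>y. f y * g y) x = f x * pd i g x + pd i f x * g x"
proof -
  note Df = f[unfolded frechet_derivative_works]
  show "pd i (\<lambda>y. c * f y) x = c * pd i f x"
    by (subst pd_eqI[OF has_derivative_mult_right[OF Df]]) (simp add: pd_def)
  assume "g differentiable (at x)"
  note Dg = this[unfolded frechet_derivative_works]
  show "pd i (\<lambda>y. f y + g y) x = pd i f x + pd i g x"
    by (subst pd_eqI[OF has_derivative_add[OF Df Dg]]) (simp add: pd_def)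
  show "pd i (\<lambda>y. f y * g y) x = f x * pd i g x + pd i f x * g x"
    by (subst pd_eqI[OF has_derivative_mult[OF Df Dg]]) (simp add: pd_def)
qed

lemma pd_eq_0: "open S \<Longrightarrow> x \<in> S \<Longrightarrow> (\<And>y. y \<in> S \<Longrightarrow> f y = 0) \<Longrightarrow> pd i f x = 0"
  using pd_eqI[OF has_derivative_transform_within_open[of "\<lambda>_. 0" "\<lambda>_. 0" x UNIV S f]] by simp

lemma pd_support: "{x. pd i f x \<noteq> 0} \<subseteq> closure {x. f x \<noteq> 0}"
proof (rule subsetI, rule ccontr)
  fix x assume x: "x \<in> {x. pd i f x \<noteq> 0}" "x \<notin> closure {x. f x \<noteq> 0}"
  have "pd i f x = 0"
  proof (rule pd_eq_0)
    show "f y = 0" if "y \<in> - closure {x. f x \<noteq> 0}" for y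
      using closure_subset[of "{x. f x \<noteq> 0}"] that by blast
  qed (use x(2) in auto)
  then show False using x(1) by simp
qed

text \<open>No iterated derivative ever leaves the class \<open>P\<close>. It suffices to find a
  family of differentiable functions that is closed under partial derivatives.\<close>

lemma smooth_coinduct:
  assumes "P f" and "\<And>g x. P g \<Longrightarrow> g differentiable (at x)" and "\<And>g i. P g \<Longrightarrow> P (pd i g)"
  shows "smooth f"
proof -
  have "P (iter_pd is f)" for "is"
  proof (induction "is")
    case (Cons i "is")
    then show ?case using assms(3) by (simp only: iter_pd_Cons)
  qed (simp add: assms(1))
  then show ?thesis unfolding smooth_def by (intro allI assms(2))
qed

lemma smooth_iter_pd_differentiable: "smooth f \<Longrightarrow> iter_pd is f differentiable (at x)"
  by (simp add: smooth_def)

lemma smooth_differentiable: "smooth f \<Longrightarrow> f differentiable (at x)"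
  using smooth_iter_pd_differentiable[of f "[]"] by simp

lemma smooth_pd: "smooth f \<Longrightarrow> smooth (pd i f)"
  unfolding smooth_def[of "pd i f"] by (simp only: iter_pd_snoc[symmetric] smooth_iter_pd_differentiable simp_thms)

lemma smooth_continuous: "smooth f \<Longrightarrow> continuous_on UNIV f"
  by (simp add: differentiable_imp_continuous_on differentiable_on_def differentiable_at_withinI
      smooth_differentiable)

lemma iter_pd_add:
  assumes "smooth f" "smooth g"
  shows "iter_pd is (\<lambda>x. f x + g x) = (\<lambda>x. iter_pd is f x + iter_pd is g x)"
proof (induction "is")
  case (Cons i "is")
  show ?case
    unfolding iter_pd_Cons Cons.IH by (rule ext) (intro pd_add smooth_iter_pd_differentiable assms)
qed simp

lemma iter_pd_scale:
  assumes "smooth f"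
  shows "iter_pd is (\<lambda>x. c * f x) = (\<lambda>x. c * iter_pd is f x)"
proof (induction "is")
  case (Cons i "is")
  show ?case
    unfolding iter_pd_Cons Cons.IH by (rule ext) (intro pd_scale smooth_iter_pd_differentiable assms)
qed simp

lemma smooth_add: "smooth f \<Longrightarrow> smooth g \<Longrightarrow> smooth (\<lambda>x. f x + g x)"
  unfolding smooth_def[of "\<lambda>x. f x + g x"]
  by (simp only: iter_pd_add) (intro allI differentiable_add smooth_iter_pd_differentiable)

lemma smooth_scale: "smooth f \<Longrightarrow> smooth (\<lambda>x. c * f x)"
  unfolding smooth_def[of "\<lambda>x. c * f x"]
  by (simp only: iter_pd_scale) (intro allI differentiable_mult differentiable_const smooth_iter_pd_differentiable)

section \<open>Integration by parts\<close>

lemma integrable_compact_support: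
  fixes f :: "'a::euclidean_space \<Rightarrow> real"
  assumes "continuous_on UNIV f" "bounded {x. f x \<noteq> 0}"
  shows "integrable lborel f"
proof -
  obtain R where R: "{x. f x \<noteq> 0} \<subseteq> cball 0 R" using bounded_subset_ballD[OF assms(2), of 0] ball_subset_cball by (meson order_trans)
  have "integrable lborel (\<lambda>x. indicator (cball 0 R) x *\<^sub>R f x)"
    using continuous_on_subset[OF assms(1)] by (intro borel_integrable_compact) auto
  moreover have "(\<lambda>x. indicator (cball 0 R) x *\<^sub>R f x) = f"
    using R by (auto simp: indicator_def fun_eq_iff)
  ultimately show ?thesis by simp
qed

lemma integral_translate:
  fixes f :: "'a::euclidean_space \<Rightarrow> real"
  assumes "f \<in> borel_measurable borel"
  shows "(\<integral>x. f (c + x) \<partial>lborel) = (\<integral>x. f x \<partial>lborel)"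
  using integral_distr[of "(+) c" lborel borel f] assms by (simp add: lborel_distr_plus)

lemma has_real_derivative_along:
  assumes "F differentiable (at (x + t *\<^sub>R axis i 1))"
  shows "((\<lambda>s. F (x + s *\<^sub>R axis i 1)) has_real_derivative pd i F (x + t *\<^sub>R axis i 1)) (at t)"
proof -
  let ?D = "frechet_derivative F (at (x + t *\<^sub>R axis i 1))"
  have D: "(F has_derivative ?D) (at (x + t *\<^sub>R axis i 1))" using assms frechet_derivative_works by blast
  have "((\<lambda>s. x + s *\<^sub>R axis i 1) has_derivative (\<lambda>s. s *\<^sub>R axis i 1)) (at t)"
    by (auto intro!: derivative_eq_intros)
  from diff_chain_at[OF this D]
  have "((\<lambda>s. F (x + s *\<^sub>R axis i 1)) has_derivative (\<lambda>s. ?D (s *\<^sub>R axis i 1))) (at t)"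
    by (simp add: o_def)
  moreover have "(\<lambda>s. ?D (s *\<^sub>R axis i 1)) = (\<lambda>s. pd i F (x + t *\<^sub>R axis i 1) * s)"
    using linear_cmul[OF has_derivative_linear[OF D]] by (auto simp: pd_def)
  ultimately show ?thesis by (simp add: has_field_derivative_def)
qed

text \<open>The difference quotients in direction \<open>i\<close> have integral zero by translation invariance and
  converge dominatedly to the partial derivative.\<close>

lemma integral_pd_eq_0:
  assumes diff: "\<And>x. F differentiable (at x)" and cont: "continuous_on UNIV (pd i F)"
    and supp: "bounded {x. F x \<noteq> 0}"
  shows "(\<integral>x. pd i F x \<partial>lborel) = 0"
proof -
  let ?e = "axis i 1 :: real^'a"
  have contF: "continuous_on UNIV F"
    using diff by (simp add: differentiable_imp_continuous_on differentiable_on_def differentiable_at_withinI)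
  have [measurable]: "F \<in> borel_measurable borel" "pd i F \<in> borel_measurable borel"
    using contF cont by (simp_all add: borel_measurable_continuous_onI)
  obtain R where R: "{x. F x \<noteq> 0} \<subseteq> cball 0 R" using bounded_subset_ballD[OF supp, of 0] ball_subset_cball by (meson order_trans)
  have pd0: "pd i F x = 0" if "x \<notin> cball 0 R" for x
    by (rule pd_eq_0[of "- cball 0 R"]) (use that R in auto)
  have "bounded (pd i F ` cball 0 R)"
    using continuous_on_subset[OF cont] by (intro compact_imp_bounded compact_continuous_image) auto
  then obtain M where bd: "\<forall>y\<in>pd i F ` cball 0 R. norm y \<le> M" unfolding bounded_iff by blast
  have M: "\<bar>pd i F x\<bar> \<le> \<bar>M\<bar>" for x
  proof (cases "x \<in> cball 0 R")
    case True
    then have "norm (pd i F x) \<le> M" using bd by blast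
    then show ?thesis by simp
  qed (use pd0 in simp)
  define t where "t k = 1 / real (Suc k)" for k
  define Q where "Q k x = (F (t k *\<^sub>R ?e + x) - F x) / t k" for k x
  have t: "0 < t k" "t k \<le> 1" for k by (simp_all add: t_def)
  have intF: "integrable lborel F" using contF supp by (rule integrable_compact_support)
  have Q0: "(\<integral>x. Q k x \<partial>lborel) = 0" for k
  proof -
    have "integrable lborel (\<lambda>x. F (t k *\<^sub>R ?e + x))"
      using intF integrable_distr[of "(+) (t k *\<^sub>R ?e)" lborel borel F] by (simp add: lborel_distr_plus)
    then show ?thesis using intF integral_translate[of F "t k *\<^sub>R ?e"] by (simp add: Q_def)
  qed
  \<comment> \<open>The mean value theorem bounds the quotients by the derivative; steps of length
    at most 1 enlarge the support radius by at most 1.\<close>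
  have Qbound: "\<bar>Q k x\<bar> \<le> \<bar>M\<bar> * indicator (cball 0 (R + 1)) x" for k x
  proof (cases "x \<in> cball 0 (R + 1)")
    case True
    have "\<exists>z. 0 < z \<and> z < t k \<and> F (x + t k *\<^sub>R ?e) - F (x + 0 *\<^sub>R ?e) = (t k - 0) * pd i F (x + z *\<^sub>R ?e)"
      by (rule MVT2[OF t(1)]) (rule has_real_derivative_along[OF diff])
    then obtain z where "F (x + t k *\<^sub>R ?e) - F x = t k * pd i F (x + z *\<^sub>R ?e)" by auto
    then have "Q k x = pd i F (x + z *\<^sub>R ?e)" using t(1)[of k] by (simp add: Q_def add.commute)
    then show ?thesis using M True by simp
  next
    case False
    have "norm (x) \<le> norm (t k *\<^sub>R ?e + x) + norm (t k *\<^sub>R ?e)"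
      using norm_triangle_ineq4[of "t k *\<^sub>R ?e + x" "t k *\<^sub>R ?e"] by simp
    then have "R < norm (t k *\<^sub>R ?e + x)" "R < norm x" using False t[of k] by simp_all
    then have "F (t k *\<^sub>R ?e + x) = 0" "F x = 0" using R by force+
    then show ?thesis by (simp add: Q_def)
  qed
  have lim: "(\<lambda>k. Q k x) \<longlonglongrightarrow> pd i F x" for x
  proof -
    have "((\<lambda>s. F (x + s *\<^sub>R ?e)) has_real_derivative pd i F (x + 0 *\<^sub>R ?e)) (at 0)"
      by (rule has_real_derivative_along[OF diff])
    then have "((\<lambda>h. (F (x + h *\<^sub>R ?e) - F x) / h) \<longlongrightarrow> pd i F x) (at 0)"
      by (simp add: DERIV_def)
    moreover have "filterlim t (at 0) sequentially"
    proof (rule filterlim_atI)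
      show "t \<longlonglongrightarrow> 0" unfolding t_def using LIMSEQ_inverse_real_of_nat by (simp add: inverse_eq_divide)
    qed (use t(1) in \<open>auto simp: less_imp_neq[symmetric] t_def\<close>)
    ultimately have "(\<lambda>k. (F (x + t k *\<^sub>R ?e) - F x) / t k) \<longlonglongrightarrow> pd i F x"
      by (rule filterlim_compose)
    then show ?thesis by (simp add: Q_def add.commute)
  qed
  have "(\<lambda>k. \<integral>x. Q k x \<partial>lborel) \<longlonglongrightarrow> (\<integral>x. pd i F x \<partial>lborel)"
  proof (rule integral_dominated_convergence)
    show "integrable lborel (\<lambda>x. \<bar>M\<bar> * indicator (cball 0 (R + 1)) x)"
      using emeasure_bounded_finite[OF bounded_cball]
      by (intro integrable_mult_right integrable_real_indicator) simp_all
    show "AE x in lborel. norm (Q k x) \<le> \<bar>M\<bar> * indicator (cball 0 (R + 1)) x" for k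
      using Qbound by simp
    show "Q k \<in> borel_measurable lborel" for k unfolding Q_def by measurable
  qed (use lim in simp_all)
  then show ?thesis by (simp add: Q0 LIMSEQ_const_iff)
qed

text \<open>The integral of the derivative of the product vanishes; bounded support of one factor
  already gives the product bounded support.\<close>

lemma integral_by_parts:
  assumes f: "smooth f" and g: "smooth g" and supp: "bounded {x. f x \<noteq> 0}"
  shows "(\<integral>x. f x * pd i g x \<partial>lborel) = - (\<integral>x. pd i f x * g x \<partial>lborel)"
proof -
  have cont: "continuous_on UNIV f" "continuous_on UNIV g" "continuous_on UNIV (pd i f)" "continuous_on UNIV (pd i g)"
    using f g by (auto intro: smooth_continuous smooth_pd)
  have supp': "bounded {x. pd i f x \<noteq> 0}" by (rule bounded_subset[OF bounded_closure[OF supp] pd_support])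
  have pd_fg: "pd i (\<lambda>x. f x * g x) = (\<lambda>x. f x * pd i g x + pd i f x * g x)"
    using f g by (simp add: fun_eq_iff pd_mult smooth_differentiable)
  have i1: "integrable lborel (\<lambda>x. f x * pd i g x)"
    by (rule integrable_compact_support) (auto intro!: continuous_intros cont intro: bounded_subset[OF supp])
  have i2: "integrable lborel (\<lambda>x. pd i f x * g x)"
    by (rule integrable_compact_support) (auto intro!: continuous_intros cont intro: bounded_subset[OF supp'])
  have "(\<integral>x. pd i (\<lambda>x. f x * g x) x \<partial>lborel) = 0"
  proof (rule integral_pd_eq_0)
    show "(\<lambda>x. f x * g x) differentiable at x" for x
      using f g by (simp add: smooth_differentiable)
    show "continuous_on UNIV (pd i (\<lambda>x. f x * g x))"
      unfolding pd_fg by (intro continuous_intros cont)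
  qed (auto intro: bounded_subset[OF supp])
  then show ?thesis unfolding pd_fg using i1 i2 by simp
qed

section \<open>Smooth bump functions\<close>

text \<open>One term of the exponential series is at most the whole series. It expresses that
  exponential decay beats every power.\<close>

lemma power_exp_bound:
  fixes u c :: real assumes "0 \<le> u" "0 < c"
  shows "u ^ n * exp (- c * u) \<le> fact n / c ^ n"
proof -
  have "(c * u) ^ n / fact n \<le> exp (c * u)"
  proof -
    have "(c * u) ^ n /\<^sub>R fact n \<le> (\<Sum>i. (c * u) ^ i /\<^sub>R fact i)"
      using assms summable_exp_generic[of "c * u"] sum_le_suminf[of "\<lambda>i. (c * u) ^ i /\<^sub>R fact i" "{n}"]
      by simp
    then show ?thesis by (simp add: exp_def divide_inverse mult.commute)
  qed
  then show ?thesis using assms by (simp add: exp_minus field_simps power_mult_distrib)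
qed

text \<open>All derivatives of the bump \<open>exp (- c / ((t - a) * (b - t)))\<close> on \<open>(a, b)\<close> are of this form.\<close>

definition bump :: "real \<Rightarrow> real \<Rightarrow> real \<Rightarrow> real poly \<Rightarrow> nat \<Rightarrow> real \<Rightarrow> real" where
  "bump a b c p j t = (if a < t \<and> t < b
     then poly p t * (1 / ((t - a) * (b - t))) ^ j * exp (- c / ((t - a) * (b - t))) else 0)"

text \<open>With \<open>q = (t - a) * (b - t)\<close>, the exponential beats two more powers of
  \<open>1 / q\<close> than the \<open>j\<close> present, so the bump is of order
  \<open>q\<^sup>2\<close>. For \<open>s\<close> outside the interval, \<open>q\<close> is at most
  \<open>(b - a) * \<bar>t - s\<bar>\<close>. Quadratic decay at the endpoints makes the difference
  quotients there tend to 0.\<close>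

lemma bump_quadratic_bound:
  assumes c: "0 < c"
  shows "\<exists>K\<ge>0. \<forall>t s. \<not> (a < s \<and> s < b) \<longrightarrow> \<bar>bump a b c p j t\<bar> \<le> K * (t - s)\<^sup>2"
proof -
  have "compact (poly p ` {a..b})"
    by (intro compact_continuous_image continuous_intros) auto
  from compact_imp_bounded[OF this] obtain B where "\<forall>x\<in>poly p ` {a..b}. norm x \<le> B"
    unfolding bounded_iff by blast
  then have B: "\<bar>poly p t\<bar> \<le> B" if "t \<in> {a..b}" for t using that by simp
  \<comment> \<open>\<open>power_exp_bound\<close> at exponent \<open>j + 2\<close>: the two extra
    powers are traded for the factor \<open>q\<^sup>2\<close>.\<close>
  define L where "L = fact (j + 2) / c ^ (j + 2)"
  have L: "0 \<le> L" using c by (simp add: L_def)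
  define K where "K = \<bar>B\<bar> * L * (b - a)\<^sup>2"
  have "\<bar>bump a b c p j t\<bar> \<le> K * (t - s)\<^sup>2" if s: "\<not> (a < s \<and> s < b)" for t s
  proof (cases "a < t \<and> t < b")
    case True
    define q where "q = (t - a) * (b - t)"
    have q: "0 < q" using True by (simp add: q_def)
    have qs: "q \<le> (b - a) * \<bar>t - s\<bar>"
    proof (cases "s \<le> a")
      case True
      then have "(t - a) * (b - t) \<le> \<bar>t - s\<bar> * (b - a)"
        using \<open>a < t \<and> t < b\<close> by (intro mult_mono) auto
      then show ?thesis by (simp add: q_def mult.commute)
    next
      case False
      then have "(t - a) * (b - t) \<le> (b - a) * \<bar>t - s\<bar>"
        using \<open>a < t \<and> t < b\<close> s by (intro mult_mono) auto
      then show ?thesis by (simp add: q_def)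
    qed
    have "(1 / q) ^ (j + 2) * exp (- c * (1 / q)) \<le> L"
      unfolding L_def by (rule power_exp_bound) (use q c in auto)
    then have "(1 / q) ^ (j + 2) * exp (- c * (1 / q)) * q\<^sup>2 \<le> L * q\<^sup>2" by (intro mult_right_mono) auto
    then have e: "(1 / q) ^ j * exp (- c / q) \<le> L * q\<^sup>2"
      using q by (simp add: power_add power_one_over field_simps power2_eq_square)
    have "q\<^sup>2 \<le> ((b - a) * \<bar>t - s\<bar>)\<^sup>2" using q qs by (intro power_mono) auto
    then have q2: "L * q\<^sup>2 \<le> L * ((b - a)\<^sup>2 * (t - s)\<^sup>2)"
      using L by (intro mult_left_mono) (simp_all add: power_mult_distrib)
    have "\<bar>bump a b c p j t\<bar> = \<bar>poly p t\<bar> * ((1 / q) ^ j * exp (- c / q))"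
      using True q by (simp add: bump_def abs_mult flip: q_def)
    also have "\<dots> \<le> \<bar>B\<bar> * (L * ((b - a)\<^sup>2 * (t - s)\<^sup>2))"
    proof (rule mult_mono)
      show "\<bar>poly p t\<bar> \<le> \<bar>B\<bar>" using B[of t] True by simp
      show "(1 / q) ^ j * exp (- c / q) \<le> L * ((b - a)\<^sup>2 * (t - s)\<^sup>2)" using e q2 by linarith
    qed (use q in simp_all)
    finally show ?thesis by (simp add: K_def mult.assoc)
  qed (use L in \<open>auto simp: bump_def K_def\<close>)
  moreover have "0 \<le> K" using L by (simp add: K_def)
  ultimately show ?thesis by blast
qed

text \<open>The numerator obtained by differentiating \<open>p * q^(-j) * exp (- c / q)\<close> and
  bringing the three terms to the common denominator \<open>q^(j + 2)\<close>; the last term is the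
  derivative of the exponent, \<open>c * pderiv q / q^2\<close>.\<close>

definition bump_deriv_poly :: "real \<Rightarrow> real \<Rightarrow> real \<Rightarrow> real poly \<Rightarrow> nat \<Rightarrow> real poly" where
  "bump_deriv_poly a b c p j = (let q = [:-a, 1:] * [:b, -1:] in
     pderiv p * q * q - smult (of_nat j) (p * pderiv q * q) + smult c (p * pderiv q))"

lemma bump_has_derivative:
  assumes c: "0 < c"
  shows "(bump a b c p j has_real_derivative bump a b c (bump_deriv_poly a b c p j) (j + 2) t) (at t)"
proof (cases "a < t \<and> t < b")
  case True
  define q where "q s = (s - a) * (b - s)" for s
  define q' where "q' = (b - t) - (t - a)"
  have q: "q t \<noteq> 0" using True by (simp add: q_def)
  have dq: "(q has_real_derivative q') (at t)"
    unfolding q_def q'_def by (auto intro!: derivative_eq_intros)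
  have dw: "((\<lambda>s. 1 / q s) has_real_derivative - q' * (1 / q t)\<^sup>2) (at t)"
    using dq q by (auto intro!: derivative_eq_intros simp: power2_eq_square)
  have dwj: "((\<lambda>s. (1 / q s) ^ j) has_real_derivative of_nat j * (1 / q t) ^ (j - 1) * (- q' * (1 / q t)\<^sup>2)) (at t)"
    by (rule DERIV_cong[OF DERIV_power[OF dw]]) simp
  have de: "((\<lambda>s. exp (- c * (1 / q s))) has_real_derivative exp (- c * (1 / q t)) * (- c * (- q' * (1 / q t)\<^sup>2))) (at t)"
    by (rule DERIV_fun_exp[OF DERIV_cmult[OF dw]])
  \<comment> \<open>The subtraction in \<open>j - 1\<close> is truncated; for \<open>j = 0\<close>
    the factor \<open>of_nat j\<close> makes both sides vanish.\<close>
  have jw: "of_nat j * (1 / q t) ^ (j - 1) = of_nat j * ((1 / q t) ^ j * q t)"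
    using q by (cases j) simp_all
  have Q: "poly ([:-a, 1:] * [:b, -1:]) t = q t" by (simp add: q_def algebra_simps)
  have Q': "poly (pderiv ([:-a, 1:] * [:b, -1:])) t = q'" by (simp add: q'_def pderiv_mult pderiv_pCons algebra_simps)
  have "((\<lambda>s. poly p s * (1 / q s) ^ j * exp (- c * (1 / q s))) has_real_derivative
      poly (bump_deriv_poly a b c p j) t * (1 / q t) ^ (j + 2) * exp (- c * (1 / q t))) (at t)"
  proof (rule DERIV_cong[OF DERIV_mult[OF DERIV_mult[OF poly_DERIV dwj] de]])
    show "(poly (pderiv p) t * (1 / q t) ^ j + of_nat j * (1 / q t) ^ (j - 1) * (- q' * (1 / q t)\<^sup>2) * poly p t)
          * exp (- c * (1 / q t))
        + exp (- c * (1 / q t)) * (- c * (- q' * (1 / q t)\<^sup>2)) * (poly p t * (1 / q t) ^ j)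
        = poly (bump_deriv_poly a b c p j) t * (1 / q t) ^ (j + 2) * exp (- c * (1 / q t))"
      unfolding jw bump_deriv_poly_def Let_def poly_add poly_diff poly_smult poly_mult[of _ "[:-a, 1:] * [:b, -1:]"] poly_mult[of p] Q Q'
        poly_mult[of "pderiv p"]
      using q by (simp add: field_simps power_add power2_eq_square)
  qed
  then have *: "((\<lambda>s. poly p s * (1 / q s) ^ j * exp (- c * (1 / q s))) has_real_derivative
      bump a b c (bump_deriv_poly a b c p j) (j + 2) t) (at t)"
    using True by (simp add: bump_def q_def)
  show ?thesis
    by (rule has_field_derivative_transform_within_open[OF *, of "{a<..<b}"])
      (use True in \<open>auto simp: bump_def q_def\<close>)
next
  case False
  \<comment> \<open>Outside the open interval, endpoints included, the point \<open>t\<close> itself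
    may serve as \<open>s\<close> in the quadratic bound, and the derivative is 0.\<close>
  obtain K where K: "0 \<le> K" "\<And>s. \<bar>bump a b c p j s\<bar> \<le> K * (s - t)\<^sup>2"
    using bump_quadratic_bound[OF c, of a b p j] False by blast
  have t0: "bump a b c p j t = 0" "bump a b c (bump_deriv_poly a b c p j) (j + 2) t = 0"
    using False by (auto simp: bump_def)
  have "((\<lambda>h. (bump a b c p j (t + h) - bump a b c p j t) / h) \<longlongrightarrow> 0) (at 0)"
  proof (rule Lim_null_comparison)
    show "\<forall>\<^sub>F h in at 0. norm ((bump a b c p j (t + h) - bump a b c p j t) / h) \<le> K * \<bar>h\<bar>"
    proof (rule eventually_at_topological[THEN iffD2], intro exI[of _ UNIV] conjI ballI impI)
      fix h :: real assume "h \<noteq> 0"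
      then show "norm ((bump a b c p j (t + h) - bump a b c p j t) / h) \<le> K * \<bar>h\<bar>"
        using K(2)[of "t + h"] by (simp add: t0 divide_le_eq power2_eq_square abs_mult_self_eq mult.assoc)
    qed auto
    show "((\<lambda>h. K * \<bar>h\<bar>) \<longlongrightarrow> 0) (at 0)" by (auto intro!: tendsto_eq_intros)
  qed
  then show ?thesis unfolding DERIV_def t0(2) .
qed

lemma bump_differentiable_comp:
  assumes "0 < c"
  shows "((\<lambda>x::real^'n. bump a b c p j (x $ i)) has_derivative
    (\<lambda>y. bump a b c (bump_deriv_poly a b c p j) (j + 2) (x $ i) * y $ i)) (at x)"
proof -
  have "((\<lambda>x::real^'n. x $ i) has_derivative (\<lambda>y. y $ i)) (at x)"
    by (intro bounded_linear_imp_has_derivative bounded_linear_vec_nth)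
  from diff_chain_at[OF this bump_has_derivative[OF assms, unfolded has_field_derivative_def]]
  show ?thesis by (simp add: o_def)
qed

text \<open>Polynomial and exponent may differ between coordinates, because a partial derivative
  changes one factor only; this closes the family under \<open>pd\<close>.\<close>

definition box_bump :: "real^('n::finite) \<Rightarrow> real^'n \<Rightarrow> real \<Rightarrow> ('n \<Rightarrow> real poly) \<Rightarrow> ('n \<Rightarrow> nat) \<Rightarrow> real^'n \<Rightarrow> real" where
  "box_bump a b c p j x = (\<Prod>i\<in>UNIV. bump (a $ i) (b $ i) c (p i) (j i) (x $ i))"

lemma box_bump_has_derivative:
  fixes a b x :: "real^('n::finite)"
  assumes "0 < c"
  shows "(box_bump a b c p j has_derivative
    (\<lambda>y. \<Sum>i\<in>UNIV. (bump (a $ i) (b $ i) c (bump_deriv_poly (a $ i) (b $ i) c (p i) (j i)) (j i + 2) (x $ i) * y $ i)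
      * (\<Prod>k\<in>UNIV - {i}. bump (a $ k) (b $ k) c (p k) (j k) (x $ k)))) (at x)"
  unfolding box_bump_def by (rule has_derivative_prod) (rule bump_differentiable_comp[OF assms])

lemma pd_box_bump:
  assumes "0 < c"
  shows "pd k (box_bump a b c p j)
    = box_bump a b c (p(k := bump_deriv_poly (a $ k) (b $ k) c (p k) (j k))) (j(k := j k + 2))"
proof
  fix x
  let ?B = "\<lambda>i. bump (a $ i) (b $ i) c (bump_deriv_poly (a $ i) (b $ i) c (p i) (j i)) (j i + 2) (x $ i)"
  let ?P = "\<lambda>i. \<Prod>k\<in>UNIV - {i}. bump (a $ k) (b $ k) c (p k) (j k) (x $ k)"
  have "pd k (box_bump a b c p j) x = (\<Sum>i\<in>UNIV. (?B i * axis k 1 $ i) * ?P i)"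
    by (rule pd_eqI[OF box_bump_has_derivative[OF assms]])
  also have "\<dots> = (\<Sum>i\<in>UNIV. if i = k then ?B i * ?P i else 0)"
    by (rule sum.cong) (auto simp: axis_def)
  also have "\<dots> = ?B k * ?P k" by simp
  also have "\<dots> = box_bump a b c (p(k := bump_deriv_poly (a $ k) (b $ k) c (p k) (j k))) (j(k := j k + 2)) x"
    unfolding box_bump_def
    by (subst prod.remove[of UNIV k]) (auto intro!: prod.cong)
  finally show "pd k (box_bump a b c p j) x = \<dots>" .
qed

lemma smooth_box_bump: "0 < c \<Longrightarrow> smooth (box_bump a b c p j)"
proof (rule smooth_coinduct[where P = "\<lambda>f. \<exists>p j. f = box_bump a b c p j"])
  assume c: "0 < c"
  show "g differentiable (at x)" if "\<exists>p j. g = box_bump a b c p j" for g x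
    using box_bump_has_derivative[OF c] that unfolding differentiable_def by blast
  show "\<exists>p j. pd i g = box_bump a b c p j" if "\<exists>p j. g = box_bump a b c p j" for g i
    using that pd_box_bump[OF c] by blast
qed blast

lemma box_bump_support: "x \<notin> box a b \<Longrightarrow> box_bump a b c p j x = 0"
  unfolding box_bump_def mem_box_cart by (intro prod_zero) (auto simp: bump_def)

lemma box_bump_bound: "0 < c \<Longrightarrow> \<bar>box_bump a b c (\<lambda>_. 1) (\<lambda>_. 0) x\<bar> \<le> 1"
  unfolding box_bump_def abs_prod by (intro prod_le_1) (auto simp: bump_def divide_nonneg_pos)

text \<open>Sending the decay rate \<open>c\<close> to 0 flattens every factor to 1 inside its
  interval and leaves 0 outside. So indicators of boxes are bounded pointwise limits of smooth
  functions, without mollification.\<close>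

lemma box_bump_tendsto:
  "(\<lambda>k. box_bump a b (1 / real (Suc k)) (\<lambda>_. 1) (\<lambda>_. 0) x) \<longlonglongrightarrow> indicator (box a b) x"
proof (cases "x \<in> box a b")
  case True
  have "(\<lambda>k. bump (a $ i) (b $ i) (1 / real (Suc k)) 1 0 (x $ i)) \<longlonglongrightarrow> 1" for i
  proof -
    have "a $ i < x $ i" "x $ i < b $ i" using True by (auto simp: mem_box_cart)
    then have eq: "bump (a $ i) (b $ i) (1 / real (Suc k)) 1 0 (x $ i)
        = exp (- ((1 / real (Suc k)) * (1 / ((x $ i - a $ i) * (b $ i - x $ i)))))" for k
      by (simp add: bump_def)
    have "(\<lambda>k. 1 / real (Suc k)) \<longlonglongrightarrow> 0" using LIMSEQ_inverse_real_of_nat by (simp add: inverse_eq_divide)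
    then have "(\<lambda>k. exp (- ((1 / real (Suc k)) * (1 / ((x $ i - a $ i) * (b $ i - x $ i))))))
        \<longlonglongrightarrow> exp (- (0 * (1 / ((x $ i - a $ i) * (b $ i - x $ i)))))"
      by (intro tendsto_intros)
    then show ?thesis unfolding eq by simp
  qed
  then have "(\<lambda>k. \<Prod>i\<in>UNIV. bump (a $ i) (b $ i) (1 / real (Suc k)) 1 0 (x $ i)) \<longlonglongrightarrow> (\<Prod>i\<in>(UNIV::'a set). 1)"
    by (rule tendsto_prod)
  then show ?thesis using True by (simp add: box_bump_def)
qed (simp add: box_bump_support)

lemma AE_cbox_box: "AE x in lborel. x \<in> cbox a b \<longrightarrow> x \<in> box a (b :: 'a::euclidean_space)"
proof (rule AE_I')
  have "emeasure lborel (cbox a b - box a b) = emeasure lborel (cbox a b) - emeasure lborel (box a b)"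
    by (rule emeasure_Diff) (auto simp: box_subset_cbox emeasure_lborel_box_eq)
  then show "cbox a b - box a b \<in> null_sets lborel"
    by (intro null_setsI) (auto simp: emeasure_lborel_box_eq emeasure_lborel_cbox_eq)
qed auto

text \<open>Boxes form an intersection-stable generator of the Borel sets, and the sets over whose
  part in \<open>box c d\<close> the function integrates to zero form a Dynkin system. Hence all
  Borel sets qualify, among them those where \<open>g\<close> has a fixed sign.\<close>

lemma AE_zero_of_box_integrals:
  fixes g :: "real^'n \<Rightarrow> real"
  assumes g: "integrable lborel g"
    and zero: "\<And>a b. box a b \<subseteq> box c d \<Longrightarrow> set_lebesgue_integral lborel (box a b) g = 0"
  shows "AE x in lborel. x \<in> box c d \<longrightarrow> g x = 0"
proof -
  let ?K = "box c d"
  have si: "set_integrable lborel A g" if "A \<in> sets borel" for A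
    using g that unfolding set_integrable_def by (intro integrable_mult_indicator) auto
  have all: "set_lebesgue_integral lborel (A \<inter> ?K) g = 0" if A: "A \<in> sets borel" for A
  proof -
    let ?G = "range (\<lambda>(a, b). box a b :: (real^'n) set)"
    have stable: "Int_stable ?G" by (auto simp: Int_stable_def box_Int_box)
    have "A \<in> sigma_sets UNIV ?G" using A unfolding borel_eq_box by simp
    show ?thesis
    proof (rule sigma_sets_induct_disjoint[where P = "\<lambda>A. set_lebesgue_integral lborel (A \<inter> ?K) g = 0",
          OF stable _ \<open>A \<in> sigma_sets UNIV ?G\<close>])
      fix A :: "(real^'n) set" assume "A \<in> ?G"
      then obtain a b where "A = box a b" by auto
      then obtain a' b' where "A \<inter> ?K = box a' b'" using box_Int_box by blast
      then show "set_lebesgue_integral lborel (A \<inter> ?K) g = 0" using zero[of a' b'] by auto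
    next
      show "set_lebesgue_integral lborel ({} \<inter> ?K) g = 0" by (simp add: set_lebesgue_integral_def)
    next
      fix A :: "(real^'n) set"
      assume A: "A \<in> sigma_sets UNIV ?G" and 0: "set_lebesgue_integral lborel (A \<inter> ?K) g = 0"
      have A: "A \<in> sets borel" using A unfolding borel_eq_box by simp
      have "set_lebesgue_integral lborel ((A \<inter> ?K) \<union> ((UNIV - A) \<inter> ?K)) g
          = set_lebesgue_integral lborel (A \<inter> ?K) g + set_lebesgue_integral lborel ((UNIV - A) \<inter> ?K) g"
        using A by (intro set_integral_Un si) auto
      moreover have "(A \<inter> ?K) \<union> ((UNIV - A) \<inter> ?K) = ?K" by auto
      ultimately show "set_lebesgue_integral lborel ((UNIV - A) \<inter> ?K) g = 0" using 0 zero[of c d] by simp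
    next
      fix A :: "nat \<Rightarrow> (real^'n) set"
      assume disj: "disjoint_family A" and A: "range A \<subseteq> sigma_sets UNIV ?G"
        and 0: "\<And>i. set_lebesgue_integral lborel (A i \<inter> ?K) g = 0"
      have A: "A i \<in> sets borel" for i using A unfolding borel_eq_box by auto
      have "set_lebesgue_integral lborel (\<Union>i. A i \<inter> ?K) g = (\<Sum>i. set_lebesgue_integral lborel (A i \<inter> ?K) g)"
      proof (rule lebesgue_integral_countable_add)
        show "A i \<inter> ?K \<in> sets lborel" for i using A by simp
        show "(A i \<inter> ?K) \<inter> (A j \<inter> ?K) = {}" if "i \<noteq> j" for i j
          using disj that by (auto simp: disjoint_family_on_def)
        show "set_integrable lborel (\<Union>i. A i \<inter> ?K) g" using A by (intro si) auto
      qed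
      then show "set_lebesgue_integral lborel ((\<Union>i. A i) \<inter> ?K) g = 0" using 0 by simp
    qed simp
  qed
  have [measurable]: "g \<in> borel_measurable borel" using g by simp
  \<comment> \<open>The factor \<open>r\<close> treats both signs at once: the values 1 and -1
    exclude positive and negative values of \<open>g\<close>.\<close>
  have sign: "AE x in lborel. x \<in> ?K \<longrightarrow> r * g x \<le> 0" for r
  proof -
    let ?A = "{x. 0 < r * g x}"
    have A: "?A \<in> sets borel" by measurable
    have "(\<integral>x. r * (indicator (?A \<inter> ?K) x * g x) \<partial>lborel) = 0"
      using all[OF A] by (simp add: set_lebesgue_integral_def)
    moreover have "integrable lborel (\<lambda>x. r * (indicator (?A \<inter> ?K) x * g x))"
      using si[of "?A \<inter> ?K"] A by (simp add: set_integrable_def)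
    ultimately have "AE x in lborel. r * (indicator (?A \<inter> ?K) x * g x) = 0"
      by (subst (asm) integral_nonneg_eq_0_iff_AE) (auto simp: indicator_def)
    then show ?thesis by (auto elim!: AE_mp simp: indicator_def)
  qed
  show ?thesis using sign[of 1] sign[of "-1"] by eventually_elim auto
qed

section \<open>Test functions and weak derivatives\<close>

context bounded_open_set
begin

abbreviation "TF \<equiv> test_functions \<Omega>"
abbreviation "ip \<equiv> ip_L2 \<Omega>"

lemma TF_smooth: "f \<in> TF \<Longrightarrow> smooth f"
  by (simp add: test_functions_def)

lemma TF_bounded: "f \<in> TF \<Longrightarrow> bounded {x. f x \<noteq> 0}"
  unfolding test_functions_def
  by (rule bounded_subset[OF compact_imp_bounded closure_subset]) simp

lemma TF_support: "f \<in> TF \<Longrightarrow> closure {x. f x \<noteq> 0} \<subseteq> \<Omega>"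
  by (simp add: test_functions_def)

lemma TF_outside: "f \<in> TF \<Longrightarrow> x \<notin> \<Omega> \<Longrightarrow> f x = 0"
  using closure_subset[of "{x. f x \<noteq> 0}"] TF_support[of f] by blast

lemma TF_measurable: "f \<in> TF \<Longrightarrow> f \<in> borel_measurable borel"
  by (intro borel_measurable_continuous_onI smooth_continuous TF_smooth)

lemma TF_I:
  assumes "smooth f" "{x. f x \<noteq> 0} \<subseteq> S" "closed S" "S \<subseteq> \<Omega>"
  shows "f \<in> TF"
proof -
  have "closure {x. f x \<noteq> 0} \<subseteq> S" using assms(2,3) by (rule closure_minimal)
  then have "closure {x. f x \<noteq> 0} \<subseteq> \<Omega>" using assms(4) by simp
  moreover from this have "compact (closure {x. f x \<noteq> 0})"
    using bounded_\<Omega> bounded_subset by (auto simp: compact_eq_bounded_closed)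
  ultimately show ?thesis using assms(1) by (simp add: test_functions_def)
qed

lemma TF_pd: assumes "f \<in> TF" shows "pd i f \<in> TF"
proof (rule TF_I)
  show "smooth (pd i f)" using assms by (simp add: TF_smooth smooth_pd)
  show "{x. pd i f x \<noteq> 0} \<subseteq> closure {x. f x \<noteq> 0}" by (rule pd_support)
  show "closure {x. f x \<noteq> 0} \<subseteq> \<Omega>" using assms by (simp add: test_functions_def)
qed simp

lemma TF_iter_pd: "f \<in> TF \<Longrightarrow> iter_pd is f \<in> TF"
  by (induction "is") (simp_all only: iter_pd_Cons TF_pd iter_pd.simps(1))

lemma TF_add: assumes "f \<in> TF" "g \<in> TF" shows "(\<lambda>x. f x + g x) \<in> TF"
proof (rule TF_I)
  show "smooth (\<lambda>x. f x + g x)" using assms by (intro smooth_add TF_smooth)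
  show "{x. f x + g x \<noteq> 0} \<subseteq> closure {x. f x \<noteq> 0} \<union> closure {x. g x \<noteq> 0}"
    using closure_subset[of "{x. f x \<noteq> 0}"] closure_subset[of "{x. g x \<noteq> 0}"] by force
qed (use TF_support[OF assms(1)] TF_support[OF assms(2)] in auto)

lemma TF_scale: assumes "f \<in> TF" shows "(\<lambda>x. c * f x) \<in> TF"
proof (rule TF_I)
  show "smooth (\<lambda>x. c * f x)" using assms by (intro smooth_scale TF_smooth)
  show "{x. c * f x \<noteq> 0} \<subseteq> closure {x. f x \<noteq> 0}"
    using closure_subset[of "{x. f x \<noteq> 0}"] by force
qed (use TF_support[OF assms] in auto)

lemma TF_zero: "(\<lambda>x. 0) \<in> TF"
proof (rule TF_I[where S = "{}"])
  show "smooth (\<lambda>x. 0)"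
    by (rule smooth_coinduct[where P = "\<lambda>f. f = (\<lambda>x. 0)"]) (auto simp: pd_def)
qed auto

lemma TF_box_bump:
  assumes "cbox a b \<subseteq> \<Omega>" "0 < c" shows "box_bump a b c p j \<in> TF"
proof (rule TF_I)
  show "{x. box_bump a b c p j x \<noteq> 0} \<subseteq> cbox a b"
    using box_bump_support[of _ a b c p j] box_subset_cbox[of a b] by blast
qed (use assms smooth_box_bump in auto)

lemma TF_L2: assumes f: "f \<in> TF" shows "abs_lfun f \<in> L2 \<Omega>"
proof -
  have ae: "AE x in lborel. rep_lfun (abs_lfun f) x = f x" using f by (intro rep_abs_lfun TF_measurable)
  have "abs_lfun f \<in> L0 \<Omega>" unfolding L0_def using ae TF_outside[OF f] by (auto elim!: AE_mp)
  moreover have "integrable lborel (\<lambda>x. (f x)\<^sup>2)"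
    using smooth_continuous[OF TF_smooth[OF f]] TF_bounded[OF f]
    by (intro integrable_compact_support continuous_intros) auto
  then have "integrable lborel (\<lambda>x. (rep_lfun (abs_lfun f) x)\<^sup>2)"
    by (subst integrable_cong_AE[where g = "\<lambda>x. (f x)\<^sup>2"])
      (use ae TF_measurable[OF f] in \<open>auto elim!: AE_mp\<close>)
  ultimately show ?thesis by (simp add: L2_iff)
qed

lemma ip_L2_TF:
  assumes "u \<in> L2 \<Omega>" "f \<in> TF"
  shows "ip u (abs_lfun f) = (\<integral>x. rep_lfun u x * f x \<partial>lborel)"
proof -
  have "ip u (abs_lfun f) = (\<integral>x. rep_lfun u x * rep_lfun (abs_lfun f) x \<partial>lborel)"
    using assms(1) by (intro ip_L2_eq L2_L0)
  also have "\<dots> = (\<integral>x. rep_lfun u x * f x \<partial>lborel)"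
    by (rule integral_cong_AE)
      (use rep_abs_lfun[OF TF_measurable[OF assms(2)]] TF_measurable[OF assms(2)] in \<open>auto elim!: AE_mp\<close>)
  finally show ?thesis .
qed

lemma ip_L2_TF2:
  assumes "f \<in> TF" "g \<in> TF"
  shows "ip (abs_lfun f) (abs_lfun g) = (\<integral>x. f x * g x \<partial>lborel)"
proof -
  have "(\<integral>x. rep_lfun (abs_lfun f) x * g x \<partial>lborel) = (\<integral>x. f x * g x \<partial>lborel)"
    by (rule integral_cong_AE)
      (use rep_abs_lfun[OF TF_measurable[OF assms(1)]] TF_measurable[OF assms(1)] TF_measurable[OF assms(2)]
        in \<open>auto elim!: AE_mp\<close>)
  then show ?thesis using ip_L2_TF[OF TF_L2[OF assms(1)] assms(2)] by simp
qed

lemma set_integral_L2: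
  assumes "u \<in> L2 \<Omega>" "f \<in> TF"
  shows "set_lebesgue_integral lborel \<Omega> (\<lambda>x. rep_lfun u x * f x) = ip u (abs_lfun f)"
  unfolding ip_L2_TF[OF assms] set_lebesgue_integral_def
  by (rule Bochner_Integration.integral_cong) (use TF_outside[OF assms(2)] in \<open>auto simp: indicator_def\<close>)

text \<open>Rewritten with the L2 product, weak differentiability becomes a family of identities to
  which bilinearity and Cauchy-Schwarz apply.\<close>

lemma is_weak_deriv_iff:
  assumes "u \<in> L2 \<Omega>" "g \<in> L2 \<Omega>"
  shows "is_weak_deriv \<Omega> is u g \<longleftrightarrow>
    (\<forall>f\<in>TF. ip u (abs_lfun (iter_pd is f)) = (-1) ^ length is * ip g (abs_lfun f))"
  unfolding is_weak_deriv_def using assms by (simp add: set_integral_L2 TF_iter_pd)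

text \<open>Box bumps are test functions dominated by 1, so in the limit \<open>g\<close> integrates
  to zero over every box whose closure lies in \<Omega>. Countably many closed boxes exhaust
  \<Omega>, which turns this into vanishing almost everywhere.\<close>

lemma fundamental_lemma:
  assumes g: "g \<in> L2 \<Omega>" and zero: "\<And>f. f \<in> TF \<Longrightarrow> ip g (abs_lfun f) = 0"
  shows "g = 0"
proof -
  have int: "integrable lborel (rep_lfun g)" by (rule L2_integrable[OF g])
  have box0: "set_lebesgue_integral lborel (box a b) (rep_lfun g) = 0" if ab: "cbox a b \<subseteq> \<Omega>" for a b
  proof -
    let ?\<phi> = "\<lambda>k. box_bump a b (1 / real (Suc k)) (\<lambda>_. 1) (\<lambda>_. 0)"
    have TF: "?\<phi> k \<in> TF" for k by (rule TF_box_bump[OF ab]) simp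
    have [measurable]: "?\<phi> k \<in> borel_measurable borel" for k using TF_measurable[OF TF] .
    have "(\<lambda>k. \<integral>x. rep_lfun g x * ?\<phi> k x \<partial>lborel) \<longlonglongrightarrow> (\<integral>x. rep_lfun g x * indicator (box a b) x \<partial>lborel)"
    proof (rule integral_dominated_convergence)
      show "integrable lborel (\<lambda>x. \<bar>rep_lfun g x\<bar>)" using int by simp
      show "AE x in lborel. (\<lambda>k. rep_lfun g x * ?\<phi> k x) \<longlonglongrightarrow> rep_lfun g x * indicator (box a b) x"
        by (intro AE_I2 tendsto_mult_left box_bump_tendsto)
      show "AE x in lborel. norm (rep_lfun g x * ?\<phi> k x) \<le> \<bar>rep_lfun g x\<bar>" for k
        by (intro AE_I2) (simp add: abs_mult mult_left_le box_bump_bound del: of_nat_Suc)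
      show "(\<lambda>x. rep_lfun g x * ?\<phi> k x) \<in> borel_measurable lborel" for k by measurable
    qed measurable
    moreover have "(\<integral>x. rep_lfun g x * ?\<phi> k x \<partial>lborel) = 0" for k
      using zero[OF TF] ip_L2_TF[OF g TF] by simp
    ultimately have "(\<integral>x. rep_lfun g x * indicator (box a b) x \<partial>lborel) = 0"
      by (simp add: LIMSEQ_const_iff)
    then show ?thesis by (simp add: set_lebesgue_integral_def mult.commute)
  qed
  obtain D where D: "countable D" "D \<subseteq> Pow \<Omega>" "\<And>X. X \<in> D \<Longrightarrow> \<exists>a b. X = cbox a b" "\<Union>D = \<Omega>"
    by (rule open_countable_Union_open_cbox[OF open_\<Omega>]) (rule that; assumption)
  have "AE x in lborel. \<forall>X\<in>D. x \<in> X \<longrightarrow> rep_lfun g x = 0"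
  proof (subst AE_ball_countable[OF D(1)], intro ballI)
    fix X assume X: "X \<in> D"
    then obtain c d where cd: "X = cbox c d" using D(3) by blast
    have "AE x in lborel. x \<in> box c d \<longrightarrow> rep_lfun g x = 0"
    proof (rule AE_zero_of_box_integrals[OF int])
      fix a b assume ab: "box a b \<subseteq> box c d"
      show "set_lebesgue_integral lborel (box a b) (rep_lfun g) = 0"
      proof (cases "box a b = {}")
        case False
        then have cd0: "box c d \<noteq> {}" using ab by blast
        \<comment> \<open>Bumps need closed boxes inside \<Omega>. Taking closures places the closed
          subbox in the closed cell; closure of a box is the closed box only if it is
          nonempty.\<close>
        have "cbox a b \<subseteq> cbox c d"
          using closure_mono[OF ab] unfolding closure_box[OF False] closure_box[OF cd0] .
        then show ?thesis using X D(2) cd by (intro box0) auto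
      qed (simp add: set_lebesgue_integral_def)
    qed
    then show "AE x in lborel. x \<in> X \<longrightarrow> rep_lfun g x = 0"
      using AE_cbox_box[of c d] unfolding cd by eventually_elim auto
  qed
  moreover have "AE x in lborel. x \<notin> \<Omega> \<longrightarrow> rep_lfun g x = 0" using g by (simp add: L2_iff L0_def)
  ultimately have "AE x in lborel. rep_lfun g x = rep_lfun 0 x"
    using rep_zero
  proof eventually_elim
    case (elim x)
    then show ?case using D(4) by (cases "x \<in> \<Omega>") auto
  qed
  then show ?thesis by (rule lfun_eqI)
qed

abbreviation "D \<equiv> weak_deriv \<Omega>"
abbreviation "E \<equiv> energy_ip \<Omega>"

lemma TF_by_parts:
  assumes "f \<in> TF" "g \<in> TF"
  shows "ip (abs_lfun f) (abs_lfun (pd i g)) = - ip (abs_lfun (pd i f)) (abs_lfun g)"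
  using integral_by_parts[of f g i] assms by (simp add: ip_L2_TF2 TF_pd TF_smooth TF_bounded)

text \<open>The order of the derivatives is reversed because no symmetry of second derivatives is used.\<close>

lemma TF_iter_by_parts:
  assumes "f \<in> TF" "g \<in> TF"
  shows "ip (abs_lfun f) (abs_lfun (iter_pd is g))
    = (-1) ^ length is * ip (abs_lfun (iter_pd (rev is) f)) (abs_lfun g)"
  using assms(1)
proof (induction "is" arbitrary: f)
  case (Cons i "is")
  have "ip (abs_lfun f) (abs_lfun (iter_pd (i # is) g))
      = - ip (abs_lfun (pd i f)) (abs_lfun (iter_pd is g))"
    unfolding iter_pd_Cons by (rule TF_by_parts[OF Cons.prems TF_iter_pd[OF assms(2)]])
  also have "\<dots> = - ((-1) ^ length is * ip (abs_lfun (iter_pd (rev is) (pd i f))) (abs_lfun g))"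
    using Cons.IH[OF TF_pd[OF Cons.prems]] by simp
  finally show ?case by (simp add: iter_pd_snoc)
qed simp

lemma TF_weak_deriv: "f \<in> TF \<Longrightarrow> is_weak_deriv \<Omega> is (abs_lfun f) (abs_lfun (iter_pd (rev is) f))"
  by (simp add: is_weak_deriv_iff TF_L2 TF_iter_pd TF_iter_by_parts)

lemma is_weak_deriv_unique:
  assumes "u \<in> L2 \<Omega>" "g \<in> L2 \<Omega>" "h \<in> L2 \<Omega>" "is_weak_deriv \<Omega> is u g" "is_weak_deriv \<Omega> is u h"
  shows "g = h"
proof -
  have "g - h = 0"
  proof (rule fundamental_lemma)
    fix f assume f: "f \<in> TF"
    have "(-1) ^ length is * ip g (abs_lfun f) = (-1) ^ length is * ip h (abs_lfun f)"
      using assms f by (simp add: is_weak_deriv_iff)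
    then show "ip (g - h) (abs_lfun f) = 0"
      using assms f by (simp add: L2.diff_left TF_L2)
  qed (use assms in simp)
  then show ?thesis by simp
qed

lemma weak_deriv_eqI:
  assumes "u \<in> L2 \<Omega>" "g \<in> L2 \<Omega>" "is_weak_deriv \<Omega> is u g"
  shows "D is u = g"
  unfolding weak_deriv_def using assms is_weak_deriv_unique[OF assms(1)] by (intro the_equality) auto

lemma weak_deriv_TF: "f \<in> TF \<Longrightarrow> D is (abs_lfun f) = abs_lfun (iter_pd (rev is) f)"
  by (intro weak_deriv_eqI TF_L2 TF_iter_pd TF_weak_deriv)

lemma weak_deriv_Nil: "u \<in> L2 \<Omega> \<Longrightarrow> D [] u = u"
  by (intro weak_deriv_eqI) (simp_all add: is_weak_deriv_iff)

lemma is_weak_deriv_add: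
  assumes "u \<in> L2 \<Omega>" "v \<in> L2 \<Omega>" "g \<in> L2 \<Omega>" "h \<in> L2 \<Omega>" "is_weak_deriv \<Omega> is u g" "is_weak_deriv \<Omega> is v h"
  shows "is_weak_deriv \<Omega> is (u + v) (g + h)"
  using assms by (simp add: is_weak_deriv_iff L2.add_left TF_L2 TF_iter_pd distrib_left)

lemma is_weak_deriv_scale:
  assumes "u \<in> L2 \<Omega>" "g \<in> L2 \<Omega>" "is_weak_deriv \<Omega> is u g"
  shows "is_weak_deriv \<Omega> is (c *\<^sub>R u) (c *\<^sub>R g)"
  using assms by (simp add: is_weak_deriv_iff L2.scale_left TF_L2 TF_iter_pd)

text \<open>Both sides of the defining identity are L2 products with a fixed function, hence
  continuous. This closedness of weak differentiation carries completeness from L2 to the Sobolev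
  space.\<close>

lemma is_weak_deriv_limit:
  assumes u: "u \<in> L2 \<Omega>" "\<And>k. v k \<in> L2 \<Omega>" "(\<lambda>k. nrm2 (v k - u)) \<longlonglongrightarrow> 0"
    and g: "g \<in> L2 \<Omega>" "\<And>k. h k \<in> L2 \<Omega>" "(\<lambda>k. nrm2 (h k - g)) \<longlonglongrightarrow> 0"
    and wd: "\<And>k. is_weak_deriv \<Omega> is (v k) (h k)"
  shows "is_weak_deriv \<Omega> is u g"
proof -
  have lim: "(\<lambda>k. ip (w k) y) \<longlonglongrightarrow> ip x y"
    if "x \<in> L2 \<Omega>" "\<And>k. w k \<in> L2 \<Omega>" "(\<lambda>k. nrm2 (w k - x)) \<longlonglongrightarrow> 0" "y \<in> L2 \<Omega>" for w x y
  proof -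
    have "(\<lambda>k. ip (w k) y - ip x y) \<longlonglongrightarrow> 0"
    proof (rule Lim_null_comparison)
      show "\<forall>\<^sub>F k in sequentially. norm (ip (w k) y - ip x y) \<le> nrm2 (w k - x) * nrm2 y"
        using L2.Cauchy_Schwarz[of "w _ - x" y] that by (simp add: L2.diff_left)
      show "(\<lambda>k. nrm2 (w k - x) * nrm2 y) \<longlonglongrightarrow> 0" using tendsto_mult_right[OF that(3), of "nrm2 y"] by simp
    qed
    then show ?thesis by (simp add: LIM_zero_iff)
  qed
  show ?thesis
    unfolding is_weak_deriv_iff[OF u(1) g(1)]
  proof
    fix f assume f: "f \<in> TF"
    have "(\<lambda>k. ip (v k) (abs_lfun (iter_pd is f))) \<longlonglongrightarrow> ip u (abs_lfun (iter_pd is f))"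
      by (rule lim[OF u TF_L2[OF TF_iter_pd[OF f]]])
    moreover have "(\<lambda>k. (-1) ^ length is * ip (h k) (abs_lfun f)) \<longlonglongrightarrow> (-1) ^ length is * ip g (abs_lfun f)"
      by (intro tendsto_mult_left lim[OF g TF_L2[OF f]])
    moreover have "ip (v k) (abs_lfun (iter_pd is f)) = (-1) ^ length is * ip (h k) (abs_lfun f)" for k
      using wd[of k] f is_weak_deriv_iff[OF u(2) g(2)] by blast
    ultimately show "ip u (abs_lfun (iter_pd is f)) = (-1) ^ length is * ip g (abs_lfun f)"
      by (simp add: LIMSEQ_unique)
  qed
qed

section \<open>Sobolev spaces of integer order\<close>

abbreviation "W m \<equiv> Sobolev \<Omega> (real m)"

lemma W_iff: "u \<in> W m \<longleftrightarrow> u \<in> L2 \<Omega> \<and> (\<forall>is. length is \<le> m \<longrightarrow> (\<exists>g\<in>L2 \<Omega>. is_weak_deriv \<Omega> is u g))"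
  by (simp add: Sobolev_def)

lemma weak_deriv_W:
  assumes "u \<in> W m" "length is \<le> m"
  shows "D is u \<in> L2 \<Omega>" "is_weak_deriv \<Omega> is u (D is u)"
  using assms weak_deriv_eqI unfolding W_iff by metis+

lemma weak_deriv_add:
  assumes "u \<in> W m" "v \<in> W m" "length is \<le> m"
  shows "D is (u + v) = D is u + D is v"
  using assms weak_deriv_W by (intro weak_deriv_eqI is_weak_deriv_add) (auto simp: W_iff)

lemma weak_deriv_scale:
  assumes "u \<in> W m" "length is \<le> m"
  shows "D is (c *\<^sub>R u) = c *\<^sub>R D is u"
  using assms weak_deriv_W by (intro weak_deriv_eqI is_weak_deriv_scale) (auto simp: W_iff)

lemma W_subspace: "subspace (W m)"
  unfolding subspace_def
proof (intro conjI ballI allI)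
  have "is_weak_deriv \<Omega> is 0 0" for "is"
    using is_weak_deriv_iff[OF L2.zero_mem L2.zero_mem] L2.scale_left[of 0 _ 0] by (simp add: TF_L2 TF_iter_pd)
  then show "0 \<in> W m" unfolding W_iff using L2.zero_mem by blast
  fix u v and c :: real assume uv: "u \<in> W m" "v \<in> W m"
  show "u + v \<in> W m"
    unfolding W_iff
  proof (intro conjI allI impI)
    show "u + v \<in> L2 \<Omega>" using uv by (simp add: W_iff)
    fix "is" :: "'n list" assume "length is \<le> m"
    then show "\<exists>g\<in>L2 \<Omega>. is_weak_deriv \<Omega> is (u + v) g"
      using uv weak_deriv_W[OF uv(1)] weak_deriv_W[OF uv(2)]
      by (intro bexI[of _ "D is u + D is v"] is_weak_deriv_add) (auto simp: W_iff)
  qed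
  show "c *\<^sub>R u \<in> W m"
    unfolding W_iff
  proof (intro conjI allI impI)
    show "c *\<^sub>R u \<in> L2 \<Omega>" using uv by (simp add: W_iff)
    fix "is" :: "'n list" assume "length is \<le> m"
    then show "\<exists>g\<in>L2 \<Omega>. is_weak_deriv \<Omega> is (c *\<^sub>R u) g"
      using uv weak_deriv_W[OF uv(1)]
      by (intro bexI[of _ "c *\<^sub>R D is u"] is_weak_deriv_scale) (auto simp: W_iff)
  qed
qed

lemma sum_weak_deriv_ip:
  assumes "\<And>is. is \<in> S \<Longrightarrow> length is \<le> m"
  shows "semi_ip_space (W m) (\<lambda>u v. \<Sum>is\<in>S. ip (D is u) (D is v))"
proof
  show "subspace (W m)" by (rule W_subspace)
  show "semi_ip_on (W m) (\<lambda>u v. \<Sum>is\<in>S. ip (D is u) (D is v))"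
    unfolding semi_ip_on_def lin_on_def
    using assms
    by (auto simp: weak_deriv_add weak_deriv_scale weak_deriv_W L2.bilinear sum.distrib sum_distrib_left
        intro!: sum_nonneg sum.cong L2.nonneg L2.sym)
qed

lemma finite_multiindices: "finite {is :: 'n list. length is \<le> m}" "finite {is :: 'n list. length is = m}"
  using finite_lists_length_le[of "UNIV :: 'n set" m] finite_lists_length_eq[of "UNIV :: 'n set" m] by simp_all

definition sob_ip :: "nat \<Rightarrow> 'n lfun \<Rightarrow> 'n lfun \<Rightarrow> real" where
  "sob_ip m u v = (\<Sum>is | length is \<le> m. ip (D is u) (D is v))"

lemma sobolev_norm_eq: "sobolev_norm \<Omega> (real m) u = ip_norm (sob_ip m) u"
  by (simp add: sobolev_norm_def sob_ip_def ip_norm_def)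

lemma sob_ip_space: "semi_ip_space (W m) (sob_ip m)"
  using sum_weak_deriv_ip[of "{is. length is \<le> m}" m] unfolding sob_ip_def[abs_def] by simp

lemma energy_ip_space: "semi_ip_space (W m) (E m)"
  using sum_weak_deriv_ip[of "{is. length is = m}" m] unfolding energy_ip_def[abs_def] by simp

lemma weak_deriv_le_sob:
  assumes "u \<in> W m" "length is \<le> m"
  shows "nrm2 (D is u) \<le> ip_norm (sob_ip m) u"
proof -
  have "ip (D is u) (D is u) \<le> sob_ip m u u"
    unfolding sob_ip_def using assms finite_multiindices(1)[of m] weak_deriv_W[OF assms(1)]
    by (intro member_le_sum) (auto intro: L2.nonneg)
  then show ?thesis by (simp add: ip_norm_def)
qed

lemma energy_le_sob:
  assumes "u \<in> W m"
  shows "ip_norm (E m) u \<le> ip_norm (sob_ip m) u"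
proof -
  have "E m u u \<le> sob_ip m u u"
    unfolding sob_ip_def energy_ip_def using finite_multiindices weak_deriv_W[OF assms]
    by (intro sum_mono2) (auto intro: L2.nonneg)
  then show ?thesis by (simp add: ip_norm_def)
qed

section \<open>The Friedrichs inequality\<close>

text \<open>Integrating the partial derivative of \<open>x\<^sub>i f(x)\<^sup>2\<close> gives \<open>\<integral> f\<^sup>2 = - 2 \<integral> x\<^sub>i f \<partial>\<^sub>i f\<close>.\<close>

lemma Friedrichs_step:
  assumes R: "\<Omega> \<subseteq> cball 0 R" and f: "f \<in> TF"
  shows "(\<integral>x. (f x)\<^sup>2 \<partial>lborel) \<le> 4 * R\<^sup>2 * (\<integral>x. (pd i f x)\<^sup>2 \<partial>lborel)"
proof -
  let ?F = "\<lambda>x. x $ i * (f x * f x)"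
  have sm: "f differentiable (at x)" for x using f by (simp add: TF_smooth smooth_differentiable)
  have coord: "((\<lambda>x::real^'n. x $ i) has_derivative (\<lambda>y. y $ i)) (at x)" for x
    by (intro bounded_linear_imp_has_derivative bounded_linear_vec_nth)
  then have cd: "(\<lambda>x::real^'n. x $ i) differentiable (at x)" for x unfolding differentiable_def by blast
  have pdc: "pd i (\<lambda>x::real^'n. x $ i) x = 1" for x
    by (subst pd_eqI[OF coord]) simp
  have pdF: "pd i ?F = (\<lambda>x. 2 * (x $ i * f x * pd i f x) + (f x)\<^sup>2)"
    using sm cd by (simp add: fun_eq_iff pd_mult pdc power2_eq_square algebra_simps)
  have cf: "continuous_on UNIV f" "continuous_on UNIV (pd i f)"
    using f by (simp_all add: TF_smooth TF_pd smooth_continuous)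
  have cx: "continuous_on UNIV (\<lambda>x::real^'n. x $ i)" by (intro continuous_intros)
  have bd: "bounded {x. f x \<noteq> 0}" "bounded {x. pd i f x \<noteq> 0}" using f by (simp_all add: TF_bounded TF_pd)
  have int1: "integrable lborel (\<lambda>x. x $ i * f x * pd i f x)"
    by (rule integrable_compact_support) (auto intro!: continuous_intros cf cx intro: bounded_subset[OF bd(1)])
  have int2: "integrable lborel (\<lambda>x. (f x)\<^sup>2)"
    by (rule integrable_compact_support) (auto intro!: continuous_intros cf cx intro: bounded_subset[OF bd(1)])
  have int3: "integrable lborel (\<lambda>x. (pd i f x)\<^sup>2)"
    by (rule integrable_compact_support) (auto intro!: continuous_intros cf cx intro: bounded_subset[OF bd(2)])
  have "(\<integral>x. pd i ?F x \<partial>lborel) = 0"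
  proof (rule integral_pd_eq_0)
    show "?F differentiable at x" for x using sm cd by (intro differentiable_mult)
    show "continuous_on UNIV (pd i ?F)" unfolding pdF by (intro continuous_intros cf cx)
    show "bounded {x. ?F x \<noteq> 0}" by (rule bounded_subset[OF bd(1)]) auto
  qed
  then have eq: "(\<integral>x. (f x)\<^sup>2 \<partial>lborel) = (\<integral>x. - 2 * (x $ i * f x * pd i f x) \<partial>lborel)"
    unfolding pdF using int1 int2 by simp
  also have "\<dots> \<le> (\<integral>x. (1/2) * (f x)\<^sup>2 + 2 * R\<^sup>2 * (pd i f x)\<^sup>2 \<partial>lborel)"
  proof (rule integral_mono)
    show "integrable lborel (\<lambda>x. - 2 * (x $ i * f x * pd i f x))" using int1 by (intro integrable_mult_right)
    show "integrable lborel (\<lambda>x. (1/2) * (f x)\<^sup>2 + 2 * R\<^sup>2 * (pd i f x)\<^sup>2)"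
      using int2 int3 by (intro Bochner_Integration.integrable_add integrable_mult_right)
    show "- 2 * (x $ i * f x * pd i f x) \<le> (1/2) * (f x)\<^sup>2 + 2 * R\<^sup>2 * (pd i f x)\<^sup>2" for x
    proof (cases "x \<in> \<Omega>")
      case True
      have xR: "\<bar>x $ i\<bar> \<le> R" using component_le_norm_cart[of x i] True R by force
      then have "(x $ i)\<^sup>2 \<le> R\<^sup>2" using power_mono[of "\<bar>x $ i\<bar>" R 2] by simp
      then have "2 * (x $ i)\<^sup>2 * (pd i f x)\<^sup>2 \<le> 2 * R\<^sup>2 * (pd i f x)\<^sup>2" by (intro mult_right_mono) auto
      \<comment> \<open>Weights chosen so that half of the integral of \<open>f\<close> squared can
        be absorbed on the left; this produces the constant \<open>4 * R\<^sup>2\<close>.\<close>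
      moreover have "0 \<le> (f x + 2 * (x $ i * pd i f x))\<^sup>2" by simp
      then have "- 2 * (x $ i * f x * pd i f x) \<le> (1/2) * (f x)\<^sup>2 + 2 * (x $ i)\<^sup>2 * (pd i f x)\<^sup>2"
        by (simp add: power2_eq_square algebra_simps)
      ultimately show ?thesis by linarith
    qed (use TF_outside[OF f] in simp)
  qed
  also have "\<dots> = (1/2) * (\<integral>x. (f x)\<^sup>2 \<partial>lborel) + 2 * R\<^sup>2 * (\<integral>x. (pd i f x)\<^sup>2 \<partial>lborel)"
    using int2 int3 by simp
  finally show ?thesis by simp
qed

lemma Friedrichs_iter:
  assumes R: "\<Omega> \<subseteq> cball 0 R" and f: "f \<in> TF"
  shows "ip (abs_lfun f) (abs_lfun f)
    \<le> (4 * R\<^sup>2) ^ k * ip (abs_lfun (iter_pd (replicate k i) f)) (abs_lfun (iter_pd (replicate k i) f))"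
proof (induction k)
  case (Suc k)
  let ?g = "iter_pd (replicate k i) f"
  have "ip (abs_lfun ?g) (abs_lfun ?g) \<le> 4 * R\<^sup>2 * ip (abs_lfun (pd i ?g)) (abs_lfun (pd i ?g))"
    using Friedrichs_step[OF R TF_iter_pd[OF f], of "replicate k i" i]
    by (simp add: ip_L2_TF2 TF_iter_pd f TF_pd flip: power2_eq_square)
  then have "(4 * R\<^sup>2) ^ k * ip (abs_lfun ?g) (abs_lfun ?g)
      \<le> (4 * R\<^sup>2) ^ k * (4 * R\<^sup>2 * ip (abs_lfun (pd i ?g)) (abs_lfun (pd i ?g)))"
    by (intro mult_left_mono) auto
  with Suc have "ip (abs_lfun f) (abs_lfun f)
      \<le> (4 * R\<^sup>2) ^ k * (4 * R\<^sup>2 * ip (abs_lfun (pd i ?g)) (abs_lfun (pd i ?g)))"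
    by (rule order_trans)
  then show ?case by (simp only: replicate_Suc iter_pd_Cons power_Suc mult_ac)
qed simp

lemma iter_pd_append: "iter_pd (is @ js) f = iter_pd is (iter_pd js f)"
  by (induction "is") (simp_all add: iter_pd_Cons del: iter_pd.simps(2))

text \<open>A derivative of order below \<open>m\<close> is compared with one of order exactly
  \<open>m\<close>, obtained by appending copies of one direction to its list. Weak derivatives of
  test functions are classical ones for the reversed list, so the appended directions are
  differentiated last, where \<open>Friedrichs_iter\<close> applies.\<close>

lemma Friedrichs_TF:
  "\<exists>C>0. \<forall>f\<in>TF. ip_norm (sob_ip m) (abs_lfun f) \<le> C * ip_norm (E m) (abs_lfun f)"
proof -
  obtain R where R: "\<Omega> \<subseteq> cball 0 R"
    using bounded_subset_ballD[OF bounded_\<Omega>, of 0] ball_subset_cball by (meson order_trans)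
  \<comment> \<open>The summand 1 makes \<open>B\<close> at least 1, so that \<open>B ^ m\<close>
    dominates all lower powers, whatever the size of \<open>R\<close>.\<close>
  define B where "B = 4 * R\<^sup>2 + 1"
  define N where "N = real (card {is :: 'n list. length is \<le> m}) + 1"
  have B: "1 \<le> B" "4 * R\<^sup>2 \<le> B" by (simp_all add: B_def)
  have "sob_ip m (abs_lfun f) (abs_lfun f) \<le> N * B ^ m * E m (abs_lfun f) (abs_lfun f)"
    if f: "f \<in> TF" for f
  proof -
    let ?E = "E m (abs_lfun f) (abs_lfun f)"
    have nn: "0 \<le> ip (abs_lfun (iter_pd is f)) (abs_lfun (iter_pd is f))" for "is"
      by (intro L2.nonneg TF_L2 TF_iter_pd f)
    have E0: "0 \<le> ?E"
      unfolding energy_ip_def weak_deriv_TF[OF f] using nn by (intro sum_nonneg)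
    have "ip (D is (abs_lfun f)) (D is (abs_lfun f)) \<le> B ^ m * ?E"
      if len: "length is \<le> m" for "is"
    proof -
      \<comment> \<open>Any direction will do for the padding.\<close>
      fix i :: 'n
      let ?k = "m - length is"
      let ?js = "is @ replicate ?k i"
      have js: "length ?js = m" using len by simp
      have rev: "rev ?js = replicate ?k i @ rev is" by simp
      have "ip (D is (abs_lfun f)) (D is (abs_lfun f))
          \<le> (4 * R\<^sup>2) ^ ?k * ip (D ?js (abs_lfun f)) (D ?js (abs_lfun f))"
        unfolding weak_deriv_TF[OF f] rev iter_pd_append by (rule Friedrichs_iter[OF R TF_iter_pd[OF f]])
      also have "\<dots> \<le> B ^ m * ?E"
      proof (rule mult_mono)
        have "(4 * R\<^sup>2) ^ ?k \<le> B ^ ?k" using B by (intro power_mono) auto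
        also have "\<dots> \<le> B ^ m" using B by (intro power_increasing) auto
        finally show "(4 * R\<^sup>2) ^ ?k \<le> B ^ m" .
        show "ip (D ?js (abs_lfun f)) (D ?js (abs_lfun f)) \<le> ?E"
          unfolding energy_ip_def using js nn finite_multiindices(2)[of m]
          by (intro member_le_sum[of ?js _ "\<lambda>js. ip (D js (abs_lfun f)) (D js (abs_lfun f))"])
            (auto simp: weak_deriv_TF[OF f])
      qed (use B nn in \<open>simp_all add: weak_deriv_TF[OF f]\<close>)
      finally show ?thesis .
    qed
    then have "sob_ip m (abs_lfun f) (abs_lfun f) \<le> (\<Sum>is::'n list | length is \<le> m. B ^ m * ?E)"
      unfolding sob_ip_def by (intro sum_mono) auto
    also have "\<dots> \<le> N * (B ^ m * ?E)" using E0 B by (simp add: N_def distrib_right)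
    finally show ?thesis by (simp add: mult.assoc)
  qed
  then have "ip_norm (sob_ip m) (abs_lfun f) \<le> sqrt (N * B ^ m) * ip_norm (E m) (abs_lfun f)"
    if "f \<in> TF" for f
    using that by (simp add: ip_norm_def flip: real_sqrt_mult)
  moreover have "0 < sqrt (N * B ^ m)" using B by (simp add: N_def)
  ultimately show ?thesis by blast
qed

section \<open>The Hilbert space \<open>H\<^sup>m\<^sub>0(\<Omega>)\<close>\<close>

abbreviation "V m \<equiv> Sobolev0 \<Omega> (real m)"

lemma TF_W: "f \<in> TF \<Longrightarrow> abs_lfun f \<in> W m"
  unfolding W_iff using TF_L2 TF_iter_pd TF_weak_deriv by blast

lemma V_iff: "u \<in> V m \<longleftrightarrow> u \<in> W m \<and> (\<forall>\<epsilon>>0. \<exists>f\<in>TF. ip_norm (sob_ip m) (u - abs_lfun f) < \<epsilon>)"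
  by (simp add: Sobolev0_def sobolev_norm_eq)

lemma V_subspace: "subspace (V m)"
  unfolding subspace_def
proof (intro conjI ballI allI)
  interpret S: semi_ip_space "W m" "sob_ip m" by (rule sob_ip_space)
  have "abs_lfun (\<lambda>x. 0) = (0 :: 'n lfun)" by (simp add: zero_lfun_def)
  then have "\<exists>f\<in>TF. ip_norm (sob_ip m) (0 - abs_lfun f) < \<epsilon>" if "\<epsilon> > 0" for \<epsilon>
    using that by (intro bexI[OF _ TF_zero]) simp
  then show "0 \<in> V m" unfolding V_iff using S.zero_mem by blast
  fix u v and c :: real assume u: "u \<in> V m" and v: "v \<in> V m"
  show "u + v \<in> V m"
    unfolding V_iff
  proof (intro conjI allI impI)
    show "u + v \<in> W m" using u v by (simp add: V_iff)
    fix \<epsilon> :: real assume "0 < \<epsilon>"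
    then have e2: "0 < \<epsilon> / 2" by simp
    obtain f where f: "f \<in> TF" "S.nm (u - abs_lfun f) < \<epsilon> / 2" using u e2 unfolding V_iff by blast
    obtain g where g: "g \<in> TF" "S.nm (v - abs_lfun g) < \<epsilon> / 2" using v e2 unfolding V_iff by blast
    have "u + v - abs_lfun (\<lambda>x. f x + g x) = (u - abs_lfun f) + (v - abs_lfun g)"
      using abs_lfun_add[OF TF_measurable[OF f(1)] TF_measurable[OF g(1)]] by (simp only:) simp
    moreover have "u - abs_lfun f \<in> W m" "v - abs_lfun g \<in> W m" using u v f(1) g(1) by (simp_all add: V_iff TF_W)
    ultimately have "S.nm (u + v - abs_lfun (\<lambda>x. f x + g x)) \<le> S.nm (u - abs_lfun f) + S.nm (v - abs_lfun g)"
      by (simp only: S.nm_triangle)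
    then show "\<exists>f\<in>TF. S.nm (u + v - abs_lfun f) < \<epsilon>"
      using f g by (intro bexI[OF _ TF_add[OF f(1) g(1)]]) simp
  qed
  show "c *\<^sub>R u \<in> V m"
    unfolding V_iff
  proof (intro conjI allI impI)
    show "c *\<^sub>R u \<in> W m" using u by (simp add: V_iff)
    fix \<epsilon> :: real assume \<epsilon>: "0 < \<epsilon>"
    then obtain f where f: "f \<in> TF" "S.nm (u - abs_lfun f) < \<epsilon> / (\<bar>c\<bar> + 1)"
      using u unfolding V_iff by (metis abs_ge_zero add_nonneg_pos divide_pos_pos zero_less_one)
    have uf: "u - abs_lfun f \<in> W m" using u f by (simp add: V_iff TF_W)
    have "c *\<^sub>R u - abs_lfun (\<lambda>x. c * f x) = c *\<^sub>R (u - abs_lfun f)"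
      using f by (simp add: abs_lfun_scale TF_measurable scaleR_diff_right)
    then have "S.nm (c *\<^sub>R u - abs_lfun (\<lambda>x. c * f x)) = \<bar>c\<bar> * S.nm (u - abs_lfun f)"
      using S.nm_scale[OF uf] by simp
    also have "\<dots> \<le> (\<bar>c\<bar> + 1) * S.nm (u - abs_lfun f)"
      using S.nm_nonneg[OF uf] by (intro mult_right_mono) auto
    also have "\<dots> < \<epsilon>" using f(2) by (simp add: pos_less_divide_eq mult.commute)
    finally show "\<exists>f\<in>TF. S.nm (c *\<^sub>R u - abs_lfun f) < \<epsilon>"
      by (intro bexI[OF _ TF_scale[OF f(1)]])
  qed
qed

text \<open>Density: both seminorms of \<open>u - abs_lfun f\<close> are at most its Sobolev norm,
  so the inequality passes from test functions to their closure.\<close>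

lemma Friedrichs: "\<exists>C>0. \<forall>u\<in>V m. ip_norm (sob_ip m) u \<le> C * ip_norm (E m) u"
proof -
  interpret S: semi_ip_space "W m" "sob_ip m" by (rule sob_ip_space)
  interpret E: semi_ip_space "W m" "energy_ip \<Omega> m" by (rule energy_ip_space)
  obtain C where C: "C > 0" "\<And>f. f \<in> TF \<Longrightarrow> S.nm (abs_lfun f) \<le> C * E.nm (abs_lfun f)"
    using Friedrichs_TF by blast
  have "S.nm u \<le> C * E.nm u" if u: "u \<in> V m" for u
  proof (rule field_le_epsilon)
    fix e :: real assume e: "0 < e"
    \<comment> \<open>The approximation error enters once directly and \<open>C\<close> times
      through the energy norm of the test function.\<close>
    then have "0 < e / (C + 1)" using C(1) by simp
    then obtain f where f: "f \<in> TF" "S.nm (u - abs_lfun f) < e / (C + 1)" using u unfolding V_iff by blast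
    have uW: "u \<in> W m" and fW: "abs_lfun f \<in> W m" using u f by (simp_all add: V_iff TF_W)
    have "S.nm u \<le> S.nm (u - abs_lfun f) + S.nm (abs_lfun f)"
      using S.nm_triangle[of "u - abs_lfun f" "abs_lfun f"] uW fW by simp
    moreover have "E.nm (abs_lfun f) \<le> E.nm u + E.nm (u - abs_lfun f)"
      using E.nm_triangle_diff[of u "u - abs_lfun f"] uW fW by simp
    moreover have "E.nm (u - abs_lfun f) \<le> S.nm (u - abs_lfun f)" using uW fW by (intro energy_le_sob) simp
    ultimately have "E.nm (abs_lfun f) \<le> E.nm u + S.nm (u - abs_lfun f)" by linarith
    then have "C * E.nm (abs_lfun f) \<le> C * (E.nm u + S.nm (u - abs_lfun f))" using C(1) by simp
    then have "S.nm u \<le> C * E.nm u + (C + 1) * S.nm (u - abs_lfun f)"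
      using C(2)[OF f(1)] \<open>S.nm u \<le> _\<close> by (simp add: algebra_simps)
    moreover have "(C + 1) * S.nm (u - abs_lfun f) \<le> e"
      using f(2) C(1) by (simp add: pos_less_divide_eq mult.commute less_imp_le)
    ultimately show "S.nm u \<le> C * E.nm u + e" by linarith
  qed
  then show ?thesis using C(1) by blast
qed

text \<open>Definiteness is the Friedrichs inequality: zero energy forces zero Sobolev norm, whose
  summand for the empty list is the L2 norm.\<close>

lemma V_ip_space: "ip_space (V m) (E m)"
proof
  show "subspace (V m)" by (rule V_subspace)
  interpret E: semi_ip_space "W m" "energy_ip \<Omega> m" by (rule energy_ip_space)
  show "semi_ip_on (V m) (E m)" by (rule semi_ip_on_subset[OF E.semi]) (auto simp: V_iff)
  fix u assume u: "u \<in> V m" "E m u u = 0"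
  then have uW: "u \<in> W m" and uL2: "u \<in> L2 \<Omega>" by (simp_all add: V_iff W_iff)
  obtain C where "ip_norm (sob_ip m) u \<le> C * ip_norm (E m) u" using Friedrichs u by blast
  then have "nrm2 (D [] u) \<le> 0"
    using weak_deriv_le_sob[OF uW, of "[]"] u by (simp add: ip_norm_def[of "energy_ip \<Omega> m"])
  then show "u = 0" using L2.nm_nonneg[OF uL2] L2.nm_eq_0[OF uL2] by (simp add: weak_deriv_Nil uL2)
qed

text \<open>By Friedrichs, a Cauchy sequence in energy has L2-Cauchy derivatives of all orders up to
  \<open>m\<close>. Their limits are the weak derivatives of the limit function, so convergence
  holds in the full Sobolev norm, under which the closure of the test functions is closed.\<close>

lemma V_complete: "complete_on (V m) (ip_norm (E m))"
  unfolding complete_on_def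
proof (intro allI impI, elim conjE)
  interpret S: semi_ip_space "W m" "sob_ip m" by (rule sob_ip_space)
  interpret E: semi_ip_space "W m" "energy_ip \<Omega> m" by (rule energy_ip_space)
  interpret V: ip_space "V m" "energy_ip \<Omega> m" by (rule V_ip_space)
  fix u :: "nat \<Rightarrow> 'n lfun"
  assume uV': "\<forall>k. u k \<in> V m" and cau: "\<forall>\<epsilon>>0. \<exists>K. \<forall>j\<ge>K. \<forall>k\<ge>K. E.nm (u j - u k) < \<epsilon>"
  have uV: "u k \<in> V m" for k using uV' by blast
  have uW: "u k \<in> W m" for k using uV by (simp add: V_iff)
  obtain C where C: "C > 0" "\<And>v. v \<in> V m \<Longrightarrow> S.nm v \<le> C * E.nm v" using Friedrichs by blast
  have lim_ex: "\<exists>g\<in>L2 \<Omega>. (\<lambda>k. nrm2 (D is (u k) - g)) \<longlonglongrightarrow> 0" if len: "length is \<le> m" for "is"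
  proof -
    have wd: "D is (u j) - D is (u k) = D is (u j - u k)" for j k
    proof -
      have "D is (u j + (-1) *\<^sub>R u k) = D is (u j) + (-1) *\<^sub>R D is (u k)"
        using weak_deriv_add[OF uW[of j] S.scale_mem[OF uW[of k]] len] weak_deriv_scale[OF uW[of k] len]
        by (simp only:)
      then show ?thesis by simp
    qed
    have "\<exists>K. \<forall>j\<ge>K. \<forall>k\<ge>K. nrm2 (D is (u j) - D is (u k)) < \<epsilon>" if \<epsilon>: "\<epsilon> > 0" for \<epsilon>
    proof -
      have "0 < \<epsilon> / C" using \<epsilon> C(1) by simp
      then obtain K where K: "\<And>j k. j \<ge> K \<Longrightarrow> k \<ge> K \<Longrightarrow> E.nm (u j - u k) < \<epsilon> / C" using cau by blast
      have "nrm2 (D is (u j) - D is (u k)) < \<epsilon>" if jk: "j \<ge> K" "k \<ge> K" for j k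
      proof -
        have "nrm2 (D is (u j - u k)) \<le> S.nm (u j - u k)"
          using uW len by (intro weak_deriv_le_sob) simp_all
        also have "\<dots> \<le> C * E.nm (u j - u k)" using uV by (intro C(2)) simp
        also have "\<dots> < \<epsilon>" using K[OF jk] C(1) by (simp add: pos_less_divide_eq mult.commute)
        finally show ?thesis unfolding wd .
      qed
      then show ?thesis by blast
    qed
    moreover have "D is (u k) \<in> L2 \<Omega>" for k using weak_deriv_W(1)[OF uW len] .
    ultimately show ?thesis
      by (intro L2_complete[unfolded complete_on_def, rule_format, of "\<lambda>k. D is (u k)"] conjI allI impI)
  qed
  have "\<forall>is. \<exists>g. length is \<le> m \<longrightarrow> g \<in> L2 \<Omega> \<and> (\<lambda>k. nrm2 (D is (u k) - g)) \<longlonglongrightarrow> 0"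
    using lim_ex by blast
  from choice[OF this] obtain g where g: "\<And>is. length is \<le> m \<Longrightarrow> g is \<in> L2 \<Omega>"
      "\<And>is. length is \<le> m \<Longrightarrow> (\<lambda>k. nrm2 (D is (u k) - g is)) \<longlonglongrightarrow> 0" by blast
  define v where "v = g []"
  have vL2: "v \<in> L2 \<Omega>" unfolding v_def by (rule g) simp
  have uL2: "u k \<in> L2 \<Omega>" for k using uW by (simp add: W_iff)
  have vlim: "(\<lambda>k. nrm2 (u k - v)) \<longlonglongrightarrow> 0" using g(2)[of "[]"] by (simp add: v_def weak_deriv_Nil uL2)
  have wd: "is_weak_deriv \<Omega> is v (g is)" if "length is \<le> m" for "is"
    by (rule is_weak_deriv_limit[OF vL2 uL2 vlim g(1)[OF that] weak_deriv_W(1)[OF uW that] g(2)[OF that]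
          weak_deriv_W(2)[OF uW that]])
  have vW: "v \<in> W m" unfolding W_iff using vL2 wd g(1) by blast
  have Dv: "D is v = g is" if "length is \<le> m" for "is"
    using weak_deriv_eqI[OF vL2 g(1) wd] that by blast
  have Slim: "(\<lambda>k. S.nm (u k - v)) \<longlonglongrightarrow> 0"
  proof -
    have eq: "sob_ip m (u k - v) (u k - v) = (\<Sum>is | length is \<le> m. (nrm2 (D is (u k) - g is))\<^sup>2)" for k
      unfolding sob_ip_def
    proof (rule sum.cong[OF refl])
      fix "is" :: "'n list" assume "is \<in> {is. length is \<le> m}"
      then have len: "length is \<le> m" by simp
      have "D is (u k + (-1) *\<^sub>R v) = D is (u k) + (-1) *\<^sub>R D is v"
        using weak_deriv_add[OF uW[of k] S.scale_mem[OF vW] len] weak_deriv_scale[OF vW len] by (simp only:)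
      then have "D is (u k - v) = D is (u k) - g is" by (simp add: Dv[OF len])
      then show "ip (D is (u k - v)) (D is (u k - v))
          = (nrm2 (D is (u k) - g is))\<^sup>2"
        using weak_deriv_W(1)[OF uW len] g(1)[OF len] by (simp add: L2.nm_sq)
    qed
    have "(\<lambda>k. \<Sum>is | length is \<le> m. (nrm2 (D is (u k) - g is))\<^sup>2) \<longlonglongrightarrow> (\<Sum>is::'n list | length is \<le> m. 0\<^sup>2)"
      by (intro tendsto_sum tendsto_power g(2)) simp
    then have "(\<lambda>k. sqrt (sob_ip m (u k - v) (u k - v))) \<longlonglongrightarrow> sqrt 0"
      unfolding eq by (intro tendsto_real_sqrt) simp
    then show ?thesis by (simp add: ip_norm_def)
  qed
  have "v \<in> V m"
    unfolding V_iff
  proof (intro conjI vW allI impI)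
    fix \<epsilon> :: real assume "0 < \<epsilon>"
    then have e2: "0 < \<epsilon> / 2" by simp
    then obtain k where k: "S.nm (u k - v) < \<epsilon> / 2"
      using order_tendstoD(2)[OF Slim e2] eventually_happens'[OF sequentially_bot] by blast
    obtain f where f: "f \<in> TF" "S.nm (u k - abs_lfun f) < \<epsilon> / 2" using uV e2 unfolding V_iff by blast
    have "S.nm (v - abs_lfun f) \<le> S.nm (u k - abs_lfun f) + S.nm (u k - v)"
      using S.nm_triangle_diff[of "u k - abs_lfun f" "u k - v"] uW vW TF_W[OF f(1)] by simp
    then show "\<exists>f\<in>TF. S.nm (v - abs_lfun f) < \<epsilon>" using f k by (intro bexI[OF _ f(1)]) linarith
  qed
  moreover have "(\<lambda>k. E.nm (u k - v)) \<longlonglongrightarrow> 0"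
  proof (rule Lim_null_comparison[OF _ Slim])
    have "E.nm (u k - v) \<le> S.nm (u k - v)" for k using uW vW by (intro energy_le_sob) simp
    then show "\<forall>\<^sub>F k in sequentially. norm (E.nm (u k - v)) \<le> S.nm (u k - v)" using uW vW by simp
  qed
  ultimately show "\<exists>x\<in>V m. (\<lambda>k. E.nm (u k - x)) \<longlonglongrightarrow> 0" by blast
qed

end

section \<open>Application to the Sobolev setting\<close>

theorem theorem3p4:
  fixes \<Omega> :: "(real^'n) set" and m :: nat and s :: real
    and \<T> :: "(real^'n) set set"
    and V V\<^sub>n\<^sub>c V\<^sub>p\<^sub>w H :: "'n lfun set"
    and a a\<^sub>p\<^sub>w :: "'n lfun \<Rightarrow> 'n lfun \<Rightarrow> real"
    and nrm pw norm_s :: "'n lfun \<Rightarrow> real"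
    and norm_ds :: "('n lfun \<Rightarrow> real) \<Rightarrow> real"
    and F :: "'n lfun \<Rightarrow> real"
    and G G\<^sub>p\<^sub>w DG\<^sub>p\<^sub>w DN DN\<^sub>h :: "'n lfun \<Rightarrow> 'n lfun \<Rightarrow> real"
    and I J :: "'n lfun \<Rightarrow> 'n lfun"
    and \<Lambda>\<^sub>J \<kappa> C1 C2 C3 C\<^sub>T \<beta>\<^sub>h \<beta>\<^sub>0 :: real
    and uh :: "'n lfun"
    and M N2 :: "real^2^2"
  defines "V \<equiv> Sobolev0 \<Omega> (real m)"
    and "a \<equiv> energy_ip \<Omega> m"
    and "nrm \<equiv> ip_norm a"
    and "H \<equiv> Sobolev0 \<Omega> s"
    and "norm_ds \<equiv> sub_dual_norm V H norm_s"
    and "V\<^sub>p\<^sub>w \<equiv> {v + w | v w. v \<in> V \<and> w \<in> V\<^sub>n\<^sub>c}"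
    and "pw \<equiv> ip_norm a\<^sub>p\<^sub>w"
    and "DG\<^sub>p\<^sub>w \<equiv> fderiv V\<^sub>p\<^sub>w pw V nrm G\<^sub>p\<^sub>w uh"
    and "DN \<equiv> fderiv V nrm V nrm (N_op V a G F) uh"
    and "DN\<^sub>h \<equiv> fderiv V\<^sub>p\<^sub>w pw V\<^sub>n\<^sub>c pw (Nh_op V\<^sub>n\<^sub>c a\<^sub>p\<^sub>w G\<^sub>p\<^sub>w F J) uh"
    and "\<beta>\<^sub>h \<equiv> inf_sup V\<^sub>n\<^sub>c pw DN\<^sub>h"
    and "C\<^sub>T \<equiv> \<kappa> * C2 + C3 * op_norm V\<^sub>n\<^sub>c pw nrm J"
    and "N2 \<equiv> vector [vector [1, C\<^sub>T], vector [0, \<beta>\<^sub>h]]"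
    and "M \<equiv> vector [vector [(1 + C\<^sub>T) * C1, C\<^sub>T * C2], vector [\<beta>\<^sub>h * C1, \<beta>\<^sub>h * C2]]"
    and "\<beta>\<^sub>0 \<equiv> (\<beta>\<^sub>h - \<kappa> * spectral_norm M) / spectral_norm N2"
  \<comment> \<open>the continuous problem\<close>
  assumes "CARD('n) \<ge> 2"
    and "bounded_lipschitz_domain \<Omega>"
    and "0 \<le> s" and "s \<le> real m"
    and "hilbert_norm_on H norm_s"
    and "equivalent_norms_on H norm_s (sobolev_norm \<Omega> s)"
    and "C1_map V nrm V nrm G"
    and "maps_bounded_to_relcompact V nrm V nrm G"
    and "F \<in> dual V nrm"
  \<comment> \<open>the discretisation\<close>
    and "triangulation_of \<T> \<Omega>"
    and "V\<^sub>n\<^sub>c \<subseteq> L0 \<Omega>" and "subspace V\<^sub>n\<^sub>c" and "\<exists>B. finite B \<and> V\<^sub>n\<^sub>c = span B" and "V\<^sub>n\<^sub>c \<noteq> {0}"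
    and "semi_ip_on V\<^sub>p\<^sub>w a\<^sub>p\<^sub>w"
    and "\<forall>v\<in>V. \<forall>w\<in>V. a\<^sub>p\<^sub>w v w = a v w"
    and "ip_on V\<^sub>n\<^sub>c a\<^sub>p\<^sub>w"
    and "I ` V \<subseteq> V\<^sub>n\<^sub>c" and "lin_on V I" and "\<exists>C. \<forall>v\<in>V. pw (I v) \<le> C * nrm v"
    and "\<forall>v\<in>V. \<forall>w\<in>V\<^sub>n\<^sub>c. a\<^sub>p\<^sub>w (v - I v) w = 0"
    and "J ` V\<^sub>n\<^sub>c \<subseteq> V" and "lin_on V\<^sub>n\<^sub>c J" and "\<forall>w\<in>V\<^sub>n\<^sub>c. I (J w) = w"
    and "\<Lambda>\<^sub>J > 0" and "\<forall>w\<in>V\<^sub>n\<^sub>c. pw (w - J w) \<le> \<Lambda>\<^sub>J * (INF v\<in>V. pw (v - w))"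
    and "C1_map V\<^sub>p\<^sub>w pw V nrm G\<^sub>p\<^sub>w" and "\<forall>v\<in>V. G v = G\<^sub>p\<^sub>w v"
  \<comment> \<open>the constant \<open>\<kappa>(\<T>,s)\<close>\<close>
    and "\<kappa> > 0"
    and "\<forall>\<Phi> \<in> sub_dual V nrm H norm_s. \<forall>z\<in>V. \<forall>z\<^sub>n\<^sub>c\<in>V\<^sub>n\<^sub>c.
           (\<forall>v\<in>V. a z v = \<Phi> v) \<and> (\<forall>w\<in>V\<^sub>n\<^sub>c. a\<^sub>p\<^sub>w z\<^sub>n\<^sub>c w = \<Phi> (J w)) \<longrightarrow>
           pw (z - z\<^sub>n\<^sub>c) \<le> \<kappa> * norm_ds \<Phi>"
  \<comment> \<open>the linearisation at \<open>uh\<close>; the first two facts say that \<open>DG\<^sub>p\<^sub>w\<close> is bounded with values in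
      the dual of \<open>H\<close>\<close>
    and "uh \<in> V"
    and "\<forall>w\<in>V\<^sub>p\<^sub>w. DG\<^sub>p\<^sub>w w \<in> sub_dual V nrm H norm_s"
    and "\<exists>C. \<forall>w\<in>V\<^sub>p\<^sub>w. norm_ds (DG\<^sub>p\<^sub>w w) \<le> C * pw w"
    and "C1 > 0" and "C2 > 0" and "C3 > 0"
    and "\<forall>w\<in>V\<^sub>n\<^sub>c. norm_ds (DG\<^sub>p\<^sub>w w) \<le> C1 * pw w"
    and "\<forall>v\<in>V. norm_ds (DG\<^sub>p\<^sub>w (v - I v)) \<le> C2 * pw (v - I v)"
    and "\<forall>v\<in>V. dual_norm V nrm (DG\<^sub>p\<^sub>w (v - I v)) \<le> C3 * pw (v - I v)"
    and "\<kappa> * spectral_norm M < \<beta>\<^sub>h"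
  shows "\<beta>\<^sub>0 \<le> inf_sup V nrm DN \<and>
         (s < real m \<longrightarrow> DN \<in> bounded_ops V nrm V nrm \<and> bij_betw DN V (dual V nrm))"
proof -
  interpret \<Omega>: bounded_open_set \<Omega>
    using \<open>bounded_lipschitz_domain \<Omega>\<close> by unfold_locales (simp_all add: bounded_lipschitz_domain_def)
  interpret V: ip_space V a unfolding V_def a_def by (rule \<Omega>.V_ip_space)
  interpret nonconforming V a V\<^sub>n\<^sub>c V\<^sub>p\<^sub>w a\<^sub>p\<^sub>w I J \<Lambda>\<^sub>J
  proof
    show "complete_on V (ip_norm a)" unfolding V_def a_def by (rule \<Omega>.V_complete)
    show "V\<^sub>p\<^sub>w = {v + w | v w. v \<in> V \<and> w \<in> V\<^sub>n\<^sub>c}" by (simp add: V\<^sub>p\<^sub>w_def)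
    show "\<forall>w\<in>V\<^sub>n\<^sub>c. ip_norm a\<^sub>p\<^sub>w (w - J w) \<le> \<Lambda>\<^sub>J * (INF v\<in>V. ip_norm a\<^sub>p\<^sub>w (v - w))"
      using \<open>\<forall>w\<in>V\<^sub>n\<^sub>c. pw (w - J w) \<le> \<Lambda>\<^sub>J * (INF v\<in>V. pw (v - w))\<close> by (simp add: pw_def)
  qed (fact assms)+
  have Gpw: "C1_map V\<^sub>p\<^sub>w (ip_norm a\<^sub>p\<^sub>w) V (ip_norm a) G\<^sub>p\<^sub>w"
    using \<open>C1_map V\<^sub>p\<^sub>w pw V nrm G\<^sub>p\<^sub>w\<close> unfolding pw_def nrm_def .
  have Gpw_dual: "G\<^sub>p\<^sub>w v \<in> dual V (ip_norm a)" if "v \<in> V\<^sub>p\<^sub>w" for v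
    using Gpw that by (simp add: C1_map_def)
  have diff: "has_fderiv V\<^sub>p\<^sub>w (ip_norm a\<^sub>p\<^sub>w) V (ip_norm a) G\<^sub>p\<^sub>w uh DG\<^sub>p\<^sub>w"
    unfolding DG\<^sub>p\<^sub>w_def pw_def nrm_def
    by (rule C1_map_has_fderiv[OF PW.semi_ip_space_axioms V.semi_ip_space_axioms V_pw[OF \<open>uh \<in> V\<close>] Gpw])
  have F: "F \<in> dual V (ip_norm a)" using \<open>F \<in> dual V nrm\<close> by (simp add: nrm_def)
  \<comment> \<open>The defining estimate of \<kappa> is specialised to the functionals
    \<open>DG\<^sub>p\<^sub>w w\<close>, which belong to the smaller dual by assumption.\<close>
  interpret linearised V a V\<^sub>n\<^sub>c V\<^sub>p\<^sub>w a\<^sub>p\<^sub>w I J \<Lambda>\<^sub>J DG\<^sub>p\<^sub>w norm_ds \<kappa> C1 C2 C3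
  proof
    show "DG\<^sub>p\<^sub>w \<in> bounded_ops V\<^sub>p\<^sub>w (ip_norm a\<^sub>p\<^sub>w) V (ip_norm a)" using diff by (rule has_fderiv_bounded_op)
    show "\<forall>w\<in>V\<^sub>p\<^sub>w. \<forall>z\<in>V. \<forall>z\<^sub>n\<^sub>c\<in>V\<^sub>n\<^sub>c. (\<forall>v\<in>V. a z v = DG\<^sub>p\<^sub>w w v) \<and>
        (\<forall>\<phi>\<in>V\<^sub>n\<^sub>c. a\<^sub>p\<^sub>w z\<^sub>n\<^sub>c \<phi> = DG\<^sub>p\<^sub>w w (J \<phi>)) \<longrightarrow> ip_norm a\<^sub>p\<^sub>w (z - z\<^sub>n\<^sub>c) \<le> \<kappa> * norm_ds (DG\<^sub>p\<^sub>w w)"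
      using \<open>\<forall>\<Phi> \<in> sub_dual V nrm H norm_s. \<forall>z\<in>V. \<forall>z\<^sub>n\<^sub>c\<in>V\<^sub>n\<^sub>c.
           (\<forall>v\<in>V. a z v = \<Phi> v) \<and> (\<forall>w\<in>V\<^sub>n\<^sub>c. a\<^sub>p\<^sub>w z\<^sub>n\<^sub>c w = \<Phi> (J w)) \<longrightarrow>
           pw (z - z\<^sub>n\<^sub>c) \<le> \<kappa> * norm_ds \<Phi>\<close> \<open>\<forall>w\<in>V\<^sub>p\<^sub>w. DG\<^sub>p\<^sub>w w \<in> sub_dual V nrm H norm_s\<close>
      unfolding pw_def by blast
  qed (use assms in \<open>simp_all add: pw_def nrm_def\<close>)
  have G: "G v = G\<^sub>p\<^sub>w v" if "v \<in> V" for v using \<open>\<forall>v\<in>V. G v = G\<^sub>p\<^sub>w v\<close> that by blast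
  \<comment> \<open>The derivatives in the statement are definite descriptions; here they are
    identified with the explicit bilinear forms for which the abstract theorem is stated.\<close>
  have N_op: "DN = (\<lambda>v \<phi>. if v \<in> V \<and> \<phi> \<in> V then a v \<phi> + DG\<^sub>p\<^sub>w v \<phi> else 0)"
    unfolding DN_def nrm_def by (rule fderiv_N_op(1)[OF diff Gpw_dual G F \<open>uh \<in> V\<close>])
  have N_ops: "(\<lambda>v \<phi>. if v \<in> V \<and> \<phi> \<in> V then a v \<phi> + DG\<^sub>p\<^sub>w v \<phi> else 0) \<in> bounded_ops V (ip_norm a) V (ip_norm a)"
    by (rule fderiv_N_op(2)[OF diff Gpw_dual G F \<open>uh \<in> V\<close>])
  have Nh_op: "DN\<^sub>h = (\<lambda>v \<phi>. if v \<in> V\<^sub>p\<^sub>w \<and> \<phi> \<in> V\<^sub>n\<^sub>c then a\<^sub>p\<^sub>w v \<phi> + DG\<^sub>p\<^sub>w v (J \<phi>) else 0)"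
    unfolding DN\<^sub>h_def pw_def by (rule fderiv_Nh_op[OF diff Gpw_dual F \<open>uh \<in> V\<close>])
  have C\<^sub>T: "C\<^sub>T = \<kappa> * C2 + C3 * op_norm V\<^sub>n\<^sub>c (ip_norm a\<^sub>p\<^sub>w) (ip_norm a) J"
    by (simp add: C\<^sub>T_def pw_def nrm_def)
  have \<beta>\<^sub>h: "\<beta>\<^sub>h = inf_sup V\<^sub>n\<^sub>c (ip_norm a\<^sub>p\<^sub>w)
      (\<lambda>v \<phi>. if v \<in> V\<^sub>p\<^sub>w \<and> \<phi> \<in> V\<^sub>n\<^sub>c then a\<^sub>p\<^sub>w v \<phi> + DG\<^sub>p\<^sub>w v (J \<phi>) else 0)"
    unfolding \<beta>\<^sub>h_def Nh_op pw_def ..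
  have compact: "maps_bounded_to_relcompact V (ip_norm a) V (ip_norm a) G"
    using \<open>maps_bounded_to_relcompact V nrm V nrm G\<close> by (simp add: nrm_def)
  have small: "\<kappa> * spectral_norm (vector [vector [(1 + C\<^sub>T) * C1, C\<^sub>T * C2], vector [\<beta>\<^sub>h * C1, \<beta>\<^sub>h * C2]]) < \<beta>\<^sub>h"
    using \<open>\<kappa> * spectral_norm M < \<beta>\<^sub>h\<close> by (simp add: M_def)
  note conclusion = inf_sup_and_bijective[OF \<beta>\<^sub>h small[unfolded C\<^sub>T] N_ops diff Gpw_dual G \<open>uh \<in> V\<close> compact]
  show ?thesis
    using conclusion N_ops
    unfolding \<beta>\<^sub>0_def M_def N2_def C\<^sub>T N_op nrm_def by blast
qed

end
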